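(* Fix $a<b$, $K\ge1$, $\sigma>0$, $x_0\in[a,b]$ and a probability density $p_X$ on $[a,b]$ with $\inf_{[a,b]}p_X>0$ and $\|p_X\|_{L^\infty[a,b]}\vee\|p_X'\|_{L^\infty[a,b]}<\infty$. Let $\mathcal{U}_{x_0}\subset\mathcal{R}_{x_0}$ be a family of tuples $\vartheta=(p_X,f,\{\lambda_k\}_{k=1}^K,\{m_k\}_{k=1}^K)$ (all with this $p_X$, and with $f=\phi_\sigma\ast G_0$) satisfying: (C1) $\sup_{\vartheta\in\mathcal{U}_{x_0}}\operatorname{diam}(\operatorname{supp}(G_0))<\infty$ and $\sup_{\vartheta\in\mathcal{U}_{x_0}}\big(\max_k\|m_k\|_{L^\infty[a,b]}\vee\max_k\|m_k'\|_{L^\infty[a,b]}\big)<\infty$; (C2) $\inf_{\vartheta\in\mathcal{U}_{x_0}}\min_j\lambda_j>0$ and $\inf_{\vartheta\in\mathcal{U}_{x_0}}\min_{j\ne k}|\lambda_j-\lambda_k|>0$; (C3) $\inf_{\vartheta\in\mathcal{U}_{x_0}}\big[\min_{j\ne k}|m_j(x_0)-m_k(x_0)|-2\operatorname{diam}(\operatorname{supp}(G_0))\big]>0$; (C4) there is a function $J>0$ on $\mathbb{R}$ with $\inf_{\vartheta\in\mathcal{U}_{x_0}}|(\mathcal{F}G_0)(t)|\ge J(t)$ for every $t\in\mathbb{R}$; (C5) for every sequence $a_n\to0$, $\sup_{\vartheta\in\mathcal{U}_{x_0}}\operatorname{Leb}\big(\{x\in[a,b]:\exists\, j\ne k,\ |m_j(x)-m_k(x)|\le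 a_n\}\big)\to0$. Index the components so that $\lambda_1<\dots<\lambda_K$. Then there exist estimators $\widehat f_n$, $\{\widehat\lambda_{n,k}\}_{k=1}^K$, $\{\widehat m_{n,k}\}_{k=1}^K$ based on $n$ i.i.d. samples $\{(X_i,Y_i)\}_{i=1}^n$ from the joint density such that for every $\varepsilon>0$, $$\sup_{\vartheta\in\mathcal{U}_{x_0}}\mathbb{P}\Big(\|\widehat f_n-f\|_1\vee\max_k|\widehat\lambda_{n,k}-\lambda_k|\vee\max_k\|\widehat m_{n,k}-m_k\|_{L^1[a,b]}>\varepsilon\Big)\xrightarrow{n\to\infty}0.$$
   Context: $\phi_\sigma$ is the density of $\mathcal{N}(0,\sigma^2)$; $(\phi_\sigma\ast G)(y)=\int\phi_\sigma(y-\theta)\,dG(\theta)$ for a probability measure $G$ on $\mathbb{R}$. $\mathcal{F}G$ is the Fourier transform (characteristic function) of $G$, $\operatorname{Leb}$ is Lebesgue measure, $\|\cdot\|_1$ the $L^1(\mathbb{R})$ norm. $\mathcal{R}_{x_0}$ is the set of tuples $(p_X,f,\{\lambda_k\}_{k=1}^K,\{m_k\}_{k=1}^K)$ with $p_X$ a probability density on $[a,b]$ with $\inf_{[a,b]}p_X>0$, $f$ a probability density on $\mathbb{R}$ with $\int yf(y)\,dy=0$, $\min_k\lambda_k>0$, $\sum_k\lambda_k=1$, $m_k$ continuous on $[a,b]$, and such that: (A1) $f=\phi_\sigma\ast G_0$ for some compactly supported probability measure $G_0$; (A2) $\min_{j\ne k}|\lambda_j-\lambda_k|>0$; (A3) $\min_{j\ne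 k}|m_j(x_0)-m_k(x_0)|>2\operatorname{diam}(\operatorname{supp}(G_0))$; (A4) $\{x\in[a,b]:\exists\, j\ne k,\ m_j(x)=m_k(x)\}$ is countable. In (C1) the $m_k$ are differentiable. The joint density on $[a,b]\times\mathbb{R}$ is $p(x,y)=p_X(x)\sum_{k=1}^K\lambda_kf(y-m_k(x))$, and $\mathbb{P}$ is the law of the sample under $\vartheta$. Estimators are functions of the sample which may depend on known quantities ($a,b,K,\sigma,x_0$, and the family $\mathcal{U}_{x_0}$) but not on the individual $\vartheta$. *)

theory Defs
  imports "HOL-Probability.Probability"
begin

definition lborel_on :: "real \<Rightarrow> real \<Rightarrow> real measure" where
  "lborel_on a b = restrict_space lborel {a..b}"

definition prob_density :: "'a measure \<Rightarrow> ('a \<Rightarrow> real) \<Rightarrow> bool" where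
  "prob_density M p \<longleftrightarrow>
     p \<in> borel_measurable M \<and> (\<forall>x\<in>space M. 0 \<le> p x) \<and> (\<integral>\<^sup>+ x. ennreal (p x) \<partial>M) = 1"

text \<open>The norms take extended values, so that they are \<open>\<infinity>\<close>, and not a default value,
  at functions outside the space in question.\<close>

definition L1_norm :: "'a measure \<Rightarrow> ('a \<Rightarrow> real) \<Rightarrow> ennreal" where
  "L1_norm M g = (\<integral>\<^sup>+ x. ennreal \<bar>g x\<bar> \<partial>M)"

definition Linf_norm :: "'a measure \<Rightarrow> ('a \<Rightarrow> real) \<Rightarrow> ereal" where
  "Linf_norm M g = esssup M (\<lambda>x. ereal \<bar>g x\<bar>)"

text \<open>The derivative on \<open>[a,b]\<close> is one-sided at the end points.\<close>

definition deriv_on :: "real \<Rightarrow> real \<Rightarrow> (real \<Rightarrow> real) \<Rightarrow> real \<Rightarrow> real" where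
  "deriv_on a b g x = vector_derivative g (at x within {a..b})"

definition measure_support :: "'a::topological_space measure \<Rightarrow> 'a set" where
  "measure_support G = {x. \<forall>V. open V \<longrightarrow> x \<in> V \<longrightarrow> 0 < emeasure G V}"

definition gauss_conv :: "real \<Rightarrow> real measure \<Rightarrow> real \<Rightarrow> real" where
  "gauss_conv \<sigma> G y = (\<integral>\<theta>. normal_density 0 \<sigma> (y - \<theta>) \<partial>G)"

text \<open>\<open>G\<close> is determined by \<open>f\<close>, since the characteristic function of a Gaussian has no zero.\<close>

definition is_mixing_measure :: "real \<Rightarrow> (real \<Rightarrow> real) \<Rightarrow> real measure \<Rightarrow> bool" where
  "is_mixing_measure \<sigma> f G \<longleftrightarrow>
     real_distribution G \<and> compact (measure_support G) \<and> f = gauss_conv \<sigma> G"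

text \<open>The tuple \<open>(p\<^sub>X, f, (\<lambda>\<^sub>k), (m\<^sub>k))\<close>. Components are indexed by \<open>{1..K}\<close>;
  values of \<open>wt\<close> and \<open>reg\<close> at other indices, and values of \<open>covdens\<close> and \<open>reg k\<close>
  outside \<open>[a,b]\<close>, carry no meaning.\<close>

record mixreg =
  covdens :: "real \<Rightarrow> real"
  errdens :: "real \<Rightarrow> real"
  wt :: "nat \<Rightarrow> real"
  reg :: "nat \<Rightarrow> real \<Rightarrow> real"

text \<open>\<open>min\<^bsub>j\<noteq>k\<^esub> |c\<^sub>j - c\<^sub>k|\<close>, which is \<open>\<infinity>\<close> if \<open>K = 1\<close>.\<close>

definition min_sep :: "nat \<Rightarrow> (nat \<Rightarrow> real) \<Rightarrow> ereal" where
  "min_sep K c = (INF (j, k) \<in> {(j, k). j \<in> {1..K} \<and> k \<in> {1..K} \<and> j \<noteq> k}. ereal \<bar>c j - c k\<bar>)"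

definition model_class ::
  "real \<Rightarrow> real \<Rightarrow> nat \<Rightarrow> real \<Rightarrow> real \<Rightarrow> mixreg set"
where
  "model_class a b K \<sigma> x0 = {\<theta>.
     prob_density (lborel_on a b) (covdens \<theta>) \<and>
     (INF x\<in>{a..b}. covdens \<theta> x) > 0 \<and>
     prob_density lborel (errdens \<theta>) \<and>
     has_bochner_integral lborel (\<lambda>y. y * errdens \<theta> y) 0 \<and>
     Min (wt \<theta> ` {1..K}) > 0 \<and>
     (\<Sum>k\<in>{1..K}. wt \<theta> k) = 1 \<and>
     (\<forall>k\<in>{1..K}. continuous_on {a..b} (reg \<theta> k)) \<and>
     (\<exists>G0. is_mixing_measure \<sigma> (errdens \<theta>) G0 \<and>
        min_sep K (\<lambda>k. reg \<theta> k x0) > ereal (2 * diameter (measure_support G0))) \<and>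
     min_sep K (wt \<theta>) > 0 \<and>
     countable {x\<in>{a..b}. \<exists>j\<in>{1..K}. \<exists>k\<in>{1..K}. j \<noteq> k \<and> reg \<theta> j x = reg \<theta> k x}}"

definition joint_density :: "nat \<Rightarrow> mixreg \<Rightarrow> real \<times> real \<Rightarrow> real" where
  "joint_density K \<theta> = (\<lambda>(x, y).
     covdens \<theta> x * (\<Sum>k\<in>{1..K}. wt \<theta> k * errdens \<theta> (y - reg \<theta> k x)))"

definition joint_law :: "real \<Rightarrow> real \<Rightarrow> nat \<Rightarrow> mixreg \<Rightarrow> (real \<times> real) measure" where
  "joint_law a b K \<theta> =
     density (lborel_on a b \<Otimes>\<^sub>M lborel) (\<lambda>z. ennreal (joint_density K \<theta> z))"

definition sample_law ::
  "real \<Rightarrow> real \<Rightarrow> nat \<Rightarrow> nat \<Rightarrow> mixreg \<Rightarrow> (nat \<Rightarrow> real \<times> real) measure"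
where
  "sample_law a b K n \<theta> = (\<Pi>\<^sub>M i\<in>{1..n}. joint_law a b K \<theta>)"

text \<open>Only the measurable structure of this measure is used.\<close>

definition sample_space :: "real \<Rightarrow> real \<Rightarrow> nat \<Rightarrow> (nat \<Rightarrow> real \<times> real) measure" where
  "sample_space a b n = (\<Pi>\<^sub>M i\<in>{1..n}. restrict_space borel {a..b} \<Otimes>\<^sub>M borel)"

text \<open>Estimators are measurable functions of the sample. For a function-valued estimator this
  means joint measurability in the sample and the argument, which makes its \<open>L\<^sup>1\<close>-distance
  to a fixed function a random variable.\<close>

definition scalar_estimator ::
  "real \<Rightarrow> real \<Rightarrow> nat \<Rightarrow> ((nat \<Rightarrow> real \<times> real) \<Rightarrow> real) \<Rightarrow> bool"
where
  "scalar_estimator a b n T \<longleftrightarrow> T \<in> borel_measurable (sample_space a b n)"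

definition function_estimator ::
  "real \<Rightarrow> real \<Rightarrow> nat \<Rightarrow> real set \<Rightarrow> ((nat \<Rightarrow> real \<times> real) \<Rightarrow> real \<Rightarrow> real) \<Rightarrow> bool"
where
  "function_estimator a b n S T \<longleftrightarrow>
     (\<lambda>(\<omega>, x). T \<omega> x) \<in> borel_measurable (sample_space a b n \<Otimes>\<^sub>M restrict_space borel S)"

end

theory Submission
  imports Defs "HOL-Complex_Analysis.Complex_Analysis" "HOL-Real_Asymp.Real_Asymp"
begin

text \<open>The estimator is a minimum distance estimator over a countable subset of \<open>U\<close>: it returns the first
  parameter whose expectations of the first \<open>n\<close> test functions \<open>1{x \<le> q} cos (t y)\<close>, \<open>1{x \<le> q} sin (t y)\<close>
  (\<open>q\<close>, \<open>t\<close> rational) agree with the empirical means up to \<open>n powr (-1/4)\<close>. By Hoeffding's inequality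
  its expectations are uniformly close to the true ones, so the claim reduces to a uniform form of
  identifiability: parameters with close expectations are close. That follows by compactness
  (Helly for \<open>G\<^sub>0\<close>, Arzela--Ascoli for the regression functions) from identifiability of the limits.
  For these, the expectations determine the law \<open>\<Sum>\<^sub>k \<lambda>\<^sub>k \<delta>(m\<^sub>k(x)) * G\<^sub>0\<close> at every \<open>x\<close>. At \<open>x\<^sub>0\<close>
  the translates of the support of \<open>G\<^sub>0\<close> are separated clusters, which gives the weights and, since \<open>G\<^sub>0\<close>
  has mean zero, \<open>G\<^sub>0\<close>. At almost every other \<open>x\<close> dividing by the characteristic function of \<open>G\<^sub>0\<close>
  leaves a discrete law with distinct atoms, which are labelled by their distinct weights.\<close>

section \<open>Uniform consistency of minimum distance selection\<close>

text \<open>The obstacle is uniformity: \<open>U\<close> carries no topology and is not closed, so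
  limits of its tuples may leave it. Its hypotheses are therefore recast as non-strict inequalities
  with fixed constants, which survive limits. (C5) survives as the statement that limiting
  regression functions differ almost everywhere, which is what identification of the limits asks
  for. The weights do the labelling: a uniform gap keeps them strictly ordered in the limit, so no
  permutation has to be tracked from one \<open>x\<close> to the next. Separation holds only at
  \<open>x0\<close>; elsewhere clusters may overlap. Once the noise is known from \<open>x0\<close>
  and cancelled, a mixture with noise concentrated at 0 remains, and the cluster argument applies
  again with intervals of length 0. The Gaussian factor of the characteristic functions is common to
  all tuples and vanishes nowhere, so it drops out when moments are compared. Countably many
  candidates make the selection measurable. The tolerance exceeds the usual fluctuation
  \<open>n powr (-1/2)\<close> by enough to pay for a union bound over \<open>n\<close>
  tests.\<close>

lemma empirical_mean_deviation:
  fixes P :: "'a measure" and g :: "'a \<Rightarrow> real"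
  assumes P: "prob_space P" and g[measurable]: "g \<in> borel_measurable P"
    and g1: "\<And>z. z \<in> space P \<Longrightarrow> \<bar>g z\<bar> \<le> 1" and "\<delta> \<ge> 0" and "n > 0"
  shows "measure (\<Pi>\<^sub>M i\<in>{1..n}. P)
      {\<omega> \<in> space (\<Pi>\<^sub>M i\<in>{1..n}. P). \<bar>(\<Sum>i=1..n. g (\<omega> i)) / n - (\<integral>z. g z \<partial>P)\<bar> \<ge> \<delta>}
    \<le> 2 * exp (- real n * \<delta>\<^sup>2 / 2)"
proof -
  interpret P: prob_space P by (rule P)
  let ?Q = "\<Pi>\<^sub>M i\<in>{1..n}. P"
  have Q: "prob_space ?Q" by (rule prob_space_PiM) (rule P)
  interpret Q: prob_space ?Q by (rule Q)
  have distr: "distr ?Q borel (\<lambda>\<omega>. g (\<omega> i)) = distr P borel g" if "i \<in> {1..n}" for i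
  proof -
    have "distr P borel g = distr (distr ?Q P (\<lambda>\<omega>. \<omega> i)) borel g"
      by (subst distr_PiM_component) (use that P in auto)
    also have "\<dots> = distr ?Q borel (g \<circ> (\<lambda>\<omega>. \<omega> i))"
      by (rule distr_distr) (use that in measurable)
    finally show ?thesis by (simp add: comp_def)
  qed
  \<comment> \<open>Independence is checked as an identity of joint laws: the coordinatewise
    push-forward of a product measure is the product of the push-forwards.\<close>
  have indep: "Q.indep_vars (\<lambda>_. borel) (\<lambda>i \<omega>. g (\<omega> i)) {1..n}"
  proof (subst Q.indep_vars_iff_distr_eq_PiM')
    show "{1..n} \<noteq> {}" using \<open>n > 0\<close> by auto
    show "(\<lambda>\<omega>. g (\<omega> i)) \<in> borel_measurable ?Q" if "i \<in> {1..n}" for i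
      using that by measurable
    have "distr ?Q (\<Pi>\<^sub>M i\<in>{1..n}. borel) (compose {1..n} g) = (\<Pi>\<^sub>M i\<in>{1..n}. distr P borel g)"
    proof -
      let ?N = "distr P borel g"
      interpret N: prob_space ?N by (rule P.prob_space_distr) simp
      have "distr ?Q (\<Pi>\<^sub>M i\<in>{1..n}. ?N) (compose {1..n} g) = (\<Pi>\<^sub>M i\<in>{1..n}. distr P ?N g)"
        by (rule distr_PiM_finite_prob_space') (use P N.prob_space_axioms in auto)
      moreover have "distr P ?N g = distr P borel g"
        by (rule distr_cong) auto
      moreover have "distr ?Q (\<Pi>\<^sub>M i\<in>{1..n}. ?N) (compose {1..n} g)
          = distr ?Q (\<Pi>\<^sub>M i\<in>{1..n}. borel) (compose {1..n} g)"
        by (rule distr_cong) (auto intro!: sets_PiM_cong)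
      ultimately show ?thesis by simp
    qed
    also have "\<dots> = (\<Pi>\<^sub>M i\<in>{1..n}. distr ?Q borel (\<lambda>\<omega>. g (\<omega> i)))"
      by (rule PiM_cong[OF refl]) (rule distr[symmetric])
    finally show "distr ?Q (\<Pi>\<^sub>M i\<in>{1..n}. borel) (\<lambda>x. \<lambda>i\<in>{1..n}. g (x i))
        = (\<Pi>\<^sub>M i\<in>{1..n}. distr ?Q borel (\<lambda>\<omega>. g (\<omega> i)))"
      by (simp add: compose_def cong: distr_cong)
  qed
  have one: "(1::nat) \<in> {1..n}" using \<open>n > 0\<close> by auto
  have meas1 [measurable]: "(\<lambda>\<omega>. g (\<omega> 1)) \<in> borel_measurable ?Q"
    by (rule measurable_compose[OF measurable_component_singleton[OF one] g])
  have mu: "(\<integral>\<omega>. g (\<omega> 1) \<partial>?Q) = (\<integral>z. g z \<partial>P)"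
  proof -
    have "(\<integral>\<omega>. g (\<omega> 1) \<partial>?Q) = (\<integral>x. x \<partial>distr ?Q borel (\<lambda>\<omega>. g (\<omega> 1)))"
      by (rule integral_distr[symmetric, OF meas1]) simp
    also have "\<dots> = (\<integral>x. x \<partial>distr P borel g)" by (simp only: distr[OF one])
    also have "\<dots> = (\<integral>z. g z \<partial>P)" by (rule integral_distr) auto
    finally show ?thesis .
  qed
  have "Hoeffding_ineq_iid ?Q {1..n} (\<lambda>i \<omega>. g (\<omega> i)) (\<lambda>\<omega>. g (\<omega> 1)) (-1) 1"
  proof unfold_locales
    show "Q.indep_vars (\<lambda>_. borel) (\<lambda>i \<omega>. g (\<omega> i)) {1..n}" by (rule indep)
    show "distr ?Q borel (\<lambda>\<omega>. g (\<omega> i)) = distr ?Q borel (\<lambda>\<omega>. g (\<omega> 1))" if "i \<in> {1..n}" for i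
      by (simp only: distr[OF one] distr[OF that])
    show "AE x in ?Q. g (x 1) \<in> {- 1..1}"
    proof (rule AE_I2)
      fix x assume "x \<in> space ?Q"
      then have "x 1 \<in> space P" using one by (auto simp: space_PiM PiE_def Pi_def)
      from g1[OF this] show "g (x 1) \<in> {- 1..1}" by (auto simp: abs_le_iff)
    qed
  qed (rule meas1 finite_atLeastAtMost)+
  then interpret H: Hoeffding_ineq_iid ?Q "{1..n}" "\<lambda>i \<omega>. g (\<omega> i)" "\<lambda>\<omega>. g (\<omega> 1)" "-1" 1
    "\<integral>\<omega>. g (\<omega> 1) \<partial>?Q" .
  \<comment> \<open>The interval [-1, 1] has length 2, so Hoeffding's exponent 2 n \<delta>^2 / 2^2
    becomes n \<delta>^2 / 2.\<close>
  have "measure ?Q {\<omega> \<in> space ?Q. \<bar>(\<Sum>i=1..n. g (\<omega> i)) / card {1..n} - (\<integral>\<omega>. g (\<omega> 1) \<partial>?Q)\<bar> \<ge> \<delta>}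
     \<le> 2 * exp (- 2 * real (card {1..n}) * \<delta>\<^sup>2 / (1 - (-1))\<^sup>2)"
    by (rule H.Hoeffding_ineq_abs_ge') (use \<open>n > 0\<close> \<open>\<delta> \<ge> 0\<close> in auto)
  then show ?thesis unfolding mu by (simp add: power2_eq_square mult_ac)
qed

text \<open>For each mesh 1/M and each number of features, feature space is cut into cubes coded by
  integer lists, and one element of \<open>U\<close> is chosen from every cube that contains one.
  The codes are countable, and two elements of a cube differ by at most 1/M in each feature. Density
  is thus meant in the features only.\<close>

lemma countable_feature_dense:
  fixes T :: "'t \<Rightarrow> nat \<Rightarrow> real"
  assumes "U \<noteq> {}"
  obtains c :: "nat \<Rightarrow> 't" where "range c \<subseteq> U"
    "\<And>\<theta> (N::nat) \<delta>. \<theta> \<in> U \<Longrightarrow> \<delta> > 0 \<Longrightarrow> \<exists>j. \<forall>i<N. \<bar>T (c j) i - T \<theta> i\<bar> \<le> \<delta>"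
proof -
  define cell where "cell M N \<theta> = map (\<lambda>i. \<lfloor>real M * T \<theta> i\<rfloor>) [0..<N]" for M N \<theta>
  \<comment> \<open>Codes of empty cubes are sent to an arbitrary element, which keeps the range
    inside \<open>U\<close>.\<close>
  define c' :: "nat \<times> int list \<Rightarrow> 't" where "c' = (\<lambda>(M, zs).
    if \<exists>\<theta>\<in>U. cell M (length zs) \<theta> = zs then SOME \<theta>. \<theta> \<in> U \<and> cell M (length zs) \<theta> = zs
    else SOME \<theta>. \<theta> \<in> U)"
  have U: "(SOME \<theta>. \<theta> \<in> U) \<in> U" using assms by (simp add: some_in_eq)
  have c1: "c' (M, zs) \<in> U \<and> cell M (length zs) (c' (M, zs)) = zs"
    if "\<theta> \<in> U" "cell M (length zs) \<theta> = zs" for M zs \<theta>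
  proof -
    have ex: "\<exists>\<theta>\<in>U. cell M (length zs) \<theta> = zs" using that by auto
    then have "\<exists>\<theta>. \<theta> \<in> U \<and> cell M (length zs) \<theta> = zs" by auto
    from someI_ex[OF this] show ?thesis using ex by (simp add: c'_def)
  qed
  have c2: "c' p \<in> U" for p
  proof (cases p)
    case (Pair M zs)
    show ?thesis
    proof (cases "\<exists>\<theta>\<in>U. cell M (length zs) \<theta> = zs")
      case True
      then obtain \<theta> where "\<theta> \<in> U" "cell M (length zs) \<theta> = zs" by auto
      from c1[OF this] show ?thesis by (simp add: Pair)
    next
      case False
      then show ?thesis using U by (simp add: Pair c'_def)
    qed
  qed
  show ?thesis
  proof (rule that[of "\<lambda>n. c' (from_nat n)"])
    show "range (\<lambda>n. c' (from_nat n)) \<subseteq> U" by (rule image_subsetI) (rule c2)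
    fix \<theta> and N :: nat and \<delta> :: real assume \<theta>: "\<theta> \<in> U" and "\<delta> > 0"
    then obtain M :: nat where M: "1 / \<delta> < M" using reals_Archimedean2 by blast
    then have M0: "real M > 0" using \<open>\<delta> > 0\<close> by (meson divide_pos_pos less_trans zero_less_one)
    have M1: "1 / real M \<le> \<delta>" using M M0 \<open>\<delta> > 0\<close> by (simp add: field_simps)
    let ?p = "(M, cell M N \<theta>)"
    have len: "length (cell M N \<theta>) = N" by (simp add: cell_def)
    have "cell M N (c' ?p) = cell M N \<theta>" using c1[of \<theta> M "cell M N \<theta>"] \<theta> by (simp add: len)
    then have eq: "\<lfloor>real M * T (c' ?p) i\<rfloor> = \<lfloor>real M * T \<theta> i\<rfloor>" if "i < N" for i
      using that by (auto simp: cell_def)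
    have "\<bar>T (c' ?p) i - T \<theta> i\<bar> \<le> \<delta>" if "i < N" for i
    proof -
      have "\<bar>real M * T (c' ?p) i - real M * T \<theta> i\<bar> \<le> 1"
        using eq[OF that] by linarith
      then have "real M * \<bar>T (c' ?p) i - T \<theta> i\<bar> \<le> 1"
        using M0 by (simp add: abs_mult flip: right_diff_distrib)
      then have "\<bar>T (c' ?p) i - T \<theta> i\<bar> \<le> 1 / real M" using M0 by (simp add: field_simps)
      then show ?thesis using M1 by linarith
    qed
    then show "\<exists>j. \<forall>i<N. \<bar>T (c' (from_nat j)) i - T \<theta> i\<bar> \<le> \<delta>"
      by (intro exI[of _ "to_nat ?p"]) simp
  qed
qed

text \<open>On the event that the first \<open>n\<close> empirical means are within
  \<open>d n / 2\<close> of their expectations, a candidate within \<open>d n / 2\<close> of the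
  truth passes the search. Whichever candidate is selected then lies within
  \<open>3 / 2 * d n\<close> of the truth in these features, and \<open>ident\<close> turns this
  into small loss. The bound for the complement does not involve the parameter, whence the
  supremum.\<close>

lemma uniformly_consistent_selection:
  fixes P :: "'t \<Rightarrow> 'a measure" and g :: "nat \<Rightarrow> 'a \<Rightarrow> real" and loss :: "'t \<Rightarrow> 't \<Rightarrow> ennreal"
  assumes U: "U \<noteq> {}"
    and P: "\<And>\<theta>. \<theta> \<in> U \<Longrightarrow> prob_space (P \<theta>)" "\<And>\<theta>. \<theta> \<in> U \<Longrightarrow> sets (P \<theta>) = sets M"
    and g[measurable]: "\<And>i. g i \<in> borel_measurable M"
    and g1: "\<And>i z. z \<in> space M \<Longrightarrow> \<bar>g i z\<bar> \<le> 1"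
    and ident: "\<And>\<epsilon>. \<epsilon> > 0 \<Longrightarrow> \<exists>(N::nat) \<delta>. \<delta> > 0 \<and> (\<forall>\<theta>\<in>U. \<forall>\<theta>'\<in>U.
      (\<forall>i<N. \<bar>(\<integral>z. g i z \<partial>P \<theta>) - (\<integral>z. g i z \<partial>P \<theta>')\<bar> \<le> \<delta>) \<longrightarrow> loss \<theta> \<theta>' \<le> ennreal \<epsilon>)"
  obtains c :: "nat \<Rightarrow> 't" and S :: "nat \<Rightarrow> (nat \<Rightarrow> 'a) \<Rightarrow> nat"
  where "range c \<subseteq> U" "\<And>n. S n \<in> measurable (\<Pi>\<^sub>M i\<in>{1..n}. M) (count_space UNIV)"
    "\<And>\<epsilon>. \<epsilon> > 0 \<Longrightarrow> (\<lambda>n. SUP \<theta>\<in>U. emeasure (\<Pi>\<^sub>M i\<in>{1..n}. P \<theta>)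
      {\<omega> \<in> space (\<Pi>\<^sub>M i\<in>{1..n}. P \<theta>). loss (c (S n \<omega>)) \<theta> > ennreal \<epsilon>}) \<longlonglongrightarrow> 0"
proof -
  define T where "T \<theta> i = (\<integral>z. g i z \<partial>P \<theta>)" for \<theta> i
  obtain c :: "nat \<Rightarrow> 't" where c: "range c \<subseteq> U"
    and dense: "\<And>\<theta> (N::nat) \<delta>. \<theta> \<in> U \<Longrightarrow> \<delta> > 0 \<Longrightarrow> \<exists>j. \<forall>i<N. \<bar>T (c j) i - T \<theta> i\<bar> \<le> \<delta>"
    using countable_feature_dense[OF U, of T] by blast
  \<comment> \<open>With this choice the union bound is 2 n exp(- sqrt n / 8), which tends to 0, and
    so does \<open>d n\<close>. Any exponent strictly between -1/2 and 0 has this effect.\<close>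
  define d :: "nat \<Rightarrow> real" where "d n = real n powr (-1/4)" for n
  define emp where "emp n i \<omega> = (\<Sum>k=1..n. g i (\<omega> k)) / real n" for n i and \<omega> :: "nat \<Rightarrow> 'a"
  \<comment> \<open>If no candidate passes, \<open>LEAST\<close> is an unspecified number. It still
    indexes an element of \<open>U\<close>, and this happens only on the exceptional event.\<close>
  define S where "S n \<omega> = (LEAST j. \<forall>i<n. \<bar>emp n i \<omega> - T (c j) i\<bar> \<le> d n)" for n \<omega>
  have emp_meas [measurable]: "emp n i \<in> borel_measurable (\<Pi>\<^sub>M i\<in>{1..n}. M)" for n i
    unfolding emp_def by measurable
  have S_meas: "S n \<in> measurable (\<Pi>\<^sub>M i\<in>{1..n}. M) (count_space UNIV)" for n
    unfolding S_def by measurable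
  have bound: "emeasure (\<Pi>\<^sub>M i\<in>{1..n}. P \<theta>)
      {\<omega> \<in> space (\<Pi>\<^sub>M i\<in>{1..n}. P \<theta>). loss (c (S n \<omega>)) \<theta> > ennreal \<epsilon>}
      \<le> ennreal (real n * (2 * exp (- real n * (d n / 2)\<^sup>2 / 2)))"
    if \<theta>: "\<theta> \<in> U" and n: "n > 0" "n \<ge> N" "3 / 2 * d n \<le> \<delta>"
      and N: "\<And>\<theta> \<theta>'. \<theta> \<in> U \<Longrightarrow> \<theta>' \<in> U \<Longrightarrow> (\<forall>i<N. \<bar>T \<theta> i - T \<theta>' i\<bar> \<le> \<delta>) \<Longrightarrow> loss \<theta> \<theta>' \<le> ennreal \<epsilon>"
    for \<theta> and n N :: nat and \<delta> \<epsilon>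
  proof -
    let ?Q = "\<Pi>\<^sub>M i\<in>{1..n}. P \<theta>"
    have "prob_space ?Q" by (rule prob_space_PiM) (rule P[OF \<theta>])
    then interpret Q: prob_space ?Q .
    have sets[measurable_cong]: "sets (P \<theta>) = sets M" by (rule P(2)[OF \<theta>])
    have sp: "space (P \<theta>) = space M" by (rule sets_eq_imp_space_eq[OF sets])
    have dn: "d n > 0" using n by (simp add: d_def)
    define E where "E i = {\<omega> \<in> space ?Q. \<bar>(\<Sum>k=1..n. g i (\<omega> k)) / n - (\<integral>z. g i z \<partial>P \<theta>)\<bar> \<ge> d n / 2}" for i
    have gP [measurable]: "g i \<in> borel_measurable (P \<theta>)" for i
      by measurable
    have E_sets: "E i \<in> sets ?Q" for i
      unfolding E_def by measurable
    have E_meas: "measure ?Q (E i) \<le> 2 * exp (- real n * (d n / 2)\<^sup>2 / 2)" for i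
      unfolding E_def by (rule empirical_mean_deviation) (use P(1)[OF \<theta>] n dn g1 in \<open>auto simp: sp\<close>)
    have sub: "{\<omega> \<in> space ?Q. loss (c (S n \<omega>)) \<theta> > ennreal \<epsilon>} \<subseteq> (\<Union>i<n. E i)"
    proof
      fix \<omega> assume "\<omega> \<in> {\<omega> \<in> space ?Q. loss (c (S n \<omega>)) \<theta> > ennreal \<epsilon>}"
      then have \<omega>: "\<omega> \<in> space ?Q" and bad: "loss (c (S n \<omega>)) \<theta> > ennreal \<epsilon>" by auto
      show "\<omega> \<in> (\<Union>i<n. E i)"
      proof (rule ccontr)
        assume "\<omega> \<notin> (\<Union>i<n. E i)"
        then have good: "\<bar>emp n i \<omega> - T \<theta> i\<bar> \<le> d n / 2" if "i < n" for i
          using that \<omega> by (fastforce simp: E_def emp_def T_def not_le)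
        obtain j where j: "\<forall>i<n. \<bar>T (c j) i - T \<theta> i\<bar> \<le> d n / 2"
          using dense[OF \<theta>, of "d n / 2" n] dn by auto
        have "\<forall>i<n. \<bar>emp n i \<omega> - T (c j) i\<bar> \<le> d n"
        proof (intro allI impI)
          fix i assume "i < n"
          then show "\<bar>emp n i \<omega> - T (c j) i\<bar> \<le> d n"
            using good[of i] j[rule_format, of i] by linarith
        qed
        then have S: "\<forall>i<n. \<bar>emp n i \<omega> - T (c (S n \<omega>)) i\<bar> \<le> d n"
          unfolding S_def by (rule LeastI)
        have "\<forall>i<N. \<bar>T (c (S n \<omega>)) i - T \<theta> i\<bar> \<le> \<delta>"
        proof (intro allI impI)
          fix i assume "i < N"
          then have "i < n" using n by simp
          then show "\<bar>T (c (S n \<omega>)) i - T \<theta> i\<bar> \<le> \<delta>"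
            using good[of i] S[rule_format, of i] n(3) by linarith
        qed
        then have "loss (c (S n \<omega>)) \<theta> \<le> ennreal \<epsilon>" by (intro N) (use c \<theta> in auto)
        then show False using bad by simp
      qed
    qed
    have "emeasure ?Q {\<omega> \<in> space ?Q. loss (c (S n \<omega>)) \<theta> > ennreal \<epsilon>} \<le> emeasure ?Q (\<Union>i<n. E i)"
      by (rule emeasure_mono[OF sub]) (use E_sets in auto)
    also have "\<dots> = ennreal (measure ?Q (\<Union>i<n. E i))" by (rule Q.emeasure_eq_measure)
    also have "measure ?Q (\<Union>i<n. E i) \<le> (\<Sum>i<n. measure ?Q (E i))"
      by (rule Q.finite_measure_subadditive_finite) (use E_sets in auto)
    also have "\<dots> \<le> (\<Sum>i<n. 2 * exp (- real n * (d n / 2)\<^sup>2 / 2))"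
      by (rule sum_mono) (rule E_meas)
    finally show ?thesis by (simp add: ennreal_leI)
  qed
  show ?thesis
  proof (rule that[OF c S_meas])
    fix \<epsilon> :: real assume "\<epsilon> > 0"
    from ident[OF this] obtain N :: nat and \<delta> where "\<delta> > 0"
      and N: "\<And>\<theta> \<theta>'. \<theta> \<in> U \<Longrightarrow> \<theta>' \<in> U \<Longrightarrow> (\<forall>i<N. \<bar>T \<theta> i - T \<theta>' i\<bar> \<le> \<delta>) \<Longrightarrow> loss \<theta> \<theta>' \<le> ennreal \<epsilon>"
      unfolding T_def by blast
    have "(\<lambda>n. real n * (2 * exp (- real n * (d n / 2)\<^sup>2 / 2))) \<longlonglongrightarrow> 0"
      unfolding d_def by real_asymp
    then have lim: "(\<lambda>n. ennreal (real n * (2 * exp (- real n * (d n / 2)\<^sup>2 / 2)))) \<longlonglongrightarrow> 0"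
      by (metis ennreal_0 tendsto_ennrealI)
    have "(\<lambda>n. 3 / 2 * d n) \<longlonglongrightarrow> 0" unfolding d_def by real_asymp
    then have "eventually (\<lambda>n. 3 / 2 * d n < \<delta>) sequentially"
      using \<open>\<delta> > 0\<close> by (rule order_tendstoD)
    then have ev: "eventually (\<lambda>n. (SUP \<theta>\<in>U. emeasure (\<Pi>\<^sub>M i\<in>{1..n}. P \<theta>)
      {\<omega> \<in> space (\<Pi>\<^sub>M i\<in>{1..n}. P \<theta>). loss (c (S n \<omega>)) \<theta> > ennreal \<epsilon>})
      \<le> ennreal (real n * (2 * exp (- real n * (d n / 2)\<^sup>2 / 2)))) sequentially"
      using eventually_gt_at_top[of "0::nat"] eventually_ge_at_top[of N]
    proof eventually_elim
      case (elim n)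
      show ?case by (rule SUP_least, rule bound[OF _ elim(2,3) _ N]) (use elim in auto)
    qed
    show "(\<lambda>n. SUP \<theta>\<in>U. emeasure (\<Pi>\<^sub>M i\<in>{1..n}. P \<theta>)
      {\<omega> \<in> space (\<Pi>\<^sub>M i\<in>{1..n}. P \<theta>). loss (c (S n \<omega>)) \<theta> > ennreal \<epsilon>}) \<longlonglongrightarrow> 0"
      by (rule tendsto_sandwich[OF _ ev tendsto_const lim]) auto
  qed
qed

section \<open>Identifiability of location mixtures\<close>

text \<open>The convolution of \<open>G\<close> with the discrete law that has mass
  \<open>l k\<close> at \<open>m k\<close>. As a push-forward of a product measure it gets its
  integrals, masses and characteristic function from Fubini.\<close>

definition location_mixture :: "'k set \<Rightarrow> ('k \<Rightarrow> real) \<Rightarrow> ('k \<Rightarrow> real) \<Rightarrow> real measure \<Rightarrow> real measure" where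
  "location_mixture I l m G =
     distr (point_measure I (\<lambda>k. ennreal (l k)) \<Otimes>\<^sub>M G) borel (\<lambda>(k, x). m k + x)"

context
  fixes I :: "'k set" and l m :: "'k \<Rightarrow> real" and G :: "real measure"
  assumes I: "finite I" and l: "\<And>k. k \<in> I \<Longrightarrow> 0 \<le> l k" "(\<Sum>k\<in>I. l k) = 1"
    and G: "real_distribution G"
begin

lemma prob_space_weights: "prob_space (point_measure I (\<lambda>k. ennreal (l k)))"
proof
  have "emeasure (point_measure I (\<lambda>k. ennreal (l k))) I = (\<Sum>k\<in>I. ennreal (l k))"
    by (rule emeasure_point_measure_finite) (use I in auto)
  also have "\<dots> = ennreal 1" using l by (subst sum_ennreal) auto
  finally show "emeasure (point_measure I (\<lambda>k. ennreal (l k))) (space (point_measure I (\<lambda>k. ennreal (l k)))) = 1"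
    by (simp add: space_point_measure)
qed

lemma measurable_location_map:
  "(\<lambda>(k, x). m k + x) \<in> borel_measurable (point_measure I (\<lambda>k. ennreal (l k)) \<Otimes>\<^sub>M G)"
proof -
  interpret G: real_distribution G by (rule G)
  have "m \<in> borel_measurable (point_measure I (\<lambda>k. ennreal (l k)))" by (simp add: measurable_point_measure_eq1)
  then show ?thesis by measurable
qed

lemma real_distribution_location_mixture: "real_distribution (location_mixture I l m G)"
proof -
  interpret G: real_distribution G by (rule G)
  interpret W: prob_space "point_measure I (\<lambda>k. ennreal (l k))" by (rule prob_space_weights)
  interpret WG: pair_prob_space "point_measure I (\<lambda>k. ennreal (l k))" G ..
  show ?thesis unfolding location_mixture_def
    by (rule WG.real_distribution_distr) (rule measurable_location_map)
qed

lemma integral_location_mixture: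
  fixes h :: "real \<Rightarrow> 'b::{banach, second_countable_topology}"
  assumes [measurable]: "h \<in> borel_measurable borel" and b: "\<And>x. norm (h x) \<le> C"
  shows "(\<integral>x. h x \<partial>location_mixture I l m G) = (\<Sum>k\<in>I. l k *\<^sub>R (\<integral>x. h (m k + x) \<partial>G))"
proof -
  interpret G: real_distribution G by (rule G)
  interpret W: prob_space "point_measure I (\<lambda>k. ennreal (l k))" by (rule prob_space_weights)
  interpret WG: pair_prob_space "point_measure I (\<lambda>k. ennreal (l k))" G ..
  note measurable_location_map[measurable]
  have "(\<integral>x. h x \<partial>location_mixture I l m G)
     = (\<integral>p. h ((\<lambda>(k, x). m k + x) p) \<partial>(point_measure I (\<lambda>k. ennreal (l k)) \<Otimes>\<^sub>M G))"
    unfolding location_mixture_def by (rule integral_distr) (auto intro: measurable_location_map)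
  also have "\<dots> = (\<integral>k. \<integral>x. h ((\<lambda>(k, x). m k + x) (k, x)) \<partial>G \<partial>point_measure I (\<lambda>k. ennreal (l k)))"
    by (rule WG.integral_fst'[symmetric], rule WG.integrable_const_bound[of _ C])
       (use b in \<open>auto intro!: measurable_compose[OF measurable_location_map]\<close>)
  also have "\<dots> = (\<Sum>k\<in>I. l k *\<^sub>R (\<integral>x. h (m k + x) \<partial>G))"
    using lebesgue_integral_point_measure_finite[of I l] I l(1) by (simp add: comp_def)
  finally show ?thesis .
qed

lemma measure_location_mixture:
  assumes [measurable]: "B \<in> sets borel"
  shows "measure (location_mixture I l m G) B = (\<Sum>k\<in>I. l k * measure G ((\<lambda>x. m k + x) -` B))"
proof -
  interpret G: real_distribution G by (rule G)
  interpret Q: real_distribution "location_mixture I l m G" by (rule real_distribution_location_mixture)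
  have "measure (location_mixture I l m G) B = (\<integral>x. indicator B x \<partial>location_mixture I l m G)"
    by simp
  also have "\<dots> = (\<Sum>k\<in>I. l k *\<^sub>R (\<integral>x. indicator B (m k + x) \<partial>G))"
    by (rule integral_location_mixture[where C = 1]) (auto simp: indicator_def)
  also have "\<dots> = (\<Sum>k\<in>I. l k *\<^sub>R (\<integral>x. indicator ((\<lambda>x. m k + x) -` B) x \<partial>G))"
    by (simp add: indicator_def)
  finally show ?thesis by simp
qed

lemma char_location_mixture:
  "char (location_mixture I l m G) t = (\<Sum>k\<in>I. l k * iexp (t * m k)) * char G t"
proof -
  have "char (location_mixture I l m G) t = (\<Sum>k\<in>I. l k *\<^sub>R (\<integral>x. iexp (t * (m k + x)) \<partial>G))"
    unfolding char_def by (rule integral_location_mixture[where C = 1]) auto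
  also have "\<dots> = (\<Sum>k\<in>I. l k * iexp (t * m k) * char G t)"
    by (intro sum.cong refl) (simp add: char_def scaleR_conv_of_real distrib_left exp_add)
  finally show ?thesis by (simp add: sum_distrib_right)
qed

end

text \<open>Both functions list the same finite set in increasing order, and the sorted list of a
  set is unique.\<close>

lemma strict_mono_on_same_image:
  fixes l l' :: "nat \<Rightarrow> real"
  assumes "strict_mono_on {1..K} l" "strict_mono_on {1..K} l'" "l ` {1..K} = l' ` {1..K}"
  shows "\<forall>k\<in>{1..K}. l k = l' k"
proof -
  have *: "sorted_wrt (<) (map l [1..<Suc K])" if "strict_mono_on {1..K} l" for l :: "nat \<Rightarrow> real"
    unfolding sorted_wrt_map
    by (rule sorted_wrt_mono_rel[OF _ sorted_wrt_upt]) (use that in \<open>auto simp: strict_mono_on_def\<close>)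
  have "map l [1..<Suc K] = map l' [1..<Suc K]"
    by (rule strict_sorted_equal) (use *[OF assms(1)] *[OF assms(2)] assms(3) in
      \<open>auto simp: atLeastLessThanSuc_atLeastAtMost simp del: upt_Suc\<close>)
  then show ?thesis by (auto simp: map_eq_conv simp del: upt_Suc)
qed

text \<open>The components are recovered as the clusters of the support. The interval of one mixture
  cannot meet two intervals of the mixture with the wider noise, so the two families of intervals
  match.\<close>

lemma location_clusters_match:
  fixes l m l' m' :: "nat \<Rightarrow> real" and G G' :: "real measure"
  assumes G: "real_distribution G" "real_distribution G'"
    and sup: "AE x in G. x \<in> {\<alpha>..\<beta>}" "AE x in G'. x \<in> {\<alpha>'..\<beta>'}"
    and wider: "\<beta>' - \<alpha>' \<le> \<beta> - \<alpha>"
    and l: "\<And>k. k \<in> {1..K} \<Longrightarrow> 0 < l k" "\<And>k. k \<in> {1..K} \<Longrightarrow> 0 < l' k"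
    and sep: "\<And>j k. j \<in> {1..K} \<Longrightarrow> k \<in> {1..K} \<Longrightarrow> j \<noteq> k \<Longrightarrow> \<bar>m j - m k\<bar> > 2 * (\<beta> - \<alpha>)"
    and eq: "\<And>B. B \<in> sets borel \<Longrightarrow> (\<Sum>k\<in>{1..K}. l k * measure G ((\<lambda>x. m k + x) -` B))
        = (\<Sum>k\<in>{1..K}. l' k * measure G' ((\<lambda>x. m' k + x) -` B))"
  obtains \<tau> where "bij_betw \<tau> {1..K} {1..K}"
    "\<And>i B. i \<in> {1..K} \<Longrightarrow> B \<in> sets borel \<Longrightarrow>
      l (\<tau> i) * measure G ((\<lambda>x. m (\<tau> i) + x) -` B) = l' i * measure G' ((\<lambda>x. m' i + x) -` B)"
proof -
  interpret G: real_distribution G by (rule G)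
  interpret G': real_distribution G' by (rule G)
  define c where "c k B = measure G ((\<lambda>x. m k + x) -` B)" for k B
  define c' where "c' k B = measure G' ((\<lambda>x. m' k + x) -` B)" for k B
  define A where "A k = {m k + \<alpha>..m k + \<beta>}" for k
  define A' where "A' k = {m' k + \<alpha>'..m' k + \<beta>'}" for k
  have A_sets [measurable]: "A k \<in> sets borel" "A' k \<in> sets borel" for k
    by (auto simp: A_def A'_def)
  have vimage [measurable]: "(\<lambda>x. u + x) -` B \<in> sets borel" if "B \<in> sets borel" for u :: real and B
    using measurable_sets_borel[of "\<lambda>x. u + x" borel B] that by auto
  have c_inter: "c k (B \<inter> A k) = c k B" if "B \<in> sets borel" for k B
    unfolding c_def
    by (rule G.finite_measure_eq_AE) (use sup(1) that in \<open>auto simp: A_def\<close>)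
  have c'_inter: "c' k (B \<inter> A' k) = c' k B" if "B \<in> sets borel" for k B
    unfolding c'_def
    by (rule G'.finite_measure_eq_AE) (use sup(2) that in \<open>auto simp: A'_def\<close>)
  have c_UNIV: "c k UNIV = 1" "c' k UNIV = 1" for k
    using G.prob_space G'.prob_space by (auto simp: c_def c'_def)
  have c_A: "c k (A k) = 1" "c' k (A' k) = 1" for k
    using c_inter[of UNIV k] c'_inter[of UNIV k] by (auto simp: c_UNIV)
  have c_nonneg: "0 \<le> c k B" "0 \<le> c' k B" for k B by (auto simp: c_def c'_def)
  have c_empty: "c k {} = 0" "c' k {} = 0" for k by (auto simp: c_def c'_def)
  have eqc: "(\<Sum>k\<in>{1..K}. l k * c k B) = (\<Sum>k\<in>{1..K}. l' k * c' k B)" if "B \<in> sets borel" for B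
    using eq[OF that] by (simp add: c_def c'_def)
  have pos: "0 < (\<Sum>k\<in>{1..K}. l' k * c' k (A' i))" "0 < (\<Sum>k\<in>{1..K}. l k * c k (A i))" if "i \<in> {1..K}" for i
    using that l c_nonneg by (auto intro!: sum_pos2[of _ i] mult_nonneg_nonneg simp: c_A less_imp_le)
  \<comment> \<open>The second mixture gives \<open>A' i\<close> at least the mass
    \<open>l' i\<close>, whereas the first is carried by the \<open>A j\<close>.\<close>
  have ex1: "\<exists>j\<in>{1..K}. A' i \<inter> A j \<noteq> {}" if i: "i \<in> {1..K}" for i
  proof (rule ccontr)
    assume "\<not> ?thesis"
    then have "c k (A' i) = 0" if "k \<in> {1..K}" for k
      using c_inter[of "A' i" k] that by (auto simp: c_empty)
    then have "(\<Sum>k\<in>{1..K}. l k * c k (A' i)) = 0" by simp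
    then show False using pos(1)[OF i] eqc[of "A' i"] by simp
  qed
  have ex2: "\<exists>i\<in>{1..K}. A' i \<inter> A j \<noteq> {}" if j: "j \<in> {1..K}" for j
  proof (rule ccontr)
    assume "\<not> ?thesis"
    then have "c' k (A j) = 0" if "k \<in> {1..K}" for k
      using c'_inter[of "A j" k] that by (auto simp: c_empty Int_commute)
    then have "(\<Sum>k\<in>{1..K}. l' k * c' k (A j)) = 0" by simp
    then show False using pos(2)[OF j] eqc[of "A j"] by simp
  qed
  \<comment> \<open>Points of \<open>A' i\<close> are at most
    \<open>\<beta>' - \<alpha>' \<le> \<beta> - \<alpha>\<close> apart, and a point of
    \<open>A j\<close> is \<open>m j\<close> plus an element of \<open>{\<alpha>..\<beta>}\<close>.
    Meeting both \<open>A j\<close> and \<open>A k\<close> thus forces the distance of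
    \<open>m j\<close> and \<open>m k\<close> to be at most \<open>2 * (\<beta> - \<alpha>)\<close>.
    This is the origin of the factor 2 in the separation.\<close>
  have uniq: "j = k" if "j \<in> {1..K}" "k \<in> {1..K}" "A' i \<inter> A j \<noteq> {}" "A' i \<inter> A k \<noteq> {}" for i j k
  proof (rule ccontr)
    assume "j \<noteq> k"
    from sep[OF that(1,2) this] have "\<bar>m j - m k\<bar> > 2 * (\<beta> - \<alpha>)" .
    then show False using that(3,4) wider by (auto simp: A_def A'_def)
  qed
  have disj: "A j \<inter> A k = {}" if "j \<in> {1..K}" "k \<in> {1..K}" "j \<noteq> k" for j k
    using sep[OF that] by (auto simp: A_def)
  obtain \<tau> where \<tau>: "\<And>i. i \<in> {1..K} \<Longrightarrow> \<tau> i \<in> {1..K}" "\<And>i. i \<in> {1..K} \<Longrightarrow> A' i \<inter> A (\<tau> i) \<noteq> {}"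
    using bchoice[of "{1..K}" "\<lambda>i j. j \<in> {1..K} \<and> A' i \<inter> A j \<noteq> {}"] ex1 by blast
  have surj: "\<tau> ` {1..K} = {1..K}"
  proof
    show "\<tau> ` {1..K} \<subseteq> {1..K}" using \<tau>(1) by (rule image_subsetI)
    show "{1..K} \<subseteq> \<tau> ` {1..K}"
    proof
      fix j assume j: "j \<in> {1..K}"
      from ex2[OF this] obtain i where i: "i \<in> {1..K}" "A' i \<inter> A j \<noteq> {}" by blast
      have "j = \<tau> i" by (rule uniq[OF j \<tau>(1)[OF i(1)] i(2) \<tau>(2)[OF i(1)]])
      then show "j \<in> \<tau> ` {1..K}" using i(1) by (rule image_eqI)
    qed
  qed
  have inj: "inj_on \<tau> {1..K}" by (rule eq_card_imp_inj_on) (simp_all only: surj finite_atLeastAtMost)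
  have bij: "bij_betw \<tau> {1..K} {1..K}" unfolding bij_betw_def using inj surj by blast
  \<comment> \<open>Evaluating both mixtures at \<open>B \<inter> A (\<tau> i)\<close> leaves one
    component on each side: the \<open>A k\<close> are disjoint, and \<open>A' k\<close> meets
    \<open>A (\<tau> i)\<close> only for \<open>k = i\<close>.\<close>
  have "l (\<tau> i) * c (\<tau> i) B = l' i * c' i B" if i: "i \<in> {1..K}" and [measurable]: "B \<in> sets borel" for i B
  proof -
    let ?j = "\<tau> i"
    have j: "?j \<in> {1..K}" by (rule \<tau>(1)[OF i])
    have zero: "c' k (B \<inter> A ?j) = 0" if k: "k \<in> {1..K}" "k \<noteq> i" for k B
    proof -
      have "A' k \<inter> A ?j = {}"
      proof (rule ccontr)
        assume "A' k \<inter> A ?j \<noteq> {}"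
        then have "\<tau> k = ?j" using uniq[OF \<tau>(1)[OF k(1)] j \<tau>(2)[OF k(1)]] by blast
        then show False using inj_onD[OF inj _ k(1) i] k(2) by blast
      qed
      then have "c' k (A ?j) = 0" using c'_inter[of "A ?j" k] by (simp add: c_empty Int_commute)
      moreover have "c' k (B \<inter> A ?j) \<le> c' k (A ?j)"
        unfolding c'_def by (rule G'.finite_measure_mono) auto
      ultimately show ?thesis using c_nonneg(2)[of k "B \<inter> A ?j"] by linarith
    qed
    have first: "l ?j * c ?j B = (\<Sum>k\<in>{1..K}. l k * c k (B \<inter> A ?j))"
    proof -
      have "(\<Sum>k\<in>{1..K}. l k * c k (B \<inter> A ?j)) = (\<Sum>k\<in>{1..K}. if k = ?j then l ?j * c ?j B else 0)"
      proof (rule sum.cong[OF refl])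
        fix k assume k: "k \<in> {1..K}"
        show "l k * c k (B \<inter> A ?j) = (if k = ?j then l ?j * c ?j B else 0)"
        proof (cases "k = ?j")
          case True
          then show ?thesis by (simp add: c_inter)
        next
          case False
          have "B \<inter> A ?j \<inter> A k = {}" using disj[OF j k] False by blast
          then have "c k (B \<inter> A ?j) = 0" using c_inter[of "B \<inter> A ?j" k] by (simp add: c_empty)
          then show ?thesis using False by simp
        qed
      qed
      then show ?thesis using j by simp
    qed
    have second: "(\<Sum>k\<in>{1..K}. l' k * c' k (B \<inter> A ?j)) = l' i * c' i (B \<inter> A ?j)"
    proof -
      have "(\<Sum>k\<in>{1..K}. l' k * c' k (B \<inter> A ?j)) = (\<Sum>k\<in>{1..K}. if k = i then l' i * c' i (B \<inter> A ?j) else 0)"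
        by (rule sum.cong[OF refl]) (use zero in auto)
      then show ?thesis using i by simp
    qed
    \<comment> \<open>\<open>A' i\<close> meets no \<open>A k\<close> other than
      \<open>A (\<tau> i)\<close>, so the first mixture has no mass on the difference. By equality
      and positivity of \<open>l' i\<close>, the restriction to \<open>A (\<tau> i)\<close> costs
      \<open>c' i\<close> nothing.\<close>
    have null: "c' i (A' i - A ?j) = 0"
    proof -
      have "(\<Sum>k\<in>{1..K}. l k * c k (A' i - A ?j)) = 0"
      proof (rule sum.neutral, intro ballI)
        fix k assume k: "k \<in> {1..K}"
        have "(A' i - A ?j) \<inter> A k = {}"
        proof (cases "k = ?j")
          case False
          then have "A' i \<inter> A k = {}" using uniq[OF k j _ \<tau>(2)[OF i]] by blast
          then show ?thesis by blast
        qed auto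
        then have "c k (A' i - A ?j) = 0" using c_inter[of "A' i - A ?j" k] by (simp add: c_empty)
        then show "l k * c k (A' i - A ?j) = 0" by simp
      qed
      then have "(\<Sum>k\<in>{1..K}. l' k * c' k (A' i - A ?j)) = 0" using eqc[of "A' i - A ?j"] by simp
      then have "\<forall>k\<in>{1..K}. l' k * c' k (A' i - A ?j) = 0"
        by (subst (asm) sum_nonneg_eq_0_iff) (use l c_nonneg in \<open>auto intro!: mult_nonneg_nonneg simp: less_imp_le\<close>)
      then have "l' i * c' i (A' i - A ?j) = 0" using i by blast
      then show ?thesis using l(2)[OF i] by simp
    qed
    have "c' i (B \<inter> A ?j) = c' i B"
    proof -
      have "c' i B \<le> c' i (B \<inter> A ?j) + c' i (A' i - A ?j)"
      proof -
        have "c' i B = c' i (B \<inter> A' i)" by (simp add: c'_inter)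
        also have "\<dots> \<le> c' i ((B \<inter> A ?j) \<union> (A' i - A ?j))"
          unfolding c'_def by (rule G'.finite_measure_mono) auto
        also have "\<dots> \<le> c' i (B \<inter> A ?j) + c' i (A' i - A ?j)"
          unfolding c'_def vimage_Un by (rule measure_Un_le) auto
        finally show ?thesis .
      qed
      moreover have "c' i (B \<inter> A ?j) \<le> c' i B"
        unfolding c'_def by (rule G'.finite_measure_mono) auto
      ultimately show ?thesis using null by linarith
    qed
    then show ?thesis using first second eqc[of "B \<inter> A ?j"] by simp
  qed
  then show ?thesis using that[OF bij] unfolding c_def c'_def by blast
qed

text \<open>Equal characteristic functions give equal laws, and the clusters of the common law are
  matched by a bijection. Total masses match the weights, the increasing order makes the bijection
  the identity, and the zero means then separate location from noise, which the law of a single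
  cluster alone cannot do.\<close>

lemma location_mixture_identifiable:
  fixes l m l' m' :: "nat \<Rightarrow> real" and G G' :: "real measure"
  assumes G: "real_distribution G" "real_distribution G'"
    and sup: "AE x in G. x \<in> {\<alpha>..\<beta>}" "AE x in G'. x \<in> {\<alpha>'..\<beta>'}"
    and mean: "(\<integral>x. x \<partial>G) = 0" "(\<integral>x. x \<partial>G') = 0"
    and l: "\<And>k. k \<in> {1..K} \<Longrightarrow> 0 < l k" "(\<Sum>k\<in>{1..K}. l k) = 1" "strict_mono_on {1..K} l"
    and l': "\<And>k. k \<in> {1..K} \<Longrightarrow> 0 < l' k" "(\<Sum>k\<in>{1..K}. l' k) = 1" "strict_mono_on {1..K} l'"
    and sep: "\<And>j k. j \<in> {1..K} \<Longrightarrow> k \<in> {1..K} \<Longrightarrow> j \<noteq> k \<Longrightarrow> \<bar>m j - m k\<bar> > 2 * (\<beta> - \<alpha>)"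
    and sep': "\<And>j k. j \<in> {1..K} \<Longrightarrow> k \<in> {1..K} \<Longrightarrow> j \<noteq> k \<Longrightarrow> \<bar>m' j - m' k\<bar> > 2 * (\<beta>' - \<alpha>')"
    and eq: "\<And>t. (\<Sum>k\<in>{1..K}. l k * iexp (t * m k)) * char G t
        = (\<Sum>k\<in>{1..K}. l' k * iexp (t * m' k)) * char G' t"
  shows "G = G' \<and> (\<forall>k\<in>{1..K}. l k = l' k \<and> m k = m' k)"
proof -
  define Q where "Q = location_mixture {1..K} l m G"
  define Q' where "Q' = location_mixture {1..K} l' m' G'"
  have l0: "\<And>k. k \<in> {1..K} \<Longrightarrow> 0 \<le> l k" "\<And>k. k \<in> {1..K} \<Longrightarrow> 0 \<le> l' k"
    using l(1) l'(1) by (auto simp: less_imp_le)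
  have "Q = Q'"
  proof (rule Levy_uniqueness)
    show "real_distribution Q" unfolding Q_def
      by (rule real_distribution_location_mixture) (use l l0 G in auto)
    show "real_distribution Q'" unfolding Q'_def
      by (rule real_distribution_location_mixture) (use l' l0 G in auto)
    show "char Q = char Q'"
    proof
      fix t
      have "char Q t = (\<Sum>k\<in>{1..K}. l k * iexp (t * m k)) * char G t"
        unfolding Q_def by (rule char_location_mixture) (use l l0 G in auto)
      also have "\<dots> = (\<Sum>k\<in>{1..K}. l' k * iexp (t * m' k)) * char G' t" by (rule eq)
      also have "\<dots> = char Q' t"
        unfolding Q'_def by (rule char_location_mixture[symmetric]) (use l' l0 G in auto)
      finally show "char Q t = char Q' t" .
    qed
  qed
  have meas: "(\<Sum>k\<in>{1..K}. l k * measure G ((\<lambda>x. m k + x) -` B))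
        = (\<Sum>k\<in>{1..K}. l' k * measure G' ((\<lambda>x. m' k + x) -` B))" if "B \<in> sets borel" for B
  proof -
    have "(\<Sum>k\<in>{1..K}. l k * measure G ((\<lambda>x. m k + x) -` B)) = measure Q B"
      unfolding Q_def by (rule measure_location_mixture[symmetric]) (use l l0 G that in auto)
    also have "\<dots> = measure Q' B" by (simp only: \<open>Q = Q'\<close>)
    also have "\<dots> = (\<Sum>k\<in>{1..K}. l' k * measure G' ((\<lambda>x. m' k + x) -` B))"
      unfolding Q'_def by (rule measure_location_mixture) (use l' l0 G that in auto)
    finally show ?thesis .
  qed
  obtain \<tau> where \<tau>: "bij_betw \<tau> {1..K} {1..K}"
    and match: "\<And>i B. i \<in> {1..K} \<Longrightarrow> B \<in> sets borel \<Longrightarrow>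
      l (\<tau> i) * measure G ((\<lambda>x. m (\<tau> i) + x) -` B) = l' i * measure G' ((\<lambda>x. m' i + x) -` B)"
  proof (cases "\<beta>' - \<alpha>' \<le> \<beta> - \<alpha>")
    case True
    show ?thesis
      by (rule location_clusters_match[OF G sup True l(1) l'(1) sep meas]) (use that in auto)
  next
    \<comment> \<open>Now the second noise has the wider interval: the matching is run with
      exchanged roles and its bijection is inverted.\<close>
    case False
    then have "\<beta> - \<alpha> \<le> \<beta>' - \<alpha>'" by simp
    from location_clusters_match[OF G(2,1) sup(2,1) this l'(1) l(1) sep' meas[symmetric]]
    obtain \<rho> where \<rho>: "bij_betw \<rho> {1..K} {1..K}"
      and rm: "\<And>i B. i \<in> {1..K} \<Longrightarrow> B \<in> sets borel \<Longrightarrow>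
        l' (\<rho> i) * measure G' ((\<lambda>x. m' (\<rho> i) + x) -` B) = l i * measure G ((\<lambda>x. m i + x) -` B)"
      by blast
    show ?thesis
    proof (rule that[of "inv_into {1..K} \<rho>"])
      show "bij_betw (inv_into {1..K} \<rho>) {1..K} {1..K}" by (rule bij_betw_inv_into[OF \<rho>])
      fix i and B :: "real set" assume i: "i \<in> {1..K}" and B: "B \<in> sets borel"
      have j: "inv_into {1..K} \<rho> i \<in> {1..K}" "\<rho> (inv_into {1..K} \<rho> i) = i"
        using bij_betwE[OF bij_betw_inv_into[OF \<rho>]] bij_betw_inv_into_right[OF \<rho>] i by blast+
      show "l (inv_into {1..K} \<rho> i) * measure G ((\<lambda>x. m (inv_into {1..K} \<rho> i) + x) -` B)
          = l' i * measure G' ((\<lambda>x. m' i + x) -` B)"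
        using rm[OF j(1) B] unfolding j(2) by simp
    qed
  qed
  interpret G: real_distribution G by (rule G)
  interpret G': real_distribution G' by (rule G)
  \<comment> \<open>\<open>B = UNIV\<close> compares the total masses of matched clusters.\<close>
  have w: "l (\<tau> i) = l' i" if i: "i \<in> {1..K}" for i
    using match[OF i, of UNIV] G.prob_space G'.prob_space by simp
  have "l ` {1..K} = l' ` {1..K}"
  proof -
    have "l ` {1..K} = l ` \<tau> ` {1..K}" using \<tau> by (simp add: bij_betw_def)
    also have "\<dots> = l' ` {1..K}" using w by (auto simp: image_image intro!: image_cong)
    finally show ?thesis .
  qed
  then have ll: "\<forall>k\<in>{1..K}. l k = l' k" by (rule strict_mono_on_same_image[OF l(3) l'(3)])
  have \<tau>id: "\<tau> i = i" if i: "i \<in> {1..K}" for i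
  proof -
    have "\<tau> i \<in> {1..K}" using \<tau> i by (auto dest: bij_betwE)
    moreover have "l (\<tau> i) = l i" using w[OF i] ll i by simp
    ultimately show ?thesis using strict_mono_on_imp_inj_on[OF l(3)] i by (meson inj_onD)
  qed
  have shift: "distr G borel (\<lambda>x. m i + x) = distr G' borel (\<lambda>x. m' i + x)" if i: "i \<in> {1..K}" for i
  proof (rule measure_eqI)
    fix B assume "B \<in> sets (distr G borel (\<lambda>x. m i + x))"
    then have B: "B \<in> sets borel" by simp
    have "l i * measure G ((\<lambda>x. m i + x) -` B) = l i * measure G' ((\<lambda>x. m' i + x) -` B)"
      using match[OF i B] \<tau>id[OF i] ll i by simp
    then have "measure G ((\<lambda>x. m i + x) -` B) = measure G' ((\<lambda>x. m' i + x) -` B)"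
      using l(1)[OF i] by simp
    then show "emeasure (distr G borel (\<lambda>x. m i + x)) B = emeasure (distr G' borel (\<lambda>x. m' i + x)) B"
      using B by (simp add: emeasure_distr G.emeasure_eq_measure G'.emeasure_eq_measure)
  qed simp
  have int: "integrable G (\<lambda>x. x)" "integrable G' (\<lambda>x. x)"
  proof -
    show "integrable G (\<lambda>x. x)"
      by (rule G.integrable_const_bound[of _ "max \<bar>\<alpha>\<bar> \<bar>\<beta>\<bar>"]) (use sup(1) in auto)
    show "integrable G' (\<lambda>x. x)"
      by (rule G'.integrable_const_bound[of _ "max \<bar>\<alpha>'\<bar> \<bar>\<beta>'\<bar>"]) (use sup(2) in auto)
  qed
  \<comment> \<open>Since the noise is centred, \<open>m i\<close> is the mean of the shifted
    law.\<close>
  have mm: "m i = m' i" if i: "i \<in> {1..K}" for i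
  proof -
    have "m i = (\<integral>x. m i + x \<partial>G)" using int mean G.prob_space by simp
    also have "\<dots> = (\<integral>x. x \<partial>distr G borel (\<lambda>x. m i + x))" by (simp add: integral_distr)
    also have "\<dots> = (\<integral>x. x \<partial>distr G' borel (\<lambda>x. m' i + x))" by (simp only: shift[OF i])
    also have "\<dots> = (\<integral>x. m' i + x \<partial>G')" by (simp add: integral_distr)
    also have "\<dots> = m' i" using int mean G'.prob_space by simp
    finally show ?thesis .
  qed
  \<comment> \<open>Weights with sum 1 exclude \<open>K = 0\<close>, so component 1 exists; undoing
    its shift recovers the noise.\<close>
  have "1 \<in> {1..K}" using l(2) by (cases K) auto
  then have "distr (distr G borel (\<lambda>x. m 1 + x)) borel (\<lambda>x. x - m 1)
      = distr (distr G' borel (\<lambda>x. m 1 + x)) borel (\<lambda>x. x - m 1)"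
    using shift[of 1] mm[of 1] by simp
  then have "distr G borel (\<lambda>x. x) = distr G' borel (\<lambda>x. x)"
    by (simp add: distr_distr comp_def)
  then have "G = G'" by (simp add: distr_id2)
  then show ?thesis using ll mm by auto
qed

section \<open>Compactness\<close>

text \<open>Arzela-Ascoli is applied to one index at a time, each time along a subsequence of the
  previous one. Uniform convergence already obtained is inherited by further subsequences.\<close>

lemma finite_family_Arzela_Ascoli:
  fixes F :: "nat \<Rightarrow> 'i \<Rightarrow> real \<Rightarrow> real"
  assumes "finite I"
    and bound: "\<And>n i x. i \<in> I \<Longrightarrow> x \<in> {a..b} \<Longrightarrow> \<bar>F n i x\<bar> \<le> B"
    and lip: "\<And>n i x y. i \<in> I \<Longrightarrow> x \<in> {a..b} \<Longrightarrow> y \<in> {a..b} \<Longrightarrow> \<bar>F n i x - F n i y\<bar> \<le> B * \<bar>x - y\<bar>"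
  shows "\<exists>r g. strict_mono (r :: nat \<Rightarrow> nat) \<and>
    (\<forall>i\<in>I. uniform_limit {a..b} (\<lambda>n. F (r n) i) (g i) sequentially)"
  using assms
proof (induction I rule: finite_induct)
  case empty
  show ?case by (intro exI[of _ id] exI) (simp add: strict_mono_id)
next
  case (insert j I)
  have "\<exists>r g. strict_mono (r :: nat \<Rightarrow> nat) \<and>
    (\<forall>i\<in>I. uniform_limit {a..b} (\<lambda>n. F (r n) i) (g i) sequentially)"
    by (rule insert.IH) (use insert.prems in auto)
  then obtain r g where r: "strict_mono (r :: nat \<Rightarrow> nat)"
    and lim: "\<forall>i\<in>I. uniform_limit {a..b} (\<lambda>n. F (r n) i) (g i) sequentially" by blast
  have B0: "0 \<le> B" if "x \<in> {a..b}" for x using insert.prems(1)[of j x] that by (meson abs_ge_zero insertI1 order_trans)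
  obtain h s where s: "strict_mono (s :: nat \<Rightarrow> nat)"
    and h: "\<And>e. 0 < e \<Longrightarrow> \<exists>N. \<forall>n x. n \<ge> N \<and> x \<in> {a..b} \<longrightarrow> norm (F (r (s n)) j x - h x) < e"
  proof (rule Arzela_Ascoli[of "{a..b}" "\<lambda>n. F (r n) j" B])
    show "\<exists>d>0. \<forall>n y. y \<in> {a..b} \<and> norm (x - y) < d \<longrightarrow> norm (F (r n) j x - F (r n) j y) < e"
      if x: "x \<in> {a..b}" and "0 < e" for x e
    proof (intro exI conjI allI impI)
      \<comment> \<open>\<open>B\<close> may be 0; the 1 is added so that \<open>e / (B + 1)\<close>
        is a legitimate modulus.\<close>
      have B1: "0 < B + 1" using B0[OF x] by linarith
      show "0 < e / (B + 1)" using \<open>0 < e\<close> B1 by simp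
      fix n y assume y: "y \<in> {a..b} \<and> norm (x - y) < e / (B + 1)"
      then have "\<bar>F (r n) j x - F (r n) j y\<bar> \<le> B * \<bar>x - y\<bar>" using insert.prems(2)[of j x y] x by simp
      also have "\<dots> \<le> (B + 1) * \<bar>x - y\<bar>" by (intro mult_right_mono) auto
      also have "\<dots> < e" using y B1 by (simp add: field_simps)
      finally show "norm (F (r n) j x - F (r n) j y) < e" by simp
    qed
  qed (use insert.prems in auto)
  show ?case
  proof (intro exI conjI ballI)
    show "strict_mono (r \<circ> s)" using r s by (rule strict_mono_o)
    fix i assume "i \<in> insert j I"
    show "uniform_limit {a..b} (\<lambda>n. F ((r \<circ> s) n) i) ((g(j := h)) i) sequentially"
    proof (cases "i = j")
      case True
      show ?thesis unfolding uniform_limit_iff True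
      proof (intro allI impI)
        fix e :: real assume "0 < e"
        from h[OF this] obtain N where "\<forall>n x. n \<ge> N \<and> x \<in> {a..b} \<longrightarrow> norm (F (r (s n)) j x - h x) < e" by blast
        then show "\<forall>\<^sub>F n in sequentially. \<forall>x\<in>{a..b}. dist (F ((r \<circ> s) n) j x) ((g(j := h)) j x) < e"
          unfolding eventually_sequentially by (intro exI[of _ N]) (auto simp: dist_norm)
      qed
    next
      case False
      then have "uniform_limit {a..b} (\<lambda>n. F (r n) i) (g i) sequentially"
        using lim \<open>i \<in> insert j I\<close> by blast
      then have "uniform_limit {a..b} (\<lambda>n. F (r (s n)) i) (g i) sequentially"
        unfolding uniform_limit_iff using eventually_subseq[OF s] by blast
      then show ?thesis using False by simp
    qed
  qed
qed

text \<open>Numbers are treated as functions on the one-point interval \<open>{0..0}\<close>, where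
  the Lipschitz condition is trivial and uniform convergence is plain convergence.\<close>

lemma finite_family_bounded_subsequence:
  fixes u :: "nat \<Rightarrow> 'i \<Rightarrow> real"
  assumes "finite I" and bound: "\<And>n i. i \<in> I \<Longrightarrow> \<bar>u n i\<bar> \<le> B"
  shows "\<exists>r v. strict_mono (r :: nat \<Rightarrow> nat) \<and> (\<forall>i\<in>I. (\<lambda>n. u (r n) i) \<longlonglongrightarrow> v i)"
proof -
  have "\<exists>r g. strict_mono (r :: nat \<Rightarrow> nat) \<and>
    (\<forall>i\<in>I. uniform_limit {0..0::real} (\<lambda>n x. u (r n) i) (g i) sequentially)"
    by (rule finite_family_Arzela_Ascoli[OF \<open>finite I\<close>, where F = "\<lambda>n i x. u n i" and B = B]) (use bound in auto)
  then obtain r :: "nat \<Rightarrow> nat" and g where r: "strict_mono r"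
    and "\<forall>i\<in>I. uniform_limit {0..0::real} (\<lambda>n x. u (r n) i) (g i) sequentially" by blast
  then have "\<forall>i\<in>I. (\<lambda>n. u (r n) i) \<longlonglongrightarrow> g i 0"
    using tendsto_uniform_limitI[where x = "0::real"] by fastforce
  with r show ?thesis by (intro exI conjI)
qed

lemma weak_conv_m_subseq:
  assumes "weak_conv_m \<mu> M" "strict_mono (r :: nat \<Rightarrow> nat)"
  shows "weak_conv_m (\<mu> \<circ> r) M"
  unfolding weak_conv_m_def weak_conv_def
proof (intro allI impI)
  fix x assume "isCont (cdf M) x"
  then have "(\<lambda>n. cdf (\<mu> n) x) \<longlonglongrightarrow> cdf M x"
    using assms(1) unfolding weak_conv_m_def weak_conv_def by blast
  from LIMSEQ_subseq_LIMSEQ[OF this assms(2)]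
  show "(\<lambda>n. cdf ((\<mu> \<circ> r) n) x) \<longlonglongrightarrow> cdf M x" by (simp add: comp_def)
qed

lemma tight_bounded_support:
  assumes "\<And>n. real_distribution (G n)" "\<And>n. AE x in G n. x \<in> {-D..D}"
  shows "tight G"
  unfolding tight_def
proof (intro conjI allI impI)
  show "real_distribution (G n)" for n by (rule assms(1))
  fix \<epsilon> :: real assume "\<epsilon> > 0"
  show "\<exists>a b. a < b \<and> (\<forall>n. measure (G n) {a<..b} > 1 - \<epsilon>)"
  proof (intro exI conjI allI)
    \<comment> \<open>The margin 1 keeps the end point \<open>-D\<close> inside an interval that is
      open on the left.\<close>
    show "- \<bar>D\<bar> - 1 < \<bar>D\<bar> + 1" by simp
    fix n
    interpret real_distribution "G n" by (rule assms(1))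
    have "AE x in G n. x \<in> {- \<bar>D\<bar> - 1<..\<bar>D\<bar> + 1}"
      using assms(2)[of n] by eventually_elim auto
    then have "measure (G n) {- \<bar>D\<bar> - 1<..\<bar>D\<bar> + 1} = 1"
      by (subst prob_eq_1) auto
    then show "measure (G n) {- \<bar>D\<bar> - 1<..\<bar>D\<bar> + 1} > 1 - \<epsilon>" using \<open>\<epsilon> > 0\<close> by simp
  qed
qed

text \<open>The test function \<open>g\<close> is the distance to the limiting interval, capped at
  1. It is bounded and continuous, and its integral under \<open>G n\<close> is at most the
  displacement of the end points. So its integral under the limit is 0, and \<open>g\<close>
  vanishes almost surely.\<close>

lemma weak_limit_support_interval:
  assumes G: "\<And>n. real_distribution (G n)" and H: "real_distribution H" and conv: "weak_conv_m G H"
    and sup: "\<And>n. AE x in G n. x \<in> {\<alpha> n..\<beta> n}"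
    and lim: "\<alpha> \<longlonglongrightarrow> \<alpha>'" "\<beta> \<longlonglongrightarrow> \<beta>'"
  shows "AE x in H. x \<in> {\<alpha>'..\<beta>'}"
proof -
  interpret H: real_distribution H by (rule H)
  define g where "g x = min 1 (max 0 (\<alpha>' - x) + max 0 (x - \<beta>'))" for x
  have g0: "0 \<le> g x" "g x \<le> 1" for x by (auto simp: g_def)
  have g_cont: "isCont g x" for x unfolding g_def by (intro continuous_intros)
  have [measurable]: "g \<in> borel_measurable borel"
    by (rule borel_measurable_continuous_onI) (simp add: continuous_at_imp_continuous_on g_cont)
  have "(\<lambda>n. \<integral>x. g x \<partial>G n) \<longlonglongrightarrow> (\<integral>x. g x \<partial>H)"
    by (rule weak_conv_imp_integral_bdd_continuous_conv[OF G H conv g_cont, of 1]) (use g0 in auto)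
  moreover have "(\<lambda>n. \<bar>\<alpha> n - \<alpha>'\<bar> + \<bar>\<beta> n - \<beta>'\<bar>) \<longlonglongrightarrow> \<bar>\<alpha>' - \<alpha>'\<bar> + \<bar>\<beta>' - \<beta>'\<bar>"
    by (intro tendsto_intros lim)
  moreover have "(\<integral>x. g x \<partial>G n) \<le> \<bar>\<alpha> n - \<alpha>'\<bar> + \<bar>\<beta> n - \<beta>'\<bar>" for n
  proof -
    interpret Gn: real_distribution "G n" by (rule G)
    have "(\<integral>x. g x \<partial>G n) \<le> (\<integral>x. \<bar>\<alpha> n - \<alpha>'\<bar> + \<bar>\<beta> n - \<beta>'\<bar> \<partial>G n)"
    proof (rule integral_mono_AE)
      show "integrable (G n) g" by (rule Gn.integrable_const_bound[of _ 1]) (use g0 in auto)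
      show "AE x in G n. g x \<le> \<bar>\<alpha> n - \<alpha>'\<bar> + \<bar>\<beta> n - \<beta>'\<bar>"
        using sup[of n] by eventually_elim (auto simp: g_def)
    qed simp
    then show ?thesis using Gn.prob_space by simp
  qed
  then have "\<exists>N. \<forall>n\<ge>N. (\<integral>x. g x \<partial>G n) \<le> \<bar>\<alpha> n - \<alpha>'\<bar> + \<bar>\<beta> n - \<beta>'\<bar>" by blast
  ultimately have "(\<integral>x. g x \<partial>H) \<le> \<bar>\<alpha>' - \<alpha>'\<bar> + \<bar>\<beta>' - \<beta>'\<bar>"
    by (rule LIMSEQ_le)
  moreover have "0 \<le> (\<integral>x. g x \<partial>H)" using g0 by simp
  ultimately have "(\<integral>x. g x \<partial>H) = 0" by simp
  moreover have "integrable H g" by (rule H.integrable_const_bound[of _ 1]) (use g0 in auto)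
  ultimately have "AE x in H. g x = 0"
    using integral_nonneg_eq_0_iff_AE[of H g] g0 by auto
  then show ?thesis by eventually_elim (auto simp: g_def min_def max_def split: if_splits)
qed

text \<open>The identity is not a bounded test function. Clipping it at \<open>-D\<close> and
  \<open>D\<close> makes it one and changes no integral, because all the laws live on
  \<open>{-D..D}\<close>.\<close>

lemma weak_limit_mean:
  assumes G: "\<And>n. real_distribution (G n)" and H: "real_distribution H" and conv: "weak_conv_m G H"
    and sup: "\<And>n. AE x in G n. x \<in> {-D..D}" "AE x in H. x \<in> {-D..D}"
  shows "(\<lambda>n. \<integral>x. x \<partial>G n) \<longlonglongrightarrow> (\<integral>x. x \<partial>H)"
proof -
  define g where "g x = max (-D) (min D x)" for x
  have g_cont: "isCont g x" for x unfolding g_def by (intro continuous_intros)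
  have [measurable]: "g \<in> borel_measurable borel"
    by (rule borel_measurable_continuous_onI) (simp add: continuous_at_imp_continuous_on g_cont)
  have eq: "(\<integral>x. g x \<partial>M) = (\<integral>x. x \<partial>M)" if "real_distribution M" "AE x in M. x \<in> {-D..D}" for M
  proof -
    interpret M: real_distribution M by (rule that)
    show ?thesis
      by (rule integral_cong_AE) (use that(2) in \<open>auto simp: g_def\<close>)
  qed
  have "(\<lambda>n. \<integral>x. g x \<partial>G n) \<longlonglongrightarrow> (\<integral>x. g x \<partial>H)"
    by (rule weak_conv_imp_integral_bdd_continuous_conv[OF G H conv g_cont, of "\<bar>D\<bar>"])
       (auto simp: g_def)
  then show ?thesis by (simp only: eq[OF G sup(1)] eq[OF H sup(2)])
qed

text \<open>The weights of a member are listed in increasing order, so that its components are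
  labelled as in the theorem. The interval \<open>{\<alpha>..\<beta>}\<close> stands for the convex hull of the support
  of \<open>G\<close>: unlike the support it passes to weak limits.\<close>

locale mixture_class =
  fixes a b x0 B c D :: real and K :: nat and J :: "real \<Rightarrow> real"
  assumes ab: "a < b" and x0: "x0 \<in> {a..b}" and c: "c > 0" and J: "\<And>t. J t > 0"
begin

definition member :: "real measure \<Rightarrow> (nat \<Rightarrow> real) \<Rightarrow> (nat \<Rightarrow> real \<Rightarrow> real) \<Rightarrow> bool" where
  "member G l m \<longleftrightarrow> real_distribution G \<and> (\<integral>x. x \<partial>G) = 0 \<and>
    (\<exists>\<alpha> \<beta>. \<bar>\<alpha>\<bar> \<le> D \<and> \<bar>\<beta>\<bar> \<le> D \<and> (AE x in G. x \<in> {\<alpha>..\<beta>}) \<and>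
      (\<forall>j\<in>{1..K}. \<forall>k\<in>{1..K}. j \<noteq> k \<longrightarrow> 2 * (\<beta> - \<alpha>) + c \<le> \<bar>m j x0 - m k x0\<bar>)) \<and>
    (\<forall>t. J t \<le> cmod (char G t)) \<and>
    (\<forall>k\<in>{1..K}. c \<le> l k) \<and> (\<Sum>k\<in>{1..K}. l k) = 1 \<and>
    (\<forall>j\<in>{1..K}. \<forall>k\<in>{1..K}. j < k \<longrightarrow> l j + c \<le> l k) \<and>
    (\<forall>k\<in>{1..K}. \<forall>x\<in>{a..b}. \<bar>m k x\<bar> \<le> B) \<and>
    (\<forall>k\<in>{1..K}. \<forall>x\<in>{a..b}. \<forall>y\<in>{a..b}. \<bar>m k x - m k y\<bar> \<le> B * \<bar>x - y\<bar>)"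

lemma memberD:
  assumes "member G l m"
  shows "real_distribution G" "(\<integral>x. x \<partial>G) = 0" "J t \<le> cmod (char G t)" "(\<Sum>k\<in>{1..K}. l k) = 1"
    "k \<in> {1..K} \<Longrightarrow> c \<le> l k"
    "j \<in> {1..K} \<Longrightarrow> k \<in> {1..K} \<Longrightarrow> j < k \<Longrightarrow> l j + c \<le> l k"
    "k \<in> {1..K} \<Longrightarrow> x \<in> {a..b} \<Longrightarrow> \<bar>m k x\<bar> \<le> B"
    "k \<in> {1..K} \<Longrightarrow> x \<in> {a..b} \<Longrightarrow> y \<in> {a..b} \<Longrightarrow> \<bar>m k x - m k y\<bar> \<le> B * \<bar>x - y\<bar>"
    "\<exists>\<alpha> \<beta>. \<bar>\<alpha>\<bar> \<le> D \<and> \<bar>\<beta>\<bar> \<le> D \<and> (AE x in G. x \<in> {\<alpha>..\<beta>}) \<and>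
      (\<forall>j\<in>{1..K}. \<forall>k\<in>{1..K}. j \<noteq> k \<longrightarrow> 2 * (\<beta> - \<alpha>) + c \<le> \<bar>m j x0 - m k x0\<bar>)"
proof -
  note * = assms[unfolded member_def]
  show "real_distribution G" using * by (elim conjE)
  show "(\<integral>x. x \<partial>G) = 0" using * by (elim conjE)
  show "J t \<le> cmod (char G t)" using * by (elim conjE) (erule spec)
  show "(\<Sum>k\<in>{1..K}. l k) = 1" using * by (elim conjE)
  have "\<forall>k\<in>{1..K}. c \<le> l k" using * by (elim conjE)
  then show "k \<in> {1..K} \<Longrightarrow> c \<le> l k" by (rule bspec)
  have "\<forall>j\<in>{1..K}. \<forall>k\<in>{1..K}. j < k \<longrightarrow> l j + c \<le> l k" using * by (elim conjE)
  then show "j \<in> {1..K} \<Longrightarrow> k \<in> {1..K} \<Longrightarrow> j < k \<Longrightarrow> l j + c \<le> l k" by (elim ballE) auto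
  have "\<forall>k\<in>{1..K}. \<forall>x\<in>{a..b}. \<bar>m k x\<bar> \<le> B" using * by (elim conjE)
  then show "k \<in> {1..K} \<Longrightarrow> x \<in> {a..b} \<Longrightarrow> \<bar>m k x\<bar> \<le> B" by (elim ballE) auto
  have "\<forall>k\<in>{1..K}. \<forall>x\<in>{a..b}. \<forall>y\<in>{a..b}. \<bar>m k x - m k y\<bar> \<le> B * \<bar>x - y\<bar>" using * by (elim conjE)
  then show "k \<in> {1..K} \<Longrightarrow> x \<in> {a..b} \<Longrightarrow> y \<in> {a..b} \<Longrightarrow> \<bar>m k x - m k y\<bar> \<le> B * \<bar>x - y\<bar>"
    by (elim ballE) auto
  show "\<exists>\<alpha> \<beta>. \<bar>\<alpha>\<bar> \<le> D \<and> \<bar>\<beta>\<bar> \<le> D \<and> (AE x in G. x \<in> {\<alpha>..\<beta>}) \<and>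
      (\<forall>j\<in>{1..K}. \<forall>k\<in>{1..K}. j \<noteq> k \<longrightarrow> 2 * (\<beta> - \<alpha>) + c \<le> \<bar>m j x0 - m k x0\<bar>)"
    using * by (elim conjE)
qed

lemma member_weight_bounds:
  assumes "member G l m" "k \<in> {1..K}"
  shows "0 < l k" "l k \<le> 1"
proof -
  have pos: "\<And>j. j \<in> {1..K} \<Longrightarrow> 0 < l j" using less_le_trans[OF c memberD(5)[OF assms(1)]] .
  then show "0 < l k" using assms(2) by blast
  have "l k \<le> (\<Sum>k\<in>{1..K}. l k)"
    by (rule member_le_sum) (use pos assms(2) in \<open>auto simp: less_imp_le\<close>)
  then show "l k \<le> 1" using memberD(4)[OF assms(1)] by simp
qed

lemma member_strict_mono:
  assumes "member G l m"
  shows "strict_mono_on {1..K} l"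
proof (rule strict_mono_onI)
  show "l j < l k" if "j \<in> {1..K}" "k \<in> {1..K}" "j < k" for j k
    using memberD(6)[OF assms that] c by linarith
qed

text \<open>Every clause of \<open>member\<close> is an equality or a non-strict inequality with
  constants common to the whole sequence, so it passes to limits. These exist along a subsequence by
  Bolzano-Weierstrass for weights and end points, Arzela-Ascoli for the regression functions, and
  tightness for \<open>G\<close>. The bound by \<open>J\<close> passes through Levy's continuity
  theorem.\<close>

lemma member_compact:
  assumes mem: "\<And>n. member (G n) (l n) (m n)"
  shows "\<exists>r H w g. strict_mono (r :: nat \<Rightarrow> nat) \<and> member H w g \<and> weak_conv_m (G \<circ> r) H \<and>
    (\<forall>k\<in>{1..K}. (\<lambda>n. l (r n) k) \<longlonglongrightarrow> w k) \<and>
    (\<forall>k\<in>{1..K}. uniform_limit {a..b} (\<lambda>n. m (r n) k) (g k) sequentially)"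
proof -
  have "\<forall>n. \<exists>p. \<bar>fst p\<bar> \<le> D \<and> \<bar>snd p\<bar> \<le> D \<and> (AE x in G n. x \<in> {fst p..snd p}) \<and>
      (\<forall>j\<in>{1..K}. \<forall>k\<in>{1..K}. j \<noteq> k \<longrightarrow> 2 * (snd p - fst p) + c \<le> \<bar>m n j x0 - m n k x0\<bar>)"
    using memberD(9)[OF mem] by simp
  from choice[OF this] obtain p :: "nat \<Rightarrow> real \<times> real" where
    p: "\<And>n. \<bar>fst (p n)\<bar> \<le> D" "\<And>n. \<bar>snd (p n)\<bar> \<le> D" "\<And>n. AE x in G n. x \<in> {fst (p n)..snd (p n)}"
    and psep: "\<And>n j k. j \<in> {1..K} \<Longrightarrow> k \<in> {1..K} \<Longrightarrow> j \<noteq> k \<Longrightarrow>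
       2 * (snd (p n) - fst (p n)) + c \<le> \<bar>m n j x0 - m n k x0\<bar>"
    by blast
  have G: "real_distribution (G n)" for n by (rule memberD(1)[OF mem])
  have D: "AE x in G n. x \<in> {-D..D}" for n
    using p(3)[of n] by eventually_elim (use p(1,2)[of n] in auto)
  \<comment> \<open>Indices \<open>0\<close> and \<open>Suc K\<close> carry the end points of the interval.\<close>
  define u where "u n i = (if i = 0 then fst (p n) else if i = Suc K then snd (p n) else l n i)" for n i
  have "\<exists>r v. strict_mono (r :: nat \<Rightarrow> nat) \<and> (\<forall>i\<in>{0..Suc K}. (\<lambda>n. u (r n) i) \<longlonglongrightarrow> v i)"
  proof (rule finite_family_bounded_subsequence[where B = "max D 1"])
    fix n i assume i: "i \<in> {0..Suc K}"
    show "\<bar>u n i\<bar> \<le> max D 1"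
    proof (cases "i = 0 \<or> i = Suc K")
      case True
      then show ?thesis using p(1,2)[of n] by (auto simp: u_def le_max_iff_disj)
    next
      case False
      then have "i \<in> {1..K}" using i by auto
      then have "0 < l n i" "l n i \<le> 1" using member_weight_bounds[OF mem[of n]] by auto
      then show ?thesis using False by (simp add: u_def)
    qed
  qed simp
  then obtain r1 :: "nat \<Rightarrow> nat" and v where r1: "strict_mono r1"
    and v: "\<And>i. i \<in> {0..Suc K} \<Longrightarrow> (\<lambda>n. u (r1 n) i) \<longlonglongrightarrow> v i" by blast
  have "\<exists>r g. strict_mono (r :: nat \<Rightarrow> nat) \<and>
    (\<forall>k\<in>{1..K}. uniform_limit {a..b} (\<lambda>n. (\<lambda>n. m (r1 n)) (r n) k) (g k) sequentially)"
    by (rule finite_family_Arzela_Ascoli[where B = B and F = "\<lambda>n. m (r1 n)"])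
       (use memberD(7,8)[OF mem] in auto)
  then obtain r2 :: "nat \<Rightarrow> nat" and g where r2: "strict_mono r2"
    and g: "\<And>k. k \<in> {1..K} \<Longrightarrow> uniform_limit {a..b} (\<lambda>n. m (r1 (r2 n)) k) (g k) sequentially" by blast
  have "tight G" by (rule tight_bounded_support[OF G D])
  from tight_imp_convergent_subsubsequence[OF this strict_mono_o[OF r1 r2]]
  obtain r3 :: "nat \<Rightarrow> nat" and H where r3: "strict_mono r3" and H: "real_distribution H"
    and conv: "weak_conv_m (G \<circ> (r1 \<circ> r2) \<circ> r3) H" by blast
  define r where "r = r1 \<circ> r2 \<circ> r3"
  have r: "strict_mono r" unfolding r_def by (intro strict_mono_o r1 r2 r3)
  have conv: "weak_conv_m (\<lambda>n. G (r n)) H" using conv by (simp add: r_def comp_def)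
  have v: "(\<lambda>n. u (r n) i) \<longlonglongrightarrow> v i" if "i \<in> {0..Suc K}" for i
    using LIMSEQ_subseq_LIMSEQ[OF v[OF that] strict_mono_o[OF r2 r3]] by (simp add: r_def comp_def)
  have \<alpha>: "(\<lambda>n. fst (p (r n))) \<longlonglongrightarrow> v 0" using v[of 0] by (simp add: u_def)
  have \<beta>: "(\<lambda>n. snd (p (r n))) \<longlonglongrightarrow> v (Suc K)" using v[of "Suc K"] by (simp add: u_def)
  have w: "(\<lambda>n. l (r n) k) \<longlonglongrightarrow> v k" if "k \<in> {1..K}" for k using v[of k] that by (simp add: u_def)
  have g: "uniform_limit {a..b} (\<lambda>n. m (r n) k) (g k) sequentially" if "k \<in> {1..K}" for k
    using g[OF that] unfolding uniform_limit_iff r_def comp_def using eventually_subseq[OF r3] by blast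
  have gl: "(\<lambda>n. m (r n) k x) \<longlonglongrightarrow> g k x" if "k \<in> {1..K}" "x \<in> {a..b}" for k x
    using tendsto_uniform_limitI[OF g[OF that(1)] that(2)] .
  have supH: "AE x in H. x \<in> {v 0..v (Suc K)}"
    by (rule weak_limit_support_interval[OF G H conv p(3) \<alpha> \<beta>])
  have vD: "\<bar>v 0\<bar> \<le> D" "\<bar>v (Suc K)\<bar> \<le> D"
    using LIMSEQ_le_const2[OF tendsto_rabs[OF \<alpha>], of D] LIMSEQ_le_const2[OF tendsto_rabs[OF \<beta>], of D] p(1,2) by auto
  have DH: "AE x in H. x \<in> {-D..D}"
    using supH by eventually_elim (use vD in auto)
  have "member H v g"
    unfolding member_def
  proof (intro conjI allI ballI impI exI)
    show "real_distribution H" by (rule H)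
    have "(\<lambda>n. \<integral>x. x \<partial>G (r n)) \<longlonglongrightarrow> (\<integral>x. x \<partial>H)" by (rule weak_limit_mean[OF G H conv D DH])
    moreover have "(\<integral>x. x \<partial>G n) = 0" for n by (rule memberD(2)[OF mem])
    ultimately show "(\<integral>x. x \<partial>H) = 0" by (simp add: LIMSEQ_const_iff)
    show "AE x in H. x \<in> {v 0..v (Suc K)}" by (rule supH)
    show "\<bar>v 0\<bar> \<le> D" "\<bar>v (Suc K)\<bar> \<le> D" by (rule vD)+
    show "2 * (v (Suc K) - v 0) + c \<le> \<bar>g j x0 - g k x0\<bar>" if "j \<in> {1..K}" "k \<in> {1..K}" "j \<noteq> k" for j k
    proof (rule LIMSEQ_le)
      show "(\<lambda>n. 2 * (snd (p (r n)) - fst (p (r n))) + c) \<longlonglongrightarrow> 2 * (v (Suc K) - v 0) + c"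
        by (intro tendsto_intros \<alpha> \<beta>)
      show "(\<lambda>n. \<bar>m (r n) j x0 - m (r n) k x0\<bar>) \<longlonglongrightarrow> \<bar>g j x0 - g k x0\<bar>"
        by (intro tendsto_intros gl that x0)
    qed (use psep[OF that] in blast)
    show "J t \<le> cmod (char H t)" for t
    proof (rule LIMSEQ_le_const)
      show "(\<lambda>n. cmod (char (G (r n)) t)) \<longlonglongrightarrow> cmod (char H t)"
        by (intro tendsto_norm levy_continuity1[OF G H conv])
    qed (use memberD(3)[OF mem] in blast)
    show "c \<le> v k" if "k \<in> {1..K}" for k
      by (rule LIMSEQ_le_const[OF w[OF that]]) (use memberD(5)[OF mem that] in blast)
    have "(\<lambda>n. \<Sum>k\<in>{1..K}. l (r n) k) \<longlonglongrightarrow> (\<Sum>k\<in>{1..K}. v k)" by (intro tendsto_sum w)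
    moreover have "(\<Sum>k\<in>{1..K}. l (r n) k) = 1" for n by (rule memberD(4)[OF mem])
    ultimately show "(\<Sum>k\<in>{1..K}. v k) = 1" by (simp add: LIMSEQ_const_iff)
    show "v j + c \<le> v k" if "j \<in> {1..K}" "k \<in> {1..K}" "j < k" for j k
      by (rule LIMSEQ_le[OF tendsto_add[OF w[OF that(1)] tendsto_const] w[OF that(2)]])
         (use memberD(6)[OF mem that] in blast)
    show "\<bar>g k x\<bar> \<le> B" if "k \<in> {1..K}" "x \<in> {a..b}" for k x
      by (rule LIMSEQ_le_const2[OF tendsto_rabs[OF gl[OF that]]]) (use memberD(7)[OF mem that] in blast)
    show "\<bar>g k x - g k y\<bar> \<le> B * \<bar>x - y\<bar>" if "k \<in> {1..K}" "x \<in> {a..b}" "y \<in> {a..b}" for k x y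
      by (rule LIMSEQ_le_const2[OF tendsto_rabs[OF tendsto_diff[OF gl[OF that(1,2)] gl[OF that(1,3)]]]])
         (use memberD(8)[OF mem that] in blast)
  qed
  moreover have "weak_conv_m (G \<circ> r) H" using conv by (simp only: comp_def)
  moreover have "\<forall>k\<in>{1..K}. (\<lambda>n. l (r n) k) \<longlonglongrightarrow> v k" using w by (rule ballI)
  moreover have "\<forall>k\<in>{1..K}. uniform_limit {a..b} (\<lambda>n. m (r n) k) (g k) sequentially" using g by (rule ballI)
  ultimately show ?thesis using r by (intro exI conjI)
qed

end

section \<open>Gaussian convolutions and the joint law\<close>

lemma normal_density_le: "\<sigma> > 0 \<Longrightarrow> normal_density \<mu> \<sigma> x \<le> 1 / sqrt (2 * pi * \<sigma>\<^sup>2)"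
  unfolding normal_density_def by (rule mult_left_le) auto

lemma borel_measurable_gauss_conv [measurable]:
  assumes "real_distribution G"
  shows "gauss_conv \<sigma> G \<in> borel_measurable borel"
proof -
  interpret G: real_distribution G by (rule assms)
  show ?thesis unfolding gauss_conv_def by measurable
qed

lemma gauss_conv_nonneg: "0 \<le> gauss_conv \<sigma> G y"
  unfolding gauss_conv_def by (rule Bochner_Integration.integral_nonneg) simp

lemma gauss_conv_nn_integral:
  assumes "real_distribution G" "\<sigma> > 0"
  shows "ennreal (gauss_conv \<sigma> G y) = (\<integral>\<^sup>+x. ennreal (normal_density 0 \<sigma> (y - x)) \<partial>G)"
proof -
  interpret G: real_distribution G by (rule assms)
  show ?thesis unfolding gauss_conv_def
    by (rule nn_integral_eq_integral[symmetric], rule G.integrable_const_bound[of _ "1 / sqrt (2 * pi * \<sigma>\<^sup>2)"])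
       (use normal_density_le[OF assms(2)] in auto)
qed

text \<open>Tonelli and a translation of Lebesgue measure identify the density as that of a sum of
  independent variables. Total mass, characteristic function and mean are then read off from the
  product measure.\<close>

lemma gauss_conv_law:
  assumes G: "real_distribution G" and "\<sigma> > 0"
  shows "density lborel (\<lambda>y. ennreal (gauss_conv \<sigma> G y))
    = distr (density lborel (\<lambda>z. ennreal (normal_density 0 \<sigma> z)) \<Otimes>\<^sub>M G) borel (\<lambda>(z, x). z + x)"
    (is "?L = distr (?N \<Otimes>\<^sub>M G) borel _")
proof (rule measure_eqI)
  interpret G: real_distribution G by (rule G)
  interpret N: prob_space ?N by (rule prob_space_normal_density[OF \<open>\<sigma> > 0\<close>])
  interpret NG: pair_prob_space ?N G ..
  interpret LG: pair_sigma_finite lborel G ..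
  note borel_measurable_gauss_conv[OF G, measurable]
  have NGm[measurable]: "(\<lambda>(z, x). z + x) \<in> borel_measurable (?N \<Otimes>\<^sub>M G)" by measurable
  fix B assume "B \<in> sets ?L"
  then have [measurable]: "B \<in> sets borel" by simp
  have "emeasure ?L B = (\<integral>\<^sup>+y. ennreal (gauss_conv \<sigma> G y) * indicator B y \<partial>lborel)"
    by (rule emeasure_density) auto
  also have "\<dots> = (\<integral>\<^sup>+y. (\<integral>\<^sup>+x. ennreal (normal_density 0 \<sigma> (y - x)) * indicator B y \<partial>G) \<partial>lborel)"
    by (intro nn_integral_cong) (simp add: gauss_conv_nn_integral[OF assms] nn_integral_multc)
  also have "\<dots> = (\<integral>\<^sup>+x. (\<integral>\<^sup>+y. ennreal (normal_density 0 \<sigma> (y - x)) * indicator B y \<partial>lborel) \<partial>G)"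
    by (rule LG.Fubini'[symmetric]) measurable
  also have "\<dots> = (\<integral>\<^sup>+x. (\<integral>\<^sup>+z. ennreal (normal_density 0 \<sigma> z) * indicator B (z + x) \<partial>lborel) \<partial>G)"
  proof (rule nn_integral_cong)
    fix x
    show "(\<integral>\<^sup>+y. ennreal (normal_density 0 \<sigma> (y - x)) * indicator B y \<partial>lborel)
       = (\<integral>\<^sup>+z. ennreal (normal_density 0 \<sigma> z) * indicator B (z + x) \<partial>lborel)"
      using nn_integral_real_affine[of "\<lambda>y. ennreal (normal_density 0 \<sigma> (y - x)) * indicator B y" 1 x]
      by (simp add: add.commute)
  qed
  also have "\<dots> = (\<integral>\<^sup>+x. (\<integral>\<^sup>+z. indicator B (z + x) \<partial>?N) \<partial>G)"
    by (intro nn_integral_cong) (subst nn_integral_density, auto)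
  also have "\<dots> = (\<integral>\<^sup>+p. indicator B (case p of (z, x) \<Rightarrow> z + x) \<partial>(?N \<Otimes>\<^sub>M G))"
    by (subst NG.nn_integral_snd[symmetric]) auto
  also have "\<dots> = (\<integral>\<^sup>+y. indicator B y \<partial>distr (?N \<Otimes>\<^sub>M G) borel (\<lambda>(z, x). z + x))"
    by (rule nn_integral_distr[symmetric]) auto
  finally show "emeasure ?L B = emeasure (distr (?N \<Otimes>\<^sub>M G) borel (\<lambda>(z, x). z + x)) B" by simp
qed simp

lemma prob_density_gauss_conv:
  assumes G: "real_distribution G" and "\<sigma> > 0"
  shows "(\<integral>\<^sup>+y. ennreal (gauss_conv \<sigma> G y) \<partial>lborel) = 1"
proof -
  interpret G: real_distribution G by (rule G)
  interpret N: prob_space "density lborel (\<lambda>z. ennreal (normal_density 0 \<sigma> z))"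
    by (rule prob_space_normal_density[OF \<open>\<sigma> > 0\<close>])
  interpret NG: pair_prob_space "density lborel (\<lambda>z. ennreal (normal_density 0 \<sigma> z))" G ..
  interpret S: prob_space "density lborel (\<lambda>y. ennreal (gauss_conv \<sigma> G y))"
    unfolding gauss_conv_law[OF assms] by (rule NG.prob_space_distr) measurable
  show ?thesis using S.emeasure_space_1 borel_measurable_gauss_conv[OF G, of \<sigma>]
    by (simp add: emeasure_density)
qed

lemma integrable_gauss_conv:
  assumes G: "real_distribution G" and "\<sigma> > 0"
  shows "integrable lborel (gauss_conv \<sigma> G)"
  by (rule integrableI_nonneg)
     (use prob_density_gauss_conv[OF assms] borel_measurable_gauss_conv[OF G] gauss_conv_nonneg in auto)

lemma integral_gauss_conv:
  fixes h :: "real \<Rightarrow> 'b::{banach, second_countable_topology}"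
  assumes G: "real_distribution G" and "\<sigma> > 0" and h[measurable]: "h \<in> borel_measurable borel"
    and int: "integrable (density lborel (\<lambda>z. ennreal (normal_density 0 \<sigma> z)) \<Otimes>\<^sub>M G) (\<lambda>(z, x). h (z + x))"
  shows "(\<integral>y. gauss_conv \<sigma> G y *\<^sub>R h y \<partial>lborel)
    = (\<integral>x. (\<integral>z. h (z + x) \<partial>density lborel (\<lambda>z. ennreal (normal_density 0 \<sigma> z))) \<partial>G)"
    (is "_ = (\<integral>x. (\<integral>z. h (z + x) \<partial>?N) \<partial>G)")
proof -
  interpret G: real_distribution G by (rule G)
  interpret N: prob_space ?N by (rule prob_space_normal_density[OF \<open>\<sigma> > 0\<close>])
  interpret NG: pair_prob_space ?N G ..
  note borel_measurable_gauss_conv[OF G, measurable]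
  have "(\<integral>y. gauss_conv \<sigma> G y *\<^sub>R h y \<partial>lborel) = (\<integral>y. h y \<partial>density lborel (\<lambda>y. ennreal (gauss_conv \<sigma> G y)))"
    by (rule integral_density[symmetric]) (auto simp: gauss_conv_nonneg)
  also have "\<dots> = (\<integral>p. h (case p of (z, x) \<Rightarrow> z + x) \<partial>(?N \<Otimes>\<^sub>M G))"
    unfolding gauss_conv_law[OF assms(1,2)] by (rule integral_distr) auto
  also have "\<dots> = (\<integral>p. (case p of (z, x) \<Rightarrow> h (z + x)) \<partial>(?N \<Otimes>\<^sub>M G))"
    by (rule Bochner_Integration.integral_cong) auto
  also have "\<dots> = (\<integral>x. (\<integral>z. h (z + x) \<partial>?N) \<partial>G)"
    using NG.integral_snd[of "\<lambda>z x. h (z + x)"] int by simp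
  finally show ?thesis .
qed

lemma char_gauss_conv:
  assumes G: "real_distribution G" and "\<sigma> > 0"
  shows "(\<integral>y. gauss_conv \<sigma> G y *\<^sub>R iexp (t * y) \<partial>lborel)
    = char (density lborel (\<lambda>z. ennreal (normal_density 0 \<sigma> z))) t * char G t"
proof -
  let ?N = "density lborel (\<lambda>z. ennreal (normal_density 0 \<sigma> z))"
  interpret G: real_distribution G by (rule G)
  interpret N: prob_space ?N by (rule prob_space_normal_density[OF \<open>\<sigma> > 0\<close>])
  interpret NG: pair_prob_space ?N G ..
  have "(\<integral>y. gauss_conv \<sigma> G y *\<^sub>R iexp (t * y) \<partial>lborel) = (\<integral>x. (\<integral>z. iexp (t * (z + x)) \<partial>?N) \<partial>G)"
    by (rule integral_gauss_conv[OF assms], measurable, rule NG.integrable_const_bound[of _ 1]) auto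
  also have "\<dots> = (\<integral>x. char ?N t * iexp (t * x) \<partial>G)"
    by (rule Bochner_Integration.integral_cong[OF refl]) (simp add: char_def distrib_left exp_add)
  finally show ?thesis by (simp add: char_def)
qed

text \<open>The substitution z = \<sigma> u reduces to the standard normal law, whose characteristic
  function is an exponential. This is what allows the Gaussian part of the noise to be divided out
  of the moments.\<close>

lemma char_normal_nonzero:
  assumes "\<sigma> > 0"
  shows "char (density lborel (\<lambda>z. ennreal (normal_density 0 \<sigma> z))) t \<noteq> 0"
proof -
  have "char (density lborel (\<lambda>z. ennreal (normal_density 0 \<sigma> z))) t
      = (\<integral>z. normal_density 0 \<sigma> z *\<^sub>R iexp (t * z) \<partial>lborel)"
    unfolding char_def by (rule integral_density) auto
  also have "\<dots> = \<sigma> *\<^sub>R (\<integral>u. normal_density 0 \<sigma> (\<sigma> * u) *\<^sub>R iexp (t * (\<sigma> * u)) \<partial>lborel)"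
    using lborel_integral_real_affine[of \<sigma> "\<lambda>z. normal_density 0 \<sigma> z *\<^sub>R iexp (t * z)" 0] assms by simp
  also have "\<dots> = (\<integral>u. \<sigma> *\<^sub>R normal_density 0 \<sigma> (\<sigma> * u) *\<^sub>R iexp (t * (\<sigma> * u)) \<partial>lborel)"
    by (rule integral_scaleR_right[symmetric])
  also have "\<dots> = (\<integral>u. std_normal_density u *\<^sub>R iexp ((t * \<sigma>) * u) \<partial>lborel)"
  proof (rule Bochner_Integration.integral_cong[OF refl])
    fix u
    have "\<sigma> * normal_density 0 \<sigma> (\<sigma> * u) = std_normal_density u"
      using assms by (simp add: normal_density_def real_sqrt_mult power_mult_distrib field_simps)
    then show "\<sigma> *\<^sub>R normal_density 0 \<sigma> (\<sigma> * u) *\<^sub>R iexp (t * (\<sigma> * u)) = std_normal_density u *\<^sub>R iexp ((t * \<sigma>) * u)"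
      by (simp add: mult.assoc)
  qed
  also have "\<dots> = char std_normal_distribution (t * \<sigma>)"
    unfolding char_def by (rule integral_density[symmetric]) auto
  also have "\<dots> \<noteq> 0" by (simp add: char_std_normal_distribution)
  finally show ?thesis .
qed

text \<open>The Gaussian factor is centred, so the mean of the error density is that of
  \<open>G\<close>. This transfers the normalisation of the model to the mixing measure, where it
  fixes the locations.\<close>

lemma mixing_measure_mean:
  assumes G: "real_distribution G" and "\<sigma> > 0" and sup: "AE x in G. \<bar>x\<bar> \<le> D"
    and mean: "has_bochner_integral lborel (\<lambda>y. y * gauss_conv \<sigma> G y) 0"
  shows "(\<integral>x. x \<partial>G) = 0"
proof -
  let ?N = "density lborel (\<lambda>z. ennreal (normal_density 0 \<sigma> z))"
  interpret G: real_distribution G by (rule G)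
  interpret N: prob_space ?N by (rule prob_space_normal_density[OF \<open>\<sigma> > 0\<close>])
  interpret NG: pair_prob_space ?N G ..
  have intN: "integrable ?N (\<lambda>z. z)"
    using integrable_normal_moment[OF \<open>\<sigma> > 0\<close>, of 0 1] by (subst integrable_density) auto
  have meanN: "(\<integral>z. z \<partial>?N) = 0"
    using integral_normal_moment_odd[OF \<open>\<sigma> > 0\<close>, of 0 0]
    by (subst integral_density) auto
  have intG: "integrable G (\<lambda>x. x)"
    by (rule G.integrable_const_bound[of _ D]) (use sup in auto)
  have i1: "integrable (?N \<Otimes>\<^sub>M G) (\<lambda>p. fst p)"
    by (rule NG.Fubini_integrable) (use intN G.prob_space in auto)
  have i2: "integrable (?N \<Otimes>\<^sub>M G) (\<lambda>p. snd p)"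
    by (rule NG.Fubini_integrable) (use intG in auto)
  have int: "integrable (?N \<Otimes>\<^sub>M G) (\<lambda>(z, x). z + x)"
    using Bochner_Integration.integrable_add[OF i1 i2] by (simp add: split_beta')
  have "0 = (\<integral>y. y * gauss_conv \<sigma> G y \<partial>lborel)"
    using has_bochner_integral_integral_eq[OF mean] by simp
  also have "\<dots> = (\<integral>y. gauss_conv \<sigma> G y *\<^sub>R y \<partial>lborel)" by (simp add: mult.commute)
  also have "\<dots> = (\<integral>x. (\<integral>z. z + x \<partial>?N) \<partial>G)"
    by (rule integral_gauss_conv[OF assms(1,2) _ int]) simp
  also have "\<dots> = (\<integral>x. x \<partial>G)"
    by (rule Bochner_Integration.integral_cong[OF refl]) (use intN meanN N.prob_space in simp)
  finally show ?thesis by simp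
qed

section \<open>The joint law of covariate and response\<close>

lemma space_lborel_on: "space (lborel_on a b) = {a..b}"
  by (simp add: lborel_on_def space_restrict_space)

lemma sets_lborel_on: "sets (lborel_on a b) = sets (restrict_space borel {a..b})"
  unfolding lborel_on_def by (rule sets_restrict_space_cong) simp

lemma sigma_finite_lborel_on: "sigma_finite_measure (lborel_on a b)"
  unfolding lborel_on_def by (rule sigma_finite_measure_restrict_space) (auto intro: lborel.sigma_finite_measure_axioms)

lemma finite_measure_lborel_on: "finite_measure (lborel_on a b)"
  unfolding lborel_on_def
  by (rule finite_measureI) (auto simp: space_restrict_space emeasure_restrict_space emeasure_lborel_Icc_eq)

lemma integrable_lborel_on_continuous:
  fixes h :: "real \<Rightarrow> 'b::{banach, second_countable_topology}"
  assumes "continuous_on {a..b} h"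
  shows "integrable (lborel_on a b) h"
  unfolding lborel_on_def
  by (subst integrable_restrict_space) (auto intro: borel_integrable_compact assms)

lemma measure_lborel_on_Ioc: "a \<le> u \<Longrightarrow> u \<le> v \<Longrightarrow> v \<le> b \<Longrightarrow> measure (lborel_on a b) {u<..v} = v - u"
  unfolding lborel_on_def by (subst measure_restrict_space) auto

locale joint_model =
  fixes a b \<sigma> :: real and K :: nat and \<theta> :: mixreg and G :: "real measure"
  assumes G: "real_distribution G" and \<sigma>: "\<sigma> > 0"
    and cov: "prob_density (lborel_on a b) (covdens \<theta>)"
    and err: "errdens \<theta> = gauss_conv \<sigma> G"
    and wt: "\<And>k. k \<in> {1..K} \<Longrightarrow> 0 \<le> wt \<theta> k" "(\<Sum>k\<in>{1..K}. wt \<theta> k) = 1"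
    and reg: "\<And>k. k \<in> {1..K} \<Longrightarrow> continuous_on {a..b} (reg \<theta> k)"
begin

lemma measurable_cov [measurable]: "covdens \<theta> \<in> borel_measurable (lborel_on a b)"
  using cov by (simp add: prob_density_def)

lemma cov_nonneg: "x \<in> {a..b} \<Longrightarrow> 0 \<le> covdens \<theta> x"
  using cov by (simp add: prob_density_def space_lborel_on)

lemma cov_integral: "(\<integral>\<^sup>+x. ennreal (covdens \<theta> x) \<partial>lborel_on a b) = 1"
  using cov by (simp add: prob_density_def)

lemma measurable_reg: "k \<in> {1..K} \<Longrightarrow> reg \<theta> k \<in> borel_measurable (lborel_on a b)"
  using borel_measurable_continuous_on_restrict[OF reg] sets_lborel_on
  by (simp cong: measurable_cong_sets)

lemma measurable_err [measurable]: "errdens \<theta> \<in> borel_measurable borel"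
  unfolding err by (rule borel_measurable_gauss_conv[OF G])

lemma measurable_joint_density [measurable]:
  "joint_density K \<theta> \<in> borel_measurable (lborel_on a b \<Otimes>\<^sub>M lborel)"
proof -
  have [measurable]: "(\<lambda>z. errdens \<theta> (snd z - reg \<theta> k (fst z))) \<in> borel_measurable (lborel_on a b \<Otimes>\<^sub>M lborel)"
    if "k \<in> {1..K}" for k
    using measurable_reg[OF that] by measurable
  show ?thesis unfolding joint_density_def case_prod_beta'
    by (intro borel_measurable_times borel_measurable_sum borel_measurable_const) measurable
qed

lemma joint_density_nonneg: "x \<in> {a..b} \<Longrightarrow> 0 \<le> joint_density K \<theta> (x, y)"
  unfolding joint_density_def
  by (auto intro!: mult_nonneg_nonneg sum_nonneg wt simp: cov_nonneg err gauss_conv_nonneg)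

lemma sets_joint_law: "sets (joint_law a b K \<theta>) = sets (restrict_space borel {a..b} \<Otimes>\<^sub>M borel)"
  unfolding joint_law_def by (simp add: sets_lborel_on cong: sets_pair_measure_cong)

lemma err_shift_nn_integral: "(\<integral>\<^sup>+y. ennreal (errdens \<theta> (y - u)) \<partial>lborel) = 1"
proof -
  have "(\<lambda>y. gauss_conv \<sigma> G (y - u)) \<in> borel_measurable borel"
    by (rule measurable_compose[OF _ borel_measurable_gauss_conv[OF G]]) simp
  then show ?thesis using nn_integral_real_affine[of "\<lambda>y. ennreal (errdens \<theta> (y - u))" 1 u]
    prob_density_gauss_conv[OF G \<sigma>] by (simp add: err)
qed

lemma err_shift_integrable: "integrable lborel (\<lambda>y. errdens \<theta> (y - u))"
  by (rule integrableI_nonneg) (auto simp: err_shift_nn_integral, auto simp: err gauss_conv_nonneg)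

lemma joint_density_nn_integral_snd:
  assumes "x \<in> {a..b}"
  shows "(\<integral>\<^sup>+y. ennreal (joint_density K \<theta> (x, y)) \<partial>lborel) = ennreal (covdens \<theta> x)"
proof -
  have "(\<integral>\<^sup>+y. ennreal (joint_density K \<theta> (x, y)) \<partial>lborel)
      = (\<integral>\<^sup>+y. ennreal (covdens \<theta> x) * (\<Sum>k\<in>{1..K}. ennreal (wt \<theta> k) * ennreal (errdens \<theta> (y - reg \<theta> k x))) \<partial>lborel)"
  proof (rule nn_integral_cong)
    fix y
    have e: "0 \<le> errdens \<theta> z" for z by (simp add: err gauss_conv_nonneg)
    have "(\<Sum>k\<in>{1..K}. ennreal (wt \<theta> k) * ennreal (errdens \<theta> (y - reg \<theta> k x)))
        = (\<Sum>k\<in>{1..K}. ennreal (wt \<theta> k * errdens \<theta> (y - reg \<theta> k x)))"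
      by (intro sum.cong refl ennreal_mult[symmetric] wt e)
    also have "\<dots> = ennreal (\<Sum>k\<in>{1..K}. wt \<theta> k * errdens \<theta> (y - reg \<theta> k x))"
      by (intro sum_ennreal mult_nonneg_nonneg wt e)
    finally show "ennreal (joint_density K \<theta> (x, y)) = ennreal (covdens \<theta> x) *
        (\<Sum>k\<in>{1..K}. ennreal (wt \<theta> k) * ennreal (errdens \<theta> (y - reg \<theta> k x)))"
      unfolding joint_density_def
      by (simp only: prod.case ennreal_mult'[OF cov_nonneg[OF assms]])
  qed
  also have "\<dots> = ennreal (covdens \<theta> x) * (\<Sum>k\<in>{1..K}. ennreal (wt \<theta> k))"
    by (simp add: nn_integral_cmult nn_integral_sum err_shift_nn_integral)
  also have "(\<Sum>k\<in>{1..K}. ennreal (wt \<theta> k)) = 1"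
    using wt by (subst sum_ennreal) auto
  finally show ?thesis by simp
qed

lemma prob_space_joint_law: "prob_space (joint_law a b K \<theta>)"
proof
  interpret L: sigma_finite_measure "lborel_on a b" by (rule sigma_finite_lborel_on)
  interpret P: pair_sigma_finite "lborel_on a b" lborel ..
  let ?L2 = "lborel_on a b \<Otimes>\<^sub>M lborel"
  have "emeasure (joint_law a b K \<theta>) (space (joint_law a b K \<theta>)) = (\<integral>\<^sup>+z. ennreal (joint_density K \<theta> z) \<partial>?L2)"
    unfolding joint_law_def space_density
    by (subst emeasure_density[OF _ sets.top]) (auto intro!: nn_integral_cong simp: indicator_def)
  also have "\<dots> = (\<integral>\<^sup>+x. (\<integral>\<^sup>+y. ennreal (joint_density K \<theta> (x, y)) \<partial>lborel) \<partial>lborel_on a b)"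
    by (rule lborel.nn_integral_fst[symmetric]) measurable
  also have "\<dots> = (\<integral>\<^sup>+x. ennreal (covdens \<theta> x) \<partial>lborel_on a b)"
    by (rule nn_integral_cong) (simp add: joint_density_nn_integral_snd space_lborel_on)
  also have "\<dots> = 1" by (rule cov_integral)
  finally show "emeasure (joint_law a b K \<theta>) (space (joint_law a b K \<theta>)) = 1" .
qed

lemma integral_joint_law:
  fixes h :: "real \<times> real \<Rightarrow> 'b::{banach, second_countable_topology}"
  assumes h[measurable]: "h \<in> borel_measurable (restrict_space borel {a..b} \<Otimes>\<^sub>M borel)"
    and bound: "\<And>z. norm (h z) \<le> C"
  shows "(\<integral>z. h z \<partial>joint_law a b K \<theta>) = (\<integral>x. covdens \<theta> x *\<^sub>R
     (\<Sum>k\<in>{1..K}. wt \<theta> k *\<^sub>R (\<integral>y. errdens \<theta> (y - reg \<theta> k x) *\<^sub>R h (x, y) \<partial>lborel)) \<partial>lborel_on a b)"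
proof -
  interpret L: sigma_finite_measure "lborel_on a b" by (rule sigma_finite_lborel_on)
  interpret P: pair_sigma_finite "lborel_on a b" lborel ..
  interpret J: prob_space "joint_law a b K \<theta>" by (rule prob_space_joint_law)
  let ?L2 = "lborel_on a b \<Otimes>\<^sub>M lborel"
  have sets_L2: "sets ?L2 = sets (restrict_space borel {a..b} \<Otimes>\<^sub>M borel)"
    by (simp add: sets_lborel_on cong: sets_pair_measure_cong)
  have h2[measurable]: "h \<in> borel_measurable ?L2"
    using h by (simp add: measurable_cong_sets[OF sets_L2 refl])
  have hJ: "h \<in> borel_measurable (joint_law a b K \<theta>)"
    using h by (simp add: measurable_cong_sets[OF sets_joint_law refl])
  have nonneg: "AE z in ?L2. 0 \<le> joint_density K \<theta> z"
    by (rule AE_I2) (auto simp: space_pair_measure space_lborel_on intro: joint_density_nonneg)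
  have int: "integrable (joint_law a b K \<theta>) h"
    by (rule J.integrable_const_bound[of _ C]) (use bound hJ in auto)
  then have int2: "integrable ?L2 (\<lambda>z. joint_density K \<theta> z *\<^sub>R h z)"
    unfolding joint_law_def using nonneg by (subst (asm) integrable_density) auto
  have "(\<integral>z. h z \<partial>joint_law a b K \<theta>) = (\<integral>z. joint_density K \<theta> z *\<^sub>R h z \<partial>?L2)"
    unfolding joint_law_def by (rule integral_density) (use nonneg in auto)
  also have "\<dots> = (\<integral>x. (\<integral>y. joint_density K \<theta> (x, y) *\<^sub>R h (x, y) \<partial>lborel) \<partial>lborel_on a b)"
    by (rule P.integral_fst'[symmetric]) (rule int2)
  also have "\<dots> = (\<integral>x. covdens \<theta> x *\<^sub>R
     (\<Sum>k\<in>{1..K}. wt \<theta> k *\<^sub>R (\<integral>y. errdens \<theta> (y - reg \<theta> k x) *\<^sub>R h (x, y) \<partial>lborel)) \<partial>lborel_on a b)"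
  proof (rule Bochner_Integration.integral_cong[OF refl])
    fix x assume "x \<in> space (lborel_on a b)"
    then have x: "x \<in> {a..b}" by (simp add: space_lborel_on)
    have hx[measurable]: "(\<lambda>y. h (x, y)) \<in> borel_measurable borel"
      using x by (intro measurable_compose[OF _ h]) (auto simp: space_restrict_space)
    have ik: "integrable lborel (\<lambda>y. errdens \<theta> (y - u) *\<^sub>R h (x, y))" for u
    proof (rule Bochner_Integration.integrable_bound)
      show "integrable lborel (\<lambda>y. C * errdens \<theta> (y - u))"
        by (intro integrable_mult_right err_shift_integrable)
      have "\<bar>errdens \<theta> (y - u)\<bar> * norm (h (x, y)) \<le> \<bar>errdens \<theta> (y - u)\<bar> * \<bar>C\<bar>" for y
        by (intro mult_left_mono order_trans[OF bound]) auto
      then show "AE y in lborel. norm (errdens \<theta> (y - u) *\<^sub>R h (x, y)) \<le> norm (C * errdens \<theta> (y - u))"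
        by (simp add: abs_mult mult.commute)
    qed measurable
    have "(\<integral>y. joint_density K \<theta> (x, y) *\<^sub>R h (x, y) \<partial>lborel)
      = (\<integral>y. covdens \<theta> x *\<^sub>R (\<Sum>k\<in>{1..K}. wt \<theta> k *\<^sub>R errdens \<theta> (y - reg \<theta> k x) *\<^sub>R h (x, y)) \<partial>lborel)"
      by (simp add: joint_density_def scaleR_sum_left sum_distrib_left scaleR_sum_right)
    also have "\<dots> = covdens \<theta> x *\<^sub>R
      (\<integral>y. (\<Sum>k\<in>{1..K}. wt \<theta> k *\<^sub>R errdens \<theta> (y - reg \<theta> k x) *\<^sub>R h (x, y)) \<partial>lborel)"
      by (rule integral_scaleR_right)
    also have "(\<integral>y. (\<Sum>k\<in>{1..K}. wt \<theta> k *\<^sub>R errdens \<theta> (y - reg \<theta> k x) *\<^sub>R h (x, y)) \<partial>lborel)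
      = (\<Sum>k\<in>{1..K}. \<integral>y. wt \<theta> k *\<^sub>R errdens \<theta> (y - reg \<theta> k x) *\<^sub>R h (x, y) \<partial>lborel)"
      by (rule Bochner_Integration.integral_sum) (intro integrable_scaleR_right ik)
    also have "\<dots> = (\<Sum>k\<in>{1..K}. wt \<theta> k *\<^sub>R (\<integral>y. errdens \<theta> (y - reg \<theta> k x) *\<^sub>R h (x, y) \<partial>lborel))"
      by (simp only: integral_scaleR_right)
    finally show "(\<integral>y. joint_density K \<theta> (x, y) *\<^sub>R h (x, y) \<partial>lborel) = covdens \<theta> x *\<^sub>R
     (\<Sum>k\<in>{1..K}. wt \<theta> k *\<^sub>R (\<integral>y. errdens \<theta> (y - reg \<theta> k x) *\<^sub>R h (x, y) \<partial>lborel))" .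
  qed
  finally show ?thesis .
qed

lemma integral_err_iexp:
  "(\<integral>y. errdens \<theta> (y - u) *\<^sub>R iexp (t * y) \<partial>lborel)
     = char (density lborel (\<lambda>z. ennreal (normal_density 0 \<sigma> z))) t * (char G t * iexp (t * u))"
proof -
  have "(\<integral>y. errdens \<theta> (y - u) *\<^sub>R iexp (t * y) \<partial>lborel)
      = (\<integral>y. errdens \<theta> y *\<^sub>R iexp (t * (u + y)) \<partial>lborel)"
    using lborel_integral_real_affine[of 1 "\<lambda>y. errdens \<theta> (y - u) *\<^sub>R iexp (t * y)" u] by simp
  also have "\<dots> = (\<integral>y. (gauss_conv \<sigma> G y *\<^sub>R iexp (t * y)) * iexp (t * u) \<partial>lborel)"
    by (intro Bochner_Integration.integral_cong refl) (simp add: err distrib_left exp_add)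
  also have "\<dots> = (\<integral>y. gauss_conv \<sigma> G y *\<^sub>R iexp (t * y) \<partial>lborel) * iexp (t * u)"
    by (rule integral_mult_left_zero)
  finally show ?thesis by (simp only: char_gauss_conv[OF G \<sigma>] mult.assoc)
qed

text \<open>A shift of the error density by \<open>u\<close> multiplies its Fourier integral by
  \<open>iexp (t * u)\<close>. The Gaussian factor depends neither on \<open>x\<close> nor on the
  component and leaves the integral.\<close>

lemma integral_joint_law_iexp:
  "(\<integral>z. indicator {..q} (fst z) *\<^sub>R iexp (t * snd z) \<partial>joint_law a b K \<theta>)
    = char (density lborel (\<lambda>z. ennreal (normal_density 0 \<sigma> z))) t *
      (\<integral>x. (indicator {..q} x * covdens \<theta> x) *\<^sub>R
        (char G t * (\<Sum>k\<in>{1..K}. wt \<theta> k * iexp (t * reg \<theta> k x))) \<partial>lborel_on a b)"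
proof -
  let ?c = "char (density lborel (\<lambda>z. ennreal (normal_density 0 \<sigma> z))) t"
  have hm: "(\<lambda>z. indicator {..q} (fst z) *\<^sub>R iexp (t * snd z))
     \<in> borel_measurable (restrict_space borel {a..b} \<Otimes>\<^sub>M borel)"
  proof -
    have [measurable]: "(\<lambda>x. indicator {..q} x :: real) \<in> borel_measurable (restrict_space borel {a..b})"
      by (intro measurable_restrict_space1) simp
    show ?thesis by measurable
  qed
  have "(\<integral>z. indicator {..q} (fst z) *\<^sub>R iexp (t * snd z) \<partial>joint_law a b K \<theta>)
    = (\<integral>x. covdens \<theta> x *\<^sub>R (\<Sum>k\<in>{1..K}. wt \<theta> k *\<^sub>R
       (\<integral>y. errdens \<theta> (y - reg \<theta> k x) *\<^sub>R (indicator {..q} (fst (x, y)) *\<^sub>R iexp (t * snd (x, y))) \<partial>lborel)) \<partial>lborel_on a b)"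
    by (rule integral_joint_law[OF hm, where C = 1]) (auto simp: indicator_def)
  also have "\<dots> = (\<integral>x. ?c * ((indicator {..q} x * covdens \<theta> x) *\<^sub>R
        (char G t * (\<Sum>k\<in>{1..K}. wt \<theta> k * iexp (t * reg \<theta> k x)))) \<partial>lborel_on a b)"
  proof (rule Bochner_Integration.integral_cong[OF refl])
    fix x
    have "(\<integral>y. errdens \<theta> (y - reg \<theta> k x) *\<^sub>R (indicator {..q} (fst (x, y)) *\<^sub>R iexp (t * snd (x, y))) \<partial>lborel)
        = indicator {..q} x *\<^sub>R (?c * (char G t * iexp (t * reg \<theta> k x)))" for k
    proof -
      have "(\<integral>y. errdens \<theta> (y - reg \<theta> k x) *\<^sub>R (indicator {..q} (fst (x, y)) *\<^sub>R iexp (t * snd (x, y))) \<partial>lborel)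
          = (\<integral>y. indicator {..q} x *\<^sub>R (errdens \<theta> (y - reg \<theta> k x) *\<^sub>R iexp (t * y)) \<partial>lborel)"
        by (intro Bochner_Integration.integral_cong refl) (simp add: mult_ac)
      also have "\<dots> = indicator {..q} x *\<^sub>R (\<integral>y. errdens \<theta> (y - reg \<theta> k x) *\<^sub>R iexp (t * y) \<partial>lborel)"
        by (rule integral_scaleR_right)
      finally show ?thesis by (simp only: integral_err_iexp)
    qed
    then show "covdens \<theta> x *\<^sub>R (\<Sum>k\<in>{1..K}. wt \<theta> k *\<^sub>R
       (\<integral>y. errdens \<theta> (y - reg \<theta> k x) *\<^sub>R (indicator {..q} (fst (x, y)) *\<^sub>R iexp (t * snd (x, y))) \<partial>lborel))
      = ?c * ((indicator {..q} x * covdens \<theta> x) *\<^sub>R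
        (char G t * (\<Sum>k\<in>{1..K}. wt \<theta> k * iexp (t * reg \<theta> k x))))"
      by (simp only:) (simp add: scaleR_conv_of_real sum_distrib_left sum_distrib_right mult_ac)
  qed
  also have "\<dots> = ?c * (\<integral>x. (indicator {..q} x * covdens \<theta> x) *\<^sub>R
        (char G t * (\<Sum>k\<in>{1..K}. wt \<theta> k * iexp (t * reg \<theta> k x))) \<partial>lborel_on a b)"
    by (rule integral_mult_right_zero)
  finally show ?thesis .
qed

end

section \<open>Identification from moments\<close>

lemma integrable_lborel_on_indicator:
  fixes h :: "real \<Rightarrow> 'b::{banach, second_countable_topology}"
  assumes h: "integrable (lborel_on a b) h" and A: "A \<in> sets borel"
  shows "integrable (lborel_on a b) (\<lambda>x. indicator A x *\<^sub>R h x)"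
proof (rule Bochner_Integration.integrable_bound[OF h])
  have "(\<lambda>x. indicator A x :: real) \<in> borel_measurable (lborel_on a b)"
    unfolding lborel_on_def by (intro measurable_restrict_space1) (use A in simp)
  then show "(\<lambda>x. indicator A x *\<^sub>R h x) \<in> borel_measurable (lborel_on a b)"
    by (rule borel_measurable_scaleR[OF _ borel_measurable_integrable[OF h]])
qed (auto simp: indicator_def)

text \<open>If \<open>h x\<close> were nonzero, \<open>h\<close> would stay within half its norm of
  \<open>h x\<close> on a short interval with rational end points near \<open>x\<close>. The
  integral over that interval is a difference of two vanishing ones, yet its norm would be at least
  half of \<open>(v - u) * norm (h x)\<close>.\<close>

lemma continuous_zero_from_rational_integrals:
  fixes h :: "real \<Rightarrow> 'b::{banach, second_countable_topology}"
  assumes "a < b" and h: "continuous_on {a..b} h"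
    and zero: "\<And>q. q \<in> \<rat> \<Longrightarrow> (\<integral>x. indicator {..q} x *\<^sub>R h x \<partial>lborel_on a b) = 0"
    and x: "x \<in> {a..b}"
  shows "h x = 0"
proof (rule ccontr)
  assume "h x \<noteq> 0"
  then have e: "0 < norm (h x) / 2" by simp
  interpret L: finite_measure "lborel_on a b" by (rule finite_measure_lborel_on)
  have "\<exists>d>0. \<forall>y\<in>{a..b}. dist y x < d \<longrightarrow> dist (h y) (h x) < norm (h x) / 2"
    using h x e unfolding continuous_on_iff by blast
  then obtain d where d: "d > 0" "\<And>y. y \<in> {a..b} \<Longrightarrow> dist y x < d \<Longrightarrow> dist (h y) (h x) < norm (h x) / 2" by blast
  \<comment> \<open>Cutting at \<open>a\<close> and \<open>b\<close> also covers end points: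
    \<open>{u<..v}\<close> has to lie close to \<open>x\<close>, not to contain it.\<close>
  have "max a (x - d) < min b (x + d)" using d x \<open>a < b\<close> by auto
  then obtain u where u: "u \<in> \<rat>" "max a (x - d) < u" "u < min b (x + d)"
    using Rats_dense_in_real by blast
  obtain v where v: "v \<in> \<rat>" "u < v" "v < min b (x + d)"
    using Rats_dense_in_real[OF u(3)] by blast
  let ?i = "\<lambda>y. indicator {u<..v} y :: real"
  have ind_meas [measurable]: "(\<lambda>y. indicator A y :: real) \<in> borel_measurable (lborel_on a b)"
    if "A \<in> sets borel" for A :: "real set"
    unfolding lborel_on_def by (intro measurable_restrict_space1) (use that in simp)
  have inth: "integrable (lborel_on a b) h" by (rule integrable_lborel_on_continuous[OF h])
  have intq: "integrable (lborel_on a b) (\<lambda>y. indicator {..q} y *\<^sub>R h y)" for q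
    by (rule integrable_lborel_on_indicator[OF inth]) simp
  have inti: "integrable (lborel_on a b) ?i"
    by (rule L.integrable_const_bound[of _ 1]) auto
  have mass: "(\<integral>y. ?i y \<partial>lborel_on a b) = v - u"
  proof -
    have "{u<..v} \<inter> space (lborel_on a b) = {u<..v}" using u v by (auto simp: space_lborel_on)
    then show ?thesis using measure_lborel_on_Ioc[of a u v b] u v by simp
  qed
  have "(\<integral>y. ?i y *\<^sub>R h y \<partial>lborel_on a b)
      = (\<integral>y. indicator {..v} y *\<^sub>R h y - indicator {..u} y *\<^sub>R h y \<partial>lborel_on a b)"
    by (intro Bochner_Integration.integral_cong refl) (use v in \<open>auto simp: indicator_def\<close>)
  also have "\<dots> = 0" using intq zero[OF u(1)] zero[OF v(1)] by simp
  finally have "0 = (\<integral>y. ?i y *\<^sub>R h y \<partial>lborel_on a b)" by simp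
  moreover have "(v - u) *\<^sub>R h x = (\<integral>y. ?i y *\<^sub>R h x \<partial>lborel_on a b)"
    using inti mass by simp
  moreover have i1: "integrable (lborel_on a b) (\<lambda>y. ?i y *\<^sub>R h y)"
    by (rule integrable_lborel_on_indicator[OF inth]) simp
  moreover have i2: "integrable (lborel_on a b) (\<lambda>y. ?i y *\<^sub>R h x)" using inti by simp
  ultimately have "- ((v - u) *\<^sub>R h x) = (\<integral>y. ?i y *\<^sub>R h y - ?i y *\<^sub>R h x \<partial>lborel_on a b)"
    by simp
  then have "norm ((v - u) *\<^sub>R h x) = norm (\<integral>y. ?i y *\<^sub>R h y - ?i y *\<^sub>R h x \<partial>lborel_on a b)"
    by (metis norm_minus_cancel)
  also have "\<dots> \<le> (\<integral>y. ?i y * (norm (h x) / 2) \<partial>lborel_on a b)"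
  proof (rule Bochner_Integration.integral_norm_bound_integral)
    show "integrable (lborel_on a b) (\<lambda>y. ?i y *\<^sub>R h y - ?i y *\<^sub>R h x)" using i1 i2 by simp
    show "integrable (lborel_on a b) (\<lambda>y. ?i y * (norm (h x) / 2))" using inti by simp
    fix y assume "y \<in> space (lborel_on a b)"
    then have y: "y \<in> {a..b}" by (simp add: space_lborel_on)
    show "norm (?i y *\<^sub>R h y - ?i y *\<^sub>R h x) \<le> ?i y * (norm (h x) / 2)"
    proof (cases "y \<in> {u<..v}")
      case True
      then have "dist y x < d" using u v by (auto simp: dist_real_def)
      from d(2)[OF y this] have "norm (h y - h x) \<le> norm (h x) / 2" by (simp add: dist_norm)
      then show ?thesis using True by simp
    qed simp
  qed
  also have "\<dots> = (v - u) * (norm (h x) / 2)" using mass by (simp add: mult.commute)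
  finally have "(v - u) * norm (h x) \<le> (v - u) * (norm (h x) / 2)" using v by simp
  then show False using v e by simp
qed

lemma real_distribution_return: "real_distribution (return borel (u::real))"
  by (simp add: real_distribution_def real_distribution_axioms_def prob_space_return)

text \<open>At each \<open>x\<close> the factor after \<open>*\<^sub>R\<close> is the characteristic
  function at \<open>t\<close> of the location mixture with noise \<open>G\<close>. The whole is the
  moment of the joint law for x \<le> q with frequency \<open>t\<close>, freed of its Gaussian
  factor.\<close>

definition mixture_moment ::
  "real \<Rightarrow> real \<Rightarrow> nat \<Rightarrow> (real \<Rightarrow> real) \<Rightarrow> real measure \<Rightarrow> (nat \<Rightarrow> real) \<Rightarrow> (nat \<Rightarrow> real \<Rightarrow> real) \<Rightarrow> real \<Rightarrow> real \<Rightarrow> complex"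
where
  "mixture_moment a b K p G l m q t = (\<integral>x. (indicator {..q} x * p x) *\<^sub>R
     (char G t * (\<Sum>k\<in>{1..K}. l k * iexp (t * m k x))) \<partial>lborel_on a b)"

context mixture_class
begin

lemma member_continuous_on:
  assumes "member G l m" "k \<in> {1..K}"
  shows "continuous_on {a..b} (m k)"
proof -
  have "0 \<le> B" using memberD(7)[OF assms, of x0] x0 by (meson abs_ge_zero order_trans)
  then have "B-lipschitz_on {a..b} (m k)"
    by (intro lipschitz_onI) (use memberD(8)[OF assms] in \<open>auto simp: dist_real_def\<close>)
  then show ?thesis by (rule lipschitz_on_continuous_on)
qed

text \<open>For fixed rational \<open>t\<close> the difference of the integrands is continuous in
  \<open>x\<close> and has zero integral up to every rational \<open>q\<close>, so it vanishes, and
  \<open>p x > 0\<close> is cancelled. Continuity of characteristic functions then extends the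
  identity from rational to real \<open>t\<close>.\<close>

lemma members_identified_pointwise:
  assumes mem: "member G l m" "member G' l' m'"
    and p: "continuous_on {a..b} p" "\<And>x. x \<in> {a..b} \<Longrightarrow> 0 < p x"
    and eq: "\<And>q t. q \<in> \<rat> \<Longrightarrow> t \<in> \<rat> \<Longrightarrow> mixture_moment a b K p G l m q t = mixture_moment a b K p G' l' m' q t"
    and x: "x \<in> {a..b}"
  shows "(\<Sum>k\<in>{1..K}. l k * iexp (t * m k x)) * char G t = (\<Sum>k\<in>{1..K}. l' k * iexp (t * m' k x)) * char G' t"
proof -
  interpret G: real_distribution G by (rule memberD(1)[OF mem(1)])
  interpret G': real_distribution G' by (rule memberD(1)[OF mem(2)])
  define d where "d t x = char G t * (\<Sum>k\<in>{1..K}. l k * iexp (t * m k x))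
      - char G' t * (\<Sum>k\<in>{1..K}. l' k * iexp (t * m' k x))" for t x
  have cont: "continuous_on {a..b} (\<lambda>x. char M t * (\<Sum>k\<in>{1..K}. w k * iexp (t * g k x)))"
    if "member M w g" for M w g and t :: real
    by (intro continuous_intros member_continuous_on[OF that]) auto
  have rat: "d t x = 0" if t: "t \<in> \<rat>" for t
  proof -
    have cd: "continuous_on {a..b} (\<lambda>x. p x *\<^sub>R d t x)"
      unfolding d_def by (intro continuous_intros p(1) cont mem)
    have "p x *\<^sub>R d t x = 0"
    proof (rule continuous_zero_from_rational_integrals[OF ab cd _ x])
      fix q :: real assume q: "q \<in> \<rat>"
      have int: "integrable (lborel_on a b) (\<lambda>x. (indicator {..q} x * p x) *\<^sub>R
         (char M t * (\<Sum>k\<in>{1..K}. w k * iexp (t * g k x))))" if "member M w g" for M w g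
      proof -
        have i: "integrable (lborel_on a b) (\<lambda>x. p x *\<^sub>R (char M t * (\<Sum>k\<in>{1..K}. w k * iexp (t * g k x))))"
          by (intro integrable_lborel_on_continuous continuous_intros p(1) cont that)
        have "integrable (lborel_on a b) (\<lambda>x. indicator {..q} x *\<^sub>R
            (p x *\<^sub>R (char M t * (\<Sum>k\<in>{1..K}. w k * iexp (t * g k x)))))"
          by (rule integrable_lborel_on_indicator[OF i]) simp
        then show ?thesis by (simp only: scaleR_scaleR)
      qed
      have "(\<integral>x. indicator {..q} x *\<^sub>R (p x *\<^sub>R d t x) \<partial>lborel_on a b)
        = mixture_moment a b K p G l m q t - mixture_moment a b K p G' l' m' q t"
        unfolding mixture_moment_def
        by (subst Bochner_Integration.integral_diff[OF int[OF mem(1)] int[OF mem(2)], symmetric])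
           (simp only: d_def scaleR_diff_right scaleR_scaleR)
      then show "(\<integral>x. indicator {..q} x *\<^sub>R (p x *\<^sub>R d t x) \<partial>lborel_on a b) = 0"
        using eq[OF q t] by simp
    qed
    then show ?thesis using p(2)[OF x] by simp
  qed
  have "continuous_on (closure \<rat>) (\<lambda>t. d t x)"
    unfolding d_def
    by (intro continuous_intros continuous_at_imp_continuous_on ballI G.isCont_char G'.isCont_char)
  from continuous_constant_on_closure[OF this, of 0] rat
  have "d t x = 0" by (simp add: Rats_closure_real)
  then show ?thesis by (simp add: d_def mult.commute)
qed

lemma members_identified:
  assumes mem: "member G l m" "member G' l' m'"
    and dist: "AE x in lborel_on a b. \<forall>j\<in>{1..K}. \<forall>k\<in>{1..K}. j \<noteq> k \<longrightarrow> m j x \<noteq> m k x"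
      "AE x in lborel_on a b. \<forall>j\<in>{1..K}. \<forall>k\<in>{1..K}. j \<noteq> k \<longrightarrow> m' j x \<noteq> m' k x"
    and p: "continuous_on {a..b} p" "\<And>x. x \<in> {a..b} \<Longrightarrow> 0 < p x"
    and eq: "\<And>q t. q \<in> \<rat> \<Longrightarrow> t \<in> \<rat> \<Longrightarrow> mixture_moment a b K p G l m q t = mixture_moment a b K p G' l' m' q t"
  shows "G = G' \<and> (\<forall>k\<in>{1..K}. l k = l' k) \<and> (AE x in lborel_on a b. \<forall>k\<in>{1..K}. m k x = m' k x)"
proof -
  have point: "(\<Sum>k\<in>{1..K}. l k * iexp (t * m k x)) * char G t
      = (\<Sum>k\<in>{1..K}. l' k * iexp (t * m' k x)) * char G' t" if "x \<in> {a..b}" for x t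
    by (rule members_identified_pointwise[OF mem p(1)]) (use p(2) eq that in auto)
  obtain \<alpha> \<beta> where ab1: "AE x in G. x \<in> {\<alpha>..\<beta>}"
    "\<And>j k. j \<in> {1..K} \<Longrightarrow> k \<in> {1..K} \<Longrightarrow> j \<noteq> k \<Longrightarrow> 2 * (\<beta> - \<alpha>) + c \<le> \<bar>m j x0 - m k x0\<bar>"
    using memberD(9)[OF mem(1)] by blast
  obtain \<alpha>' \<beta>' where ab2: "AE x in G'. x \<in> {\<alpha>'..\<beta>'}"
    "\<And>j k. j \<in> {1..K} \<Longrightarrow> k \<in> {1..K} \<Longrightarrow> j \<noteq> k \<Longrightarrow> 2 * (\<beta>' - \<alpha>') + c \<le> \<bar>m' j x0 - m' k x0\<bar>"
    using memberD(9)[OF mem(2)] by blast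
  have GG: "G = G' \<and> (\<forall>k\<in>{1..K}. l k = l' k \<and> m k x0 = m' k x0)"
  proof (rule location_mixture_identifiable[OF memberD(1)[OF mem(1)] memberD(1)[OF mem(2)] ab1(1) ab2(1)
        memberD(2)[OF mem(1)] memberD(2)[OF mem(2)]
        member_weight_bounds(1)[OF mem(1)] memberD(4)[OF mem(1)] member_strict_mono[OF mem(1)]
        member_weight_bounds(1)[OF mem(2)] memberD(4)[OF mem(2)] member_strict_mono[OF mem(2)]])
    show "2 * (\<beta> - \<alpha>) < \<bar>m j x0 - m k x0\<bar>" if "j \<in> {1..K}" "k \<in> {1..K}" "j \<noteq> k" for j k
      using ab1(2)[OF that] c by linarith
    show "2 * (\<beta>' - \<alpha>') < \<bar>m' j x0 - m' k x0\<bar>" if "j \<in> {1..K}" "k \<in> {1..K}" "j \<noteq> k" for j k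
      using ab2(2)[OF that] c by linarith
  qed (assumption | rule point[OF x0])+
  \<comment> \<open>Away from \<open>x0\<close> the clusters may overlap, so the common
    \<open>char G t\<close> is cancelled first. What is left is a location mixture whose noise is
    the point mass at 0, with support interval \<open>{0..0}\<close>; the separation required there
    is mere distinctness.\<close>
  let ?\<delta> = "return borel (0::real)"
  have R: "real_distribution ?\<delta>" "AE x in ?\<delta>. x \<in> {0..0}" "(\<integral>x. x \<partial>?\<delta>) = 0"
    by (auto simp: real_distribution_return AE_return integral_return)
  have charR: "char ?\<delta> t = 1" for t unfolding char_def by (subst integral_return) auto
  have "AE x in lborel_on a b. x \<in> {a..b}"
    by (rule AE_I2) (simp add: space_lborel_on)
  with dist have "AE x in lborel_on a b. \<forall>k\<in>{1..K}. m k x = m' k x"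
  proof eventually_elim
    case (elim x)
    have "?\<delta> = ?\<delta> \<and> (\<forall>k\<in>{1..K}. l k = l' k \<and> m k x = m' k x)"
    proof (rule location_mixture_identifiable[OF R(1) R(1) R(2) R(2) R(3) R(3)
        member_weight_bounds(1)[OF mem(1)] memberD(4)[OF mem(1)] member_strict_mono[OF mem(1)]
        member_weight_bounds(1)[OF mem(2)] memberD(4)[OF mem(2)] member_strict_mono[OF mem(2)]])
      show "2 * (0 - 0) < \<bar>m j x - m k x\<bar>" if "j \<in> {1..K}" "k \<in> {1..K}" "j \<noteq> k" for j k
        using elim(1) that by auto
      show "2 * (0 - 0) < \<bar>m' j x - m' k x\<bar>" if "j \<in> {1..K}" "k \<in> {1..K}" "j \<noteq> k" for j k
        using elim(2) that by auto
      fix t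
      have "char G t \<noteq> 0" using memberD(3)[OF mem(1), of t] J[of t] by auto
      then show "(\<Sum>k\<in>{1..K}. l k * iexp (t * m k x)) * char ?\<delta> t = (\<Sum>k\<in>{1..K}. l' k * iexp (t * m' k x)) * char ?\<delta> t"
        using point[OF elim(3), of t] GG by (simp add: charR)
    qed assumption+
    then show ?case by blast
  qed
  then show ?thesis using GG by blast
qed

end

section \<open>Uniform identifiability\<close>

text \<open>The Gaussian kernel is a bounded continuous test function, so weak convergence gives
  pointwise convergence of densities. All of them have mass 1, and Scheffe's lemma upgrades this to
  convergence in L1.\<close>

lemma gauss_conv_L1_tendsto:
  assumes G: "\<And>n. real_distribution (G n)" and H: "real_distribution H" and conv: "weak_conv_m G H"
    and \<sigma>: "\<sigma> > 0"
  shows "(\<lambda>n. L1_norm lborel (\<lambda>y. gauss_conv \<sigma> (G n) y - gauss_conv \<sigma> H y)) \<longlonglongrightarrow> 0"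
proof -
  have "(\<lambda>n. \<integral>\<^sup>+y. norm (gauss_conv \<sigma> (G n) y - gauss_conv \<sigma> H y) \<partial>lborel) \<longlonglongrightarrow> 0"
  proof (rule Scheffe_lemma2)
    show "gauss_conv \<sigma> (G n) \<in> borel_measurable lborel" for n
      using borel_measurable_gauss_conv[OF G] by simp
    show "integrable lborel (gauss_conv \<sigma> H)" by (rule integrable_gauss_conv[OF H \<sigma>])
    have "(\<lambda>n. gauss_conv \<sigma> (G n) y) \<longlonglongrightarrow> gauss_conv \<sigma> H y" for y
      unfolding gauss_conv_def
    proof (rule weak_conv_imp_integral_bdd_continuous_conv[OF G H conv])
      show "isCont (\<lambda>x. normal_density 0 \<sigma> (y - x)) x" for x
        unfolding normal_density_def using \<sigma> by (intro continuous_intros) auto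
      show "norm (normal_density 0 \<sigma> (y - x)) \<le> 1 / sqrt (2 * pi * \<sigma>\<^sup>2)" for x
        using normal_density_le[OF \<sigma>] by simp
    qed
    then show "AE y in lborel. (\<lambda>n. gauss_conv \<sigma> (G n) y) \<longlonglongrightarrow> gauss_conv \<sigma> H y" by simp
    show "(\<integral>\<^sup>+y. norm (gauss_conv \<sigma> (G n) y) \<partial>lborel) \<le> (\<integral>\<^sup>+y. norm (gauss_conv \<sigma> H y) \<partial>lborel)" for n
      using prob_density_gauss_conv[OF G \<sigma>] prob_density_gauss_conv[OF H \<sigma>] by (simp add: gauss_conv_nonneg)
  qed
  then show ?thesis by (simp add: L1_norm_def)
qed

lemma L1_norm_triangle:
  assumes [measurable]: "f \<in> borel_measurable M" "g \<in> borel_measurable M" "h \<in> borel_measurable M"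
  shows "L1_norm M (\<lambda>x. f x - g x) \<le> L1_norm M (\<lambda>x. f x - h x) + L1_norm M (\<lambda>x. g x - h x)"
proof -
  have "L1_norm M (\<lambda>x. f x - g x) \<le> (\<integral>\<^sup>+x. ennreal \<bar>f x - h x\<bar> + ennreal \<bar>g x - h x\<bar> \<partial>M)"
    unfolding L1_norm_def by (intro nn_integral_mono) (auto simp flip: ennreal_plus intro!: ennreal_leI)
  also have "\<dots> = L1_norm M (\<lambda>x. f x - h x) + L1_norm M (\<lambda>x. g x - h x)"
    unfolding L1_norm_def by (rule nn_integral_add) auto
  finally show ?thesis .
qed

lemma uniform_limit_L1_tendsto:
  fixes u v :: "nat \<Rightarrow> real \<Rightarrow> real"
  assumes u: "uniform_limit {a..b} u g sequentially" and v: "uniform_limit {a..b} v h sequentially"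
    and gh: "AE x in lborel_on a b. g x = h x"
  shows "(\<lambda>n. L1_norm (lborel_on a b) (\<lambda>x. u n x - v n x)) \<longlonglongrightarrow> 0"
proof (rule tendsto_zero_ennreal)
  fix e :: real assume "0 < e"
  interpret L: finite_measure "lborel_on a b" by (rule finite_measure_lborel_on)
  \<comment> \<open>The added 1 makes \<open>w\<close> positive without a case distinction and the
    final inequality strict.\<close>
  define w where "w = measure (lborel_on a b) {a..b} + 1"
  have w: "w > 0" by (simp add: w_def add_nonneg_pos)
  define d where "d = e / (2 * w)"
  have d: "d > 0" using \<open>0 < e\<close> w by (simp add: d_def)
  have "\<forall>\<^sub>F n in sequentially. \<forall>x\<in>{a..b}. dist (u n x) (g x) < d" using u d by (auto simp: uniform_limit_iff)
  moreover have "\<forall>\<^sub>F n in sequentially. \<forall>x\<in>{a..b}. dist (v n x) (h x) < d" using v d by (auto simp: uniform_limit_iff)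
  ultimately show "\<forall>\<^sub>F n in sequentially. L1_norm (lborel_on a b) (\<lambda>x. u n x - v n x) < ennreal e"
  proof eventually_elim
    case (elim n)
    have "AE x in lborel_on a b. x \<in> {a..b}" by (rule AE_I2) (simp add: space_lborel_on)
    with gh have "AE x in lborel_on a b. ennreal \<bar>u n x - v n x\<bar> \<le> ennreal (2 * d)"
    proof eventually_elim
      case (elim x)
      have "dist (u n x) (g x) < d" "dist (v n x) (h x) < d"
        using elim(2) \<open>\<forall>x\<in>{a..b}. dist (u n x) (g x) < d\<close> \<open>\<forall>x\<in>{a..b}. dist (v n x) (h x) < d\<close> by blast+
      then have "\<bar>u n x - v n x\<bar> \<le> 2 * d" using elim(1) unfolding dist_real_def by linarith
      then show ?case by (rule ennreal_leI)
    qed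
    then have "L1_norm (lborel_on a b) (\<lambda>x. u n x - v n x) \<le> (\<integral>\<^sup>+x. ennreal (2 * d) \<partial>lborel_on a b)"
      unfolding L1_norm_def by (rule nn_integral_mono_AE)
    also have "\<dots> = ennreal (2 * d) * ennreal (measure (lborel_on a b) {a..b})"
      using L.emeasure_eq_measure[of "{a..b}"] by (simp add: space_lborel_on)
    also have "\<dots> = ennreal (2 * d * measure (lborel_on a b) {a..b})"
      using d by (simp add: ennreal_mult)
    also have "\<dots> < ennreal e"
    proof (rule ennreal_lessI)
      have "2 * d * measure (lborel_on a b) {a..b} < 2 * d * w" using d by (simp add: w_def)
      also have "\<dots> = e" using w by (simp add: d_def)
      finally show "2 * d * measure (lborel_on a b) {a..b} < e" .
    qed (use \<open>0 < e\<close> in simp)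
    finally show ?case .
  qed
qed

context mixture_class
begin

text \<open>Dominated convergence with majorant \<open>\<bar>p x\<bar>\<close>: the other factor is
  a characteristic function times a convex combination of numbers of modulus 1.\<close>

lemma mixture_moment_tendsto:
  assumes mem: "\<And>n. member (G n) (l n) (m n)" "member H w g"
    and conv: "weak_conv_m G H" and l: "\<And>k. k \<in> {1..K} \<Longrightarrow> (\<lambda>n. l n k) \<longlonglongrightarrow> w k"
    and m: "\<And>k. k \<in> {1..K} \<Longrightarrow> uniform_limit {a..b} (\<lambda>n. m n k) (g k) sequentially"
    and p: "continuous_on {a..b} p"
  shows "(\<lambda>n. mixture_moment a b K p (G n) (l n) (m n) q t) \<longlonglongrightarrow> mixture_moment a b K p H w g q t"
proof -
  have meas: "(\<lambda>x. (indicator {..q} x * p x) *\<^sub>R (char M t * (\<Sum>k\<in>{1..K}. v k * iexp (t * f k x))))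
      \<in> borel_measurable (lborel_on a b)" if "member M v f" for M v f
  proof -
    have "integrable (lborel_on a b) (\<lambda>x. p x *\<^sub>R (char M t * (\<Sum>k\<in>{1..K}. v k * iexp (t * f k x))))"
      by (intro integrable_lborel_on_continuous continuous_intros p member_continuous_on[OF that]) auto
    from integrable_lborel_on_indicator[OF this, of "{..q}"] show ?thesis
      by (simp add: borel_measurable_integrable)
  qed
  have ip: "integrable (lborel_on a b) (\<lambda>x. \<bar>p x\<bar>)"
    by (intro integrable_abs integrable_lborel_on_continuous p)
  have in_ab: "AE x in lborel_on a b. x \<in> {a..b}" by (rule AE_I2) (simp add: space_lborel_on)
  show ?thesis unfolding mixture_moment_def
  proof (rule integral_dominated_convergence[where w = "\<lambda>x. \<bar>p x\<bar>"])
    show "AE x in lborel_on a b. (\<lambda>n. (indicator {..q} x * p x) *\<^sub>R (char (G n) t * (\<Sum>k\<in>{1..K}. l n k * iexp (t * m n k x))))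
      \<longlonglongrightarrow> (indicator {..q} x * p x) *\<^sub>R (char H t * (\<Sum>k\<in>{1..K}. w k * iexp (t * g k x)))"
      using in_ab
    proof eventually_elim
      case (elim x)
      have "(\<lambda>n. m n k x) \<longlonglongrightarrow> g k x" if "k \<in> {1..K}" for k
        using tendsto_uniform_limitI[OF m[OF that] elim] .
      then show ?case
        by (intro tendsto_intros levy_continuity1[OF memberD(1)[OF mem(1)] memberD(1)[OF mem(2)] conv] l) auto
    qed
    fix n
    interpret Gn: real_distribution "G n" by (rule memberD(1)[OF mem(1)])
    have "norm ((indicator {..q} x * p x) *\<^sub>R (char (G n) t * (\<Sum>k\<in>{1..K}. l n k * iexp (t * m n k x)))) \<le> \<bar>p x\<bar>" for x
    proof -
      have "norm (\<Sum>k\<in>{1..K}. l n k * iexp (t * m n k x)) \<le> (\<Sum>k\<in>{1..K}. norm (l n k * iexp (t * m n k x)))"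
        by (rule norm_sum)
      also have "\<dots> = (\<Sum>k\<in>{1..K}. l n k)"
        by (rule sum.cong[OF refl])
           (use member_weight_bounds[OF mem(1)] in \<open>auto simp: norm_mult less_imp_le\<close>)
      also have "\<dots> = 1" by (rule memberD(4)[OF mem(1)])
      finally have "norm (char (G n) t * (\<Sum>k\<in>{1..K}. l n k * iexp (t * m n k x))) \<le> 1 * 1"
        unfolding norm_mult by (intro mult_mono Gn.cmod_char_le_1) auto
      then have "\<bar>indicator {..q} x * p x\<bar> * norm (char (G n) t * (\<Sum>k\<in>{1..K}. l n k * iexp (t * m n k x))) \<le> \<bar>p x\<bar> * 1"
        by (intro mult_mono) (auto simp: indicator_def)
      then show ?thesis by simp
    qed
    then show "AE x in lborel_on a b. norm ((indicator {..q} x * p x) *\<^sub>R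
      (char (G n) t * (\<Sum>k\<in>{1..K}. l n k * iexp (t * m n k x)))) \<le> \<bar>p x\<bar>" by (intro AE_I2)
  qed (rule meas mem ip)+
qed

text \<open>By continuity this is a finite union of closed sets. Measurability matters because
  \<open>emeasure\<close> is 0 by convention on other sets, so monotonicity into them would
  fail.\<close>

lemma near_coincidence_sets:
  fixes f :: "nat \<Rightarrow> real \<Rightarrow> real" and s :: real
  assumes f: "\<And>k. k \<in> {1..K} \<Longrightarrow> continuous_on {a..b} (f k)"
  shows "{x\<in>{a..b}. \<exists>j\<in>{1..K}. \<exists>k\<in>{1..K}. j \<noteq> k \<and> \<bar>f j x - f k x\<bar> \<le> s} \<in> sets borel"
proof -
  have cl: "closed {x\<in>{a..b}. \<bar>f j x - f k x\<bar> \<le> s}" if "j \<in> {1..K}" "k \<in> {1..K}" for j k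
  proof -
    have "continuous_on {a..b} (\<lambda>x. \<bar>f j x - f k x\<bar>)" by (intro continuous_intros f that)
    from continuous_closed_preimage[OF this closed_atLeastAtMost closed_atMost[of s]]
    show ?thesis by (simp add: vimage_def Collect_conj_eq[symmetric] Int_def)
  qed
  have "(\<Union>j\<in>{1..K}. \<Union>k\<in>{1..K} - {j}. {x\<in>{a..b}. \<bar>f j x - f k x\<bar> \<le> s}) \<in> sets borel"
    by (intro sets.finite_UN borel_closed cl finite_Diff finite_atLeastAtMost) (assumption | erule DiffD1)+
  moreover have "(\<Union>j\<in>{1..K}. \<Union>k\<in>{1..K} - {j}. {x\<in>{a..b}. \<bar>f j x - f k x\<bar> \<le> s})
     = {x\<in>{a..b}. \<exists>j\<in>{1..K}. \<exists>k\<in>{1..K}. j \<noteq> k \<and> \<bar>f j x - f k x\<bar> \<le> s}"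
  proof (intro set_eqI iffI)
    fix x assume "x \<in> (\<Union>j\<in>{1..K}. \<Union>k\<in>{1..K} - {j}. {x\<in>{a..b}. \<bar>f j x - f k x\<bar> \<le> s})"
    then obtain j k where "j \<in> {1..K}" "k \<in> {1..K} - {j}" "x \<in> {a..b}" "\<bar>f j x - f k x\<bar> \<le> s"
      by (elim UN_E CollectE conjE)
    then show "x \<in> {x\<in>{a..b}. \<exists>j\<in>{1..K}. \<exists>k\<in>{1..K}. j \<noteq> k \<and> \<bar>f j x - f k x\<bar> \<le> s}"
      by - (rule CollectI, rule conjI, assumption, rule bexI[of _ j], rule bexI[of _ k], simp_all)
  next
    fix x assume "x \<in> {x\<in>{a..b}. \<exists>j\<in>{1..K}. \<exists>k\<in>{1..K}. j \<noteq> k \<and> \<bar>f j x - f k x\<bar> \<le> s}"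
    then obtain j k where "j \<in> {1..K}" "k \<in> {1..K}" "j \<noteq> k" "x \<in> {a..b}" "\<bar>f j x - f k x\<bar> \<le> s"
      by (elim CollectE conjE bexE)
    then show "x \<in> (\<Union>j\<in>{1..K}. \<Union>k\<in>{1..K} - {j}. {x\<in>{a..b}. \<bar>f j x - f k x\<bar> \<le> s})"
      by (intro UN_I[of j] UN_I[of k]) simp_all
  qed
  ultimately show ?thesis by (simp only:)
qed

text \<open>Where two limits coincide, the approximating functions are nearly equal. For each level
  \<open>s n\<close> some late member of the sequence has a near-coincidence set containing the
  whole coincidence set \<open>E\<close> of the limit, so the measure of \<open>E\<close> is below a
  bound that tends to 0.\<close>

lemma limit_components_distinct:
  fixes f :: "'t \<Rightarrow> nat \<Rightarrow> real \<Rightarrow> real" and \<tau> :: "nat \<Rightarrow> 't"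
  assumes sep: "\<And>s :: nat \<Rightarrow> real. s \<longlonglongrightarrow> 0 \<Longrightarrow>
      (\<lambda>n. SUP \<theta>\<in>U. emeasure lborel {x\<in>{a..b}. \<exists>j\<in>{1..K}. \<exists>k\<in>{1..K}.
          j \<noteq> k \<and> \<bar>f \<theta> j x - f \<theta> k x\<bar> \<le> s n}) \<longlonglongrightarrow> 0"
    and \<tau>: "\<And>n. \<tau> n \<in> U"
    and fc: "\<And>n k. k \<in> {1..K} \<Longrightarrow> continuous_on {a..b} (f (\<tau> n) k)"
    and lim: "\<And>k. k \<in> {1..K} \<Longrightarrow> uniform_limit {a..b} (\<lambda>n. f (\<tau> n) k) (g k) sequentially"
    and gc: "\<And>k. k \<in> {1..K} \<Longrightarrow> continuous_on {a..b} (g k)"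
  shows "AE x in lborel_on a b. \<forall>j\<in>{1..K}. \<forall>k\<in>{1..K}. j \<noteq> k \<longrightarrow> g j x \<noteq> g k x"
proof -
  define E where "E = {x\<in>{a..b}. \<exists>j\<in>{1..K}. \<exists>k\<in>{1..K}. j \<noteq> k \<and> \<bar>g j x - g k x\<bar> \<le> 0}"
  \<comment> \<open>Each of the two functions is within \<open>inverse (real (Suc n))\<close> of its
    limit, hence the factor 2.\<close>
  define s :: "nat \<Rightarrow> real" where "s n = 2 * inverse (real (Suc n))" for n
  define V where "V n = (SUP \<theta>\<in>U. emeasure lborel {x\<in>{a..b}. \<exists>j\<in>{1..K}. \<exists>k\<in>{1..K}.
          j \<noteq> k \<and> \<bar>f \<theta> j x - f \<theta> k x\<bar> \<le> s n})" for n
  have E: "E \<in> sets borel" unfolding E_def by (rule near_coincidence_sets[OF gc])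
  have "s \<longlonglongrightarrow> 2 * 0" unfolding s_def by (intro tendsto_intros LIMSEQ_inverse_real_of_nat)
  then have "V \<longlonglongrightarrow> 0" unfolding V_def by (intro sep) simp
  moreover have "emeasure lborel E \<le> V n" for n
  proof -
    have pos: "0 < inverse (real (Suc n))" by simp
    have "\<forall>\<^sub>F i in sequentially. \<forall>k\<in>{1..K}. \<forall>x\<in>{a..b}. dist (f (\<tau> i) k x) (g k x) < inverse (real (Suc n))"
    proof (rule eventually_ball_finite)
      show "\<forall>k\<in>{1..K}. \<forall>\<^sub>F i in sequentially. \<forall>x\<in>{a..b}. dist (f (\<tau> i) k x) (g k x) < inverse (real (Suc n))"
        using lim pos unfolding uniform_limit_iff by blast
    qed simp
    then obtain i where i: "\<And>k x. k \<in> {1..K} \<Longrightarrow> x \<in> {a..b} \<Longrightarrow> dist (f (\<tau> i) k x) (g k x) < inverse (real (Suc n))"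
      unfolding eventually_sequentially by blast
    have "E \<subseteq> {x\<in>{a..b}. \<exists>j\<in>{1..K}. \<exists>k\<in>{1..K}. j \<noteq> k \<and> \<bar>f (\<tau> i) j x - f (\<tau> i) k x\<bar> \<le> s n}"
    proof
      fix x assume "x \<in> E"
      then obtain j k where x: "x \<in> {a..b}" and jk: "j \<in> {1..K}" "k \<in> {1..K}" "j \<noteq> k" "\<bar>g j x - g k x\<bar> \<le> 0"
        unfolding E_def by blast
      have "\<bar>f (\<tau> i) j x - f (\<tau> i) k x\<bar> \<le> s n"
        using i[OF jk(1) x] i[OF jk(2) x] jk(4) unfolding dist_real_def s_def by linarith
      then show "x \<in> {x\<in>{a..b}. \<exists>j\<in>{1..K}. \<exists>k\<in>{1..K}. j \<noteq> k \<and> \<bar>f (\<tau> i) j x - f (\<tau> i) k x\<bar> \<le> s n}"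
        using x jk by blast
    qed
    then have "emeasure lborel E \<le> emeasure lborel {x\<in>{a..b}. \<exists>j\<in>{1..K}. \<exists>k\<in>{1..K}. j \<noteq> k \<and> \<bar>f (\<tau> i) j x - f (\<tau> i) k x\<bar> \<le> s n}"
      by (rule emeasure_mono) (simp only: sets_lborel near_coincidence_sets[OF fc])
    also have "\<dots> \<le> V n" unfolding V_def by (rule SUP_upper[OF \<tau>])
    finally show ?thesis .
  qed
  ultimately have "emeasure lborel E \<le> 0" by (intro LIMSEQ_le_const[of V]) auto
  then have "E \<in> null_sets lborel" using E by (auto simp: null_sets_def)
  then have "AE x in lborel. x \<notin> E" by (rule AE_not_in)
  then have "AE x in lborel. x \<in> {a..b} \<longrightarrow> (\<forall>j\<in>{1..K}. \<forall>k\<in>{1..K}. j \<noteq> k \<longrightarrow> g j x \<noteq> g k x)"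
    by eventually_elim (auto simp: E_def)
  then show ?thesis unfolding lborel_on_def by (subst AE_restrict_space_iff) auto
qed

text \<open>Compactness turns identifiability into its uniform version: two sequences of members with
  asymptotically equal moments but loss above \<open>\<epsilon>\<close> would converge to members with equal moments.\<close>

lemma uniform_identifiability:
  fixes G :: "'t \<Rightarrow> real measure" and l :: "'t \<Rightarrow> nat \<Rightarrow> real" and m :: "'t \<Rightarrow> nat \<Rightarrow> real \<Rightarrow> real"
    and T :: "nat \<Rightarrow> 't \<Rightarrow> real" and \<kappa> :: "real \<Rightarrow> complex"
  assumes K: "K \<ge> 1" and \<sigma>: "\<sigma> > 0"
    and mem: "\<And>\<theta>. \<theta> \<in> U \<Longrightarrow> member (G \<theta>) (l \<theta>) (m \<theta>)"
    and sep: "\<And>s :: nat \<Rightarrow> real. s \<longlonglongrightarrow> 0 \<Longrightarrow>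
      (\<lambda>n. SUP \<theta>\<in>U. emeasure lborel {x\<in>{a..b}. \<exists>j\<in>{1..K}. \<exists>k\<in>{1..K}.
          j \<noteq> k \<and> \<bar>m \<theta> j x - m \<theta> k x\<bar> \<le> s n}) \<longlonglongrightarrow> 0"
    and p: "continuous_on {a..b} p" "\<And>x. x \<in> {a..b} \<Longrightarrow> 0 < p x"
    and \<kappa>: "\<And>t. \<kappa> t \<noteq> 0"
    and T: "\<And>q t. q \<in> \<rat> \<Longrightarrow> t \<in> \<rat> \<Longrightarrow> \<exists>i j. \<forall>\<theta>\<in>U.
      \<kappa> t * mixture_moment a b K p (G \<theta>) (l \<theta>) (m \<theta>) q t = Complex (T i \<theta>) (T j \<theta>)"
    and \<epsilon>: "\<epsilon> > 0"
  shows "\<exists>(N::nat) \<delta>. \<delta> > 0 \<and> (\<forall>\<theta>\<in>U. \<forall>\<theta>'\<in>U. (\<forall>i<N. \<bar>T i \<theta> - T i \<theta>'\<bar> \<le> \<delta>) \<longrightarrow>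
    max (L1_norm lborel (\<lambda>y. gauss_conv \<sigma> (G \<theta>) y - gauss_conv \<sigma> (G \<theta>') y))
     (max (Max ((\<lambda>k. ennreal \<bar>l \<theta> k - l \<theta>' k\<bar>) ` {1..K}))
      (Max ((\<lambda>k. L1_norm (lborel_on a b) (\<lambda>x. m \<theta> k x - m \<theta>' k x)) ` {1..K}))) \<le> ennreal \<epsilon>)"
proof (rule ccontr)
  define loss where "loss \<theta> \<theta>' = max (L1_norm lborel (\<lambda>y. gauss_conv \<sigma> (G \<theta>) y - gauss_conv \<sigma> (G \<theta>') y))
     (max (Max ((\<lambda>k. ennreal \<bar>l \<theta> k - l \<theta>' k\<bar>) ` {1..K}))
      (Max ((\<lambda>k. L1_norm (lborel_on a b) (\<lambda>x. m \<theta> k x - m \<theta>' k x)) ` {1..K})))" for \<theta> \<theta>'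
  assume "\<not> ?thesis"
  then have neg: "\<not> (\<exists>(N::nat) \<delta>. \<delta> > 0 \<and> (\<forall>\<theta>\<in>U. \<forall>\<theta>'\<in>U. (\<forall>i<N. \<bar>T i \<theta> - T i \<theta>'\<bar> \<le> \<delta>) \<longrightarrow>
    loss \<theta> \<theta>' \<le> ennreal \<epsilon>))" by (simp only: loss_def not_False_eq_True)
  \<comment> \<open>The negation is used with \<open>N = n\<close> and
    \<open>\<delta> = inverse (real (Suc n))\<close>, so that eventually every test is included
    while the tolerance shrinks.\<close>
  have "\<forall>n. \<exists>\<theta>. \<exists>\<theta>'. \<theta> \<in> U \<and> \<theta>' \<in> U \<and> (\<forall>i<n. \<bar>T i \<theta> - T i \<theta>'\<bar> \<le> inverse (real (Suc n))) \<and> \<not> loss \<theta> \<theta>' \<le> ennreal \<epsilon>"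
  proof
    fix n :: nat
    have "\<not> (\<forall>\<theta>\<in>U. \<forall>\<theta>'\<in>U. (\<forall>i<n. \<bar>T i \<theta> - T i \<theta>'\<bar> \<le> inverse (real (Suc n))) \<longrightarrow> loss \<theta> \<theta>' \<le> ennreal \<epsilon>)"
    proof
      assume *: "\<forall>\<theta>\<in>U. \<forall>\<theta>'\<in>U. (\<forall>i<n. \<bar>T i \<theta> - T i \<theta>'\<bar> \<le> inverse (real (Suc n))) \<longrightarrow> loss \<theta> \<theta>' \<le> ennreal \<epsilon>"
      have "inverse (real (Suc n)) > 0" by simp
      with * have "\<exists>(N::nat) \<delta>. \<delta> > 0 \<and> (\<forall>\<theta>\<in>U. \<forall>\<theta>'\<in>U. (\<forall>i<N. \<bar>T i \<theta> - T i \<theta>'\<bar> \<le> \<delta>) \<longrightarrow>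
        loss \<theta> \<theta>' \<le> ennreal \<epsilon>)" by (intro exI conjI)
      then show False using neg by (rule notE[rotated])
    qed
    then show "\<exists>\<theta>. \<exists>\<theta>'. \<theta> \<in> U \<and> \<theta>' \<in> U \<and> (\<forall>i<n. \<bar>T i \<theta> - T i \<theta>'\<bar> \<le> inverse (real (Suc n))) \<and> \<not> loss \<theta> \<theta>' \<le> ennreal \<epsilon>"
      by simp blast
  qed
  from choice[OF this] obtain \<tau> where "\<forall>n. \<exists>\<theta>'. \<tau> n \<in> U \<and> \<theta>' \<in> U \<and>
    (\<forall>i<n. \<bar>T i (\<tau> n) - T i \<theta>'\<bar> \<le> inverse (real (Suc n))) \<and> \<not> loss (\<tau> n) \<theta>' \<le> ennreal \<epsilon>" ..
  from choice[OF this] obtain \<tau>' where tt: "\<forall>n. \<tau> n \<in> U \<and> \<tau>' n \<in> U \<and>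
    (\<forall>i<n. \<bar>T i (\<tau> n) - T i (\<tau>' n)\<bar> \<le> inverse (real (Suc n))) \<and> \<not> loss (\<tau> n) (\<tau>' n) \<le> ennreal \<epsilon>" ..
  have \<tau>: "\<tau> n \<in> U" "\<tau>' n \<in> U" for n using tt by blast+
  have close: "\<bar>T i (\<tau> n) - T i (\<tau>' n)\<bar> \<le> inverse (real (Suc n))" if "i < n" for i n
    using tt that by blast
  have far: "\<not> loss (\<tau> n) (\<tau>' n) \<le> ennreal \<epsilon>" for n using tt by blast
  obtain r1 H w g where r1: "strict_mono (r1 :: nat \<Rightarrow> nat)" and memH: "member H w g"
    and cH: "weak_conv_m ((\<lambda>n. G (\<tau> n)) \<circ> r1) H"
    and lw: "\<forall>k\<in>{1..K}. (\<lambda>n. l (\<tau> (r1 n)) k) \<longlonglongrightarrow> w k"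
    and mg: "\<forall>k\<in>{1..K}. uniform_limit {a..b} (\<lambda>n. m (\<tau> (r1 n)) k) (g k) sequentially"
    using member_compact[of "\<lambda>n. G (\<tau> n)" "\<lambda>n. l (\<tau> n)" "\<lambda>n. m (\<tau> n)", OF mem[OF \<tau>(1)]]
    by (elim exE conjE)
  \<comment> \<open>The second extraction runs along the first, so both sequences converge along the
    composition \<open>r\<close>.\<close>
  obtain r2 H' w' g' where r2: "strict_mono (r2 :: nat \<Rightarrow> nat)" and memH': "member H' w' g'"
    and cH': "weak_conv_m ((\<lambda>n. G (\<tau>' (r1 n))) \<circ> r2) H'"
    and lw': "\<forall>k\<in>{1..K}. (\<lambda>n. l (\<tau>' (r1 (r2 n))) k) \<longlonglongrightarrow> w' k"
    and mg': "\<forall>k\<in>{1..K}. uniform_limit {a..b} (\<lambda>n. m (\<tau>' (r1 (r2 n))) k) (g' k) sequentially"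
    using member_compact[of "\<lambda>n. G (\<tau>' (r1 n))" "\<lambda>n. l (\<tau>' (r1 n))" "\<lambda>n. m (\<tau>' (r1 n))", OF mem[OF \<tau>(2)]]
    by (elim exE conjE)
  define r where "r n = r1 (r2 n)" for n
  have r: "strict_mono r" unfolding r_def using strict_mono_o[OF r1 r2] by (simp add: comp_def)
  have cH: "weak_conv_m (\<lambda>n. G (\<tau> (r n))) H"
    using weak_conv_m_subseq[OF cH r2] by (simp add: comp_def r_def)
  have cH': "weak_conv_m (\<lambda>n. G (\<tau>' (r n))) H'" using cH' by (simp add: comp_def r_def)
  have lw: "(\<lambda>n. l (\<tau> (r n)) k) \<longlonglongrightarrow> w k" if "k \<in> {1..K}" for k
    using LIMSEQ_subseq_LIMSEQ[OF bspec[OF lw that] r2] by (simp add: comp_def r_def)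
  have lw': "(\<lambda>n. l (\<tau>' (r n)) k) \<longlonglongrightarrow> w' k" if "k \<in> {1..K}" for k
    using bspec[OF lw' that] by (simp add: r_def)
  have mg: "uniform_limit {a..b} (\<lambda>n. m (\<tau> (r n)) k) (g k) sequentially" if "k \<in> {1..K}" for k
    using bspec[OF mg that] unfolding uniform_limit_iff r_def using eventually_subseq[OF r2] by blast
  have mg': "uniform_limit {a..b} (\<lambda>n. m (\<tau>' (r n)) k) (g' k) sequentially" if "k \<in> {1..K}" for k
    using bspec[OF mg' that] by (simp add: r_def)
  have T0: "(\<lambda>n. T i (\<tau> (r n)) - T i (\<tau>' (r n))) \<longlonglongrightarrow> 0" for i
  proof -
    \<comment> \<open>Test \<open>i\<close> is controlled only from \<open>n > i\<close> on, which
      is enough for a limit.\<close>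
    have "(\<lambda>n. T i (\<tau> n) - T i (\<tau>' n)) \<longlonglongrightarrow> 0"
    proof (rule Lim_null_comparison[OF _ LIMSEQ_inverse_real_of_nat])
      show "\<forall>\<^sub>F n in sequentially. norm (T i (\<tau> n) - T i (\<tau>' n)) \<le> inverse (real (Suc n))"
        using eventually_gt_at_top[of i] by eventually_elim (simp only: real_norm_def close)
    qed
    from LIMSEQ_subseq_LIMSEQ[OF this r] show ?thesis by (simp add: comp_def)
  qed
  have id: "H = H' \<and> (\<forall>k\<in>{1..K}. w k = w' k) \<and> (AE x in lborel_on a b. \<forall>k\<in>{1..K}. g k x = g' k x)"
  proof (rule members_identified[OF memH memH' _ _ p])
    show "AE x in lborel_on a b. \<forall>j\<in>{1..K}. \<forall>k\<in>{1..K}. j \<noteq> k \<longrightarrow> g j x \<noteq> g k x"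
      by (rule limit_components_distinct[where f = m and \<tau> = "\<lambda>n. \<tau> (r n)", OF sep \<tau>(1) member_continuous_on[OF mem[OF \<tau>(1)]]
           mg member_continuous_on[OF memH]])
    show "AE x in lborel_on a b. \<forall>j\<in>{1..K}. \<forall>k\<in>{1..K}. j \<noteq> k \<longrightarrow> g' j x \<noteq> g' k x"
      by (rule limit_components_distinct[where f = m and \<tau> = "\<lambda>n. \<tau>' (r n)", OF sep \<tau>(2) member_continuous_on[OF mem[OF \<tau>(2)]]
           mg' member_continuous_on[OF memH']])
    fix q t :: real assume q: "q \<in> \<rat>" and t: "t \<in> \<rat>"
    obtain i j where ij: "\<forall>\<theta>\<in>U. \<kappa> t * mixture_moment a b K p (G \<theta>) (l \<theta>) (m \<theta>) q t = Complex (T i \<theta>) (T j \<theta>)"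
      using T[OF q t] by (elim exE)
    let ?M = "\<lambda>\<theta>. mixture_moment a b K p (G \<theta>) (l \<theta>) (m \<theta>) q t"
    have "(\<lambda>n. ?M (\<tau> (r n))) \<longlonglongrightarrow> mixture_moment a b K p H w g q t"
      by (rule mixture_moment_tendsto[OF mem[OF \<tau>(1)] memH cH lw mg p(1)])
    moreover have "(\<lambda>n. ?M (\<tau>' (r n))) \<longlonglongrightarrow> mixture_moment a b K p H' w' g' q t"
      by (rule mixture_moment_tendsto[OF mem[OF \<tau>(2)] memH' cH' lw' mg' p(1)])
    ultimately have "(\<lambda>n. \<kappa> t * ?M (\<tau> (r n)) - \<kappa> t * ?M (\<tau>' (r n)))
      \<longlonglongrightarrow> \<kappa> t * mixture_moment a b K p H w g q t - \<kappa> t * mixture_moment a b K p H' w' g' q t"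
      by (intro tendsto_intros)
    moreover have "(\<lambda>n. \<kappa> t * ?M (\<tau> (r n)) - \<kappa> t * ?M (\<tau>' (r n))) \<longlonglongrightarrow> 0"
    proof -
      have "(\<lambda>n. Complex (T i (\<tau> (r n)) - T i (\<tau>' (r n))) (T j (\<tau> (r n)) - T j (\<tau>' (r n)))) \<longlonglongrightarrow> Complex 0 0"
        by (rule tendsto_Complex[OF T0 T0])
      moreover have "\<kappa> t * ?M (\<tau> n) - \<kappa> t * ?M (\<tau>' n) = Complex (T i (\<tau> n) - T i (\<tau>' n)) (T j (\<tau> n) - T j (\<tau>' n))" for n
        unfolding bspec[OF ij \<tau>(1)[of n]] bspec[OF ij \<tau>(2)[of n]] by (rule complex_eqI) simp_all
      ultimately show ?thesis by (simp add: zero_complex.code)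
    qed
    ultimately have "\<kappa> t * mixture_moment a b K p H w g q t - \<kappa> t * mixture_moment a b K p H' w' g' q t = 0"
      by (rule LIMSEQ_unique)
    then show "mixture_moment a b K p H w g q t = mixture_moment a b K p H' w' g' q t"
      using \<kappa>[of t] by simp
  qed
  have RD: "real_distribution (G (\<tau> n))" "real_distribution (G (\<tau>' n))" for n
    using memberD(1)[OF mem[OF \<tau>(1)]] memberD(1)[OF mem[OF \<tau>(2)]] by blast+
  \<comment> \<open>Both sequences of densities tend to the one built from \<open>H\<close>, since
    \<open>H = H'\<close>.\<close>
  have L1f: "(\<lambda>n. L1_norm lborel (\<lambda>y. gauss_conv \<sigma> (G (\<tau> (r n))) y - gauss_conv \<sigma> (G (\<tau>' (r n))) y)) \<longlonglongrightarrow> 0"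
  proof (rule tendsto_sandwich[OF _ _ tendsto_const])
    have "(\<lambda>n. L1_norm lborel (\<lambda>y. gauss_conv \<sigma> (G (\<tau> (r n))) y - gauss_conv \<sigma> H y)
        + L1_norm lborel (\<lambda>y. gauss_conv \<sigma> (G (\<tau>' (r n))) y - gauss_conv \<sigma> H y)) \<longlonglongrightarrow> 0 + 0"
      using id cH' by (intro tendsto_add gauss_conv_L1_tendsto RD memberD(1)[OF memH] cH \<sigma>) simp
    then show "(\<lambda>n. L1_norm lborel (\<lambda>y. gauss_conv \<sigma> (G (\<tau> (r n))) y - gauss_conv \<sigma> H y)
        + L1_norm lborel (\<lambda>y. gauss_conv \<sigma> (G (\<tau>' (r n))) y - gauss_conv \<sigma> H y)) \<longlonglongrightarrow> 0" by simp
    show "\<forall>\<^sub>F n in sequentially. L1_norm lborel (\<lambda>y. gauss_conv \<sigma> (G (\<tau> (r n))) y - gauss_conv \<sigma> (G (\<tau>' (r n))) y)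
      \<le> L1_norm lborel (\<lambda>y. gauss_conv \<sigma> (G (\<tau> (r n))) y - gauss_conv \<sigma> H y)
        + L1_norm lborel (\<lambda>y. gauss_conv \<sigma> (G (\<tau>' (r n))) y - gauss_conv \<sigma> H y)"
      by (intro always_eventually allI L1_norm_triangle)
         (simp_all add: borel_measurable_gauss_conv RD memberD(1)[OF memH])
  qed simp
  have L1m: "(\<lambda>n. L1_norm (lborel_on a b) (\<lambda>x. m (\<tau> (r n)) k x - m (\<tau>' (r n)) k x)) \<longlonglongrightarrow> 0" if k: "k \<in> {1..K}" for k
  proof (rule uniform_limit_L1_tendsto[OF mg[OF k] mg'[OF k]])
    have "AE x in lborel_on a b. \<forall>k\<in>{1..K}. g k x = g' k x" using id by blast
    then show "AE x in lborel_on a b. g k x = g' k x" by eventually_elim (use k in blast)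
  qed
  have Ll: "(\<lambda>n. ennreal \<bar>l (\<tau> (r n)) k - l (\<tau>' (r n)) k\<bar>) \<longlonglongrightarrow> 0" if k: "k \<in> {1..K}" for k
  proof -
    have "w k = w' k" using id k by blast
    then have "(\<lambda>n. \<bar>l (\<tau> (r n)) k - l (\<tau>' (r n)) k\<bar>) \<longlonglongrightarrow> 0"
      using tendsto_rabs[OF tendsto_diff[OF lw[OF k] lw'[OF k]]] by simp
    then show ?thesis by (metis ennreal_0 tendsto_ennrealI)
  qed
  have small: "\<forall>\<^sub>F n in sequentially. u n < ennreal \<epsilon>" if "u \<longlonglongrightarrow> (0::ennreal)" for u
    by (rule order_tendstoD(2)[OF that]) (use \<epsilon> in simp)
  have "\<forall>\<^sub>F n in sequentially. \<forall>k\<in>{1..K}. L1_norm (lborel_on a b) (\<lambda>x. m (\<tau> (r n)) k x - m (\<tau>' (r n)) k x) < ennreal \<epsilon>"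
    by (rule eventually_ball_finite[OF finite_atLeastAtMost ballI]) (rule small[OF L1m])
  moreover have "\<forall>\<^sub>F n in sequentially. \<forall>k\<in>{1..K}. ennreal \<bar>l (\<tau> (r n)) k - l (\<tau>' (r n)) k\<bar> < ennreal \<epsilon>"
    by (rule eventually_ball_finite[OF finite_atLeastAtMost ballI]) (rule small[OF Ll])
  moreover note small[OF L1f]
  ultimately have "\<forall>\<^sub>F n in sequentially. loss (\<tau> (r n)) (\<tau>' (r n)) \<le> ennreal \<epsilon>"
  proof eventually_elim
    case (elim n)
    \<comment> \<open>\<open>Max\<close> has its meaning only on nonempty sets; this is where
      \<open>K \<ge> 1\<close> enters.\<close>
    have bound: "Max (u ` {1..K}) \<le> ennreal \<epsilon>" if "\<forall>k\<in>{1..K}. u k < ennreal \<epsilon>" for u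
    proof (rule Max.boundedI)
      show "u ` {1..K} \<noteq> {}" using K by simp
      show "y \<le> ennreal \<epsilon>" if "y \<in> u ` {1..K}" for y
        using that \<open>\<forall>k\<in>{1..K}. u k < ennreal \<epsilon>\<close> less_imp_le by (elim imageE) blast
    qed (rule finite_imageI[OF finite_atLeastAtMost])
    show ?case unfolding loss_def
      by (intro max.boundedI bound elim(1) elim(2) less_imp_le[OF elim(3)])
  qed
  then obtain n where "loss (\<tau> (r n)) (\<tau>' (r n)) \<le> ennreal \<epsilon>"
    unfolding eventually_sequentially by blast
  then show False using far by blast
qed

end

section \<open>Consequences of the hypotheses on the model class\<close>

text \<open>The complement of the support is the union of all open null sets. By Lindelof countably
  many of them have the same union, which is therefore null.\<close>

lemma AE_measure_support:
  assumes "real_distribution G"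
  shows "AE x in G. x \<in> measure_support G"
proof -
  interpret G: real_distribution G by (rule assms)
  define \<F> where "\<F> = {V :: real set. open V \<and> emeasure G V = 0}"
  obtain \<F>' where F': "\<F>' \<subseteq> \<F>" "countable \<F>'" "\<Union>\<F>' = \<Union>\<F>"
    using Lindelof[of \<F>] unfolding \<F>_def by blast
  have "(\<Union>V\<in>\<F>'. V) \<in> null_sets G"
    by (rule null_sets_UN'[OF F'(2)]) (use F'(1) in \<open>auto simp: \<F>_def null_sets_def\<close>)
  then have "\<Union>\<F> \<in> null_sets G" using F'(3) by simp
  then have "AE x in G. x \<notin> \<Union>\<F>" by (rule AE_not_in)
  then show ?thesis
    by eventually_elim (auto simp: \<F>_def measure_support_def zero_less_iff_neq_zero)
qed

text \<open>A compact nonempty support contains its smallest and largest elements, so their distance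
  is bounded by the diameter.\<close>

lemma measure_support_interval:
  assumes G: "real_distribution G" and comp: "compact (measure_support G)"
  obtains \<alpha> \<beta> where "AE x in G. x \<in> {\<alpha>..\<beta>}" "\<beta> - \<alpha> \<le> diameter (measure_support G)"
proof -
  interpret G: real_distribution G by (rule G)
  let ?S = "measure_support G"
  have ne: "?S \<noteq> {}"
  proof
    assume "?S = {}"
    then have "AE x in G. False" using AE_measure_support[OF G] by simp
    then show False by (simp add: G.AE_False)
  qed
  obtain \<alpha> where \<alpha>: "\<alpha> \<in> ?S" "\<And>x. x \<in> ?S \<Longrightarrow> \<alpha> \<le> x" using compact_attains_inf[OF comp ne] by blast
  obtain \<beta> where \<beta>: "\<beta> \<in> ?S" "\<And>x. x \<in> ?S \<Longrightarrow> x \<le> \<beta>" using compact_attains_sup[OF comp ne] by blast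
  show ?thesis
  proof (rule that)
    show "AE x in G. x \<in> {\<alpha>..\<beta>}" using AE_measure_support[OF G] by eventually_elim (use \<alpha> \<beta> in auto)
    have "dist \<beta> \<alpha> \<le> diameter ?S"
      by (rule diameter_bounded_bound[OF compact_imp_bounded[OF comp] \<beta>(1) \<alpha>(1)])
    then show "\<beta> - \<alpha> \<le> diameter ?S" by (simp add: dist_real_def)
  qed
qed

text \<open>A mean of zero anchors the interval at 0. A bound on the diameter of the support thereby
  becomes a bound on its position, which tightness needs.\<close>

lemma centred_interval:
  assumes G: "real_distribution G" and sup: "AE x in G. x \<in> {\<alpha>..\<beta>}" and mean: "(\<integral>x. x \<partial>G) = 0"
  shows "\<alpha> \<le> 0" "0 \<le> \<beta>"
proof -
  interpret G: real_distribution G by (rule G)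
  have int: "integrable G (\<lambda>x. x)"
    by (rule G.integrable_const_bound[of _ "max \<bar>\<alpha>\<bar> \<bar>\<beta>\<bar>"]) (use sup in auto)
  have "(\<integral>x. \<alpha> \<partial>G) \<le> (\<integral>x. x \<partial>G)" by (rule integral_mono_AE) (use sup int in auto)
  then show "\<alpha> \<le> 0" using mean G.prob_space by simp
  have "(\<integral>x. x \<partial>G) \<le> (\<integral>x. \<beta> \<partial>G)" by (rule integral_mono_AE) (use sup int in auto)
  then show "0 \<le> \<beta>" using mean G.prob_space by simp
qed

text \<open>A derivative that exists everywhere and is bounded almost everywhere gives a Lipschitz bound,
  because every derivative is Henstock--Kurzweil integrable.\<close>

lemma lipschitz_from_AE_derivative_bound:
  fixes f :: "real \<Rightarrow> real"
  assumes diff: "f differentiable_on {a..b}" and "0 \<le> B"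
    and bound: "AE x in lborel_on a b. \<bar>deriv_on a b f x\<bar> \<le> B"
    and xy: "x \<in> {a..b}" "y \<in> {a..b}"
  shows "\<bar>f x - f y\<bar> \<le> B * \<bar>x - y\<bar>"
proof -
  define N where "N = {x\<in>{a..b}. \<not> \<bar>deriv_on a b f x\<bar> \<le> B}"
  have "AE x in lborel. x \<in> {a..b} \<longrightarrow> \<bar>deriv_on a b f x\<bar> \<le> B"
    using bound unfolding lborel_on_def by (subst (asm) AE_restrict_space_iff) auto
  then have "AE x in lborel. x \<notin> N" by eventually_elim (auto simp: N_def)
  then have "AE x in lebesgue. x \<notin> N" by (rule AE_completion)
  then have "negligible N" by (simp add: negligible_iff_null_sets AE_iff_null_sets AE_not_in completion.AE_iff_null_sets flip: eventually_ae_filter)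
  have *: "\<bar>f v - f u\<bar> \<le> B * (v - u)" if "u \<in> {a..b}" "v \<in> {a..b}" "u \<le> v" for u v
  proof -
    have sub: "{u..v} \<subseteq> {a..b}" using that by auto
    have "(deriv_on a b f has_integral (f v - f u)) {u..v}"
    proof (rule fundamental_theorem_of_calculus[OF that(3)])
      fix z assume z: "z \<in> {u..v}"
      have "(f has_vector_derivative deriv_on a b f z) (at z within {a..b})"
        using diff z sub unfolding differentiable_on_def deriv_on_def
        by (auto simp: vector_derivative_works[symmetric])
      then show "(f has_vector_derivative deriv_on a b f z) (at z within {u..v})"
        by (rule has_vector_derivative_within_subset[OF _ sub])
    qed
    \<comment> \<open>Setting the derivative to 0 on the null set \<open>N\<close> leaves the
      integral unchanged and makes the bound \<open>B\<close> hold at every point.\<close>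
    then have "((\<lambda>z. if z \<in> N then 0 else deriv_on a b f z) has_integral (f v - f u)) {u..v}"
      by (rule has_integral_spike[OF \<open>negligible N\<close>, rotated]) auto
    then have "norm (f v - f u) \<le> B * measure lborel (cbox u v)"
      by (intro has_integral_bound[OF \<open>0 \<le> B\<close>]) (use sub \<open>0 \<le> B\<close> in \<open>auto simp: N_def\<close>)
    then show ?thesis using that by simp
  qed
  show ?thesis
  proof (cases "x \<le> y")
    case True
    then show ?thesis using *[OF xy True] by (simp add: abs_minus_commute)
  next
    case False
    then show ?thesis using *[OF xy(2,1)] by simp
  qed
qed

lemma AE_lborel_on_witness:
  assumes "a < b" and P: "AE x in lborel_on a b. P x"
  shows "\<exists>x\<in>{a..b}. P x"
proof (rule ccontr)
  assume no: "\<not> ?thesis"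
  have "AE x in lborel_on a b. x \<in> {a..b}" by (rule AE_I2) (simp add: space_lborel_on)
  with P have "AE x in lborel_on a b. False" by eventually_elim (use no in blast)
  then have "emeasure (lborel_on a b) (space (lborel_on a b)) = 0"
    by (simp add: ae_filter_eq_bot_iff[symmetric] eventually_False)
  moreover have "emeasure (lborel_on a b) (space (lborel_on a b)) = ennreal (b - a)"
    unfolding space_lborel_on lborel_on_def using \<open>a < b\<close> by (subst emeasure_restrict_space) auto
  ultimately show False using \<open>a < b\<close> by simp
qed

text \<open>The norms control values only almost everywhere. A set of full measure in an interval of
  positive length contains some \<open>z\<close> with \<open>\<bar>f z\<bar> \<le> C\<close>, and
  the Lipschitz bound carries this to every point; hence \<open>C + C * (b - a)\<close>.\<close>

lemma regression_bounds:
  fixes f :: "real \<Rightarrow> real"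
  assumes "a < b" and diff: "f differentiable_on {a..b}"
    and norms: "Linf_norm (lborel_on a b) f \<le> ereal C" "Linf_norm (lborel_on a b) (deriv_on a b f) \<le> ereal C"
    and xy: "x \<in> {a..b}" "y \<in> {a..b}"
  shows "\<bar>f x\<bar> \<le> C + C * (b - a)" "\<bar>f x - f y\<bar> \<le> C * \<bar>x - y\<bar>" "0 \<le> C"
proof -
  have AE: "AE x in lborel_on a b. \<bar>g x\<bar> \<le> C" if "Linf_norm (lborel_on a b) g \<le> ereal C" for g :: "real \<Rightarrow> real"
  proof -
    have "AE x in lborel_on a b. ereal \<bar>g x\<bar> \<le> Linf_norm (lborel_on a b) g"
      unfolding Linf_norm_def by (rule esssup_AE)
    then show ?thesis
      by eventually_elim (use that in \<open>metis order_trans ereal_less_eq(3)\<close>)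
  qed
  obtain z where z: "z \<in> {a..b}" "\<bar>f z\<bar> \<le> C" using AE_lborel_on_witness[OF \<open>a < b\<close> AE[OF norms(1)]] by blast
  show C: "0 \<le> C" using z(2) by linarith
  show "\<bar>f x - f y\<bar> \<le> C * \<bar>x - y\<bar>"
    by (rule lipschitz_from_AE_derivative_bound[OF diff C AE[OF norms(2)] xy])
  have "\<bar>f x - f z\<bar> \<le> C * \<bar>x - z\<bar>"
    by (rule lipschitz_from_AE_derivative_bound[OF diff C AE[OF norms(2)] xy(1) z(1)])
  also have "\<dots> \<le> C * (b - a)" using xy(1) z(1) C by (intro mult_left_mono) auto
  finally show "\<bar>f x\<bar> \<le> C + C * (b - a)" using z(2) by linarith
qed

text \<open>The infimum may be infinite, as for \<open>min_sep\<close> with \<open>K = 1\<close>, so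
  a real number strictly between 0 and it serves as the constant.\<close>

lemma ereal_INF_pos_obtains:
  fixes F :: "'t \<Rightarrow> ereal"
  assumes "(INF \<theta>\<in>U. F \<theta>) > 0"
  obtains c where "c > 0" "\<And>\<theta>. \<theta> \<in> U \<Longrightarrow> ereal c \<le> F \<theta>"
proof -
  obtain c where c: "0 < ereal c" "ereal c < (INF \<theta>\<in>U. F \<theta>)" using ereal_dense2[OF assms] by blast
  show ?thesis
  proof (rule that)
    show "c > 0" using c(1) by simp
    show "ereal c \<le> F \<theta>" if "\<theta> \<in> U" for \<theta>
      by (rule order_trans[OF less_imp_le[OF c(2)] INF_lower[OF that]])
  qed
qed

lemma ereal_SUP_finite_obtains:
  fixes F :: "'t \<Rightarrow> ereal"
  assumes "(SUP \<theta>\<in>U. F \<theta>) < \<infinity>"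
  obtains C where "\<And>\<theta>. \<theta> \<in> U \<Longrightarrow> F \<theta> \<le> ereal C"
proof -
  obtain C where C: "(SUP \<theta>\<in>U. F \<theta>) < ereal C" using ereal_dense2[OF assms] by blast
  show ?thesis
    by (rule that[of C]) (meson SUP_upper C less_imp_le order_trans)
qed

lemma min_sep_le:
  assumes "j \<in> {1..K}" "k \<in> {1..K}" "j \<noteq> k"
  shows "min_sep K c \<le> ereal \<bar>c j - c k\<bar>"
  unfolding min_sep_def
  by (rule INF_lower2[of "(j, k)"]) (use assms in auto)

text \<open>\<open>from_nat\<close> enumerates the triples of two rationals and a flag. The flag
  selects the real or the imaginary part of the truncated exponential, since Hoeffding's inequality
  is applied to real tests with values in [-1, 1].\<close>

definition mixture_test :: "nat \<Rightarrow> real \<times> real \<Rightarrow> real" where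
  "mixture_test i z = (case (from_nat i :: rat \<times> rat \<times> bool) of (q, t, s) \<Rightarrow>
     indicator {..of_rat q} (fst z) * (if s then cos (of_rat t * snd z) else sin (of_rat t * snd z)))"

lemma mixture_test_le: "\<bar>mixture_test i z\<bar> \<le> 1"
  unfolding mixture_test_def by (auto split: prod.split simp: indicator_def)

lemma measurable_mixture_test:
  "mixture_test i \<in> borel_measurable (restrict_space borel {a..b} \<Otimes>\<^sub>M borel)"
proof -
  obtain q t s where qts: "(from_nat i :: rat \<times> rat \<times> bool) = (q, t, s)" by (cases "from_nat i :: rat \<times> rat \<times> bool")
  have [measurable]: "(\<lambda>x. indicator {..of_rat q} x :: real) \<in> borel_measurable (restrict_space borel {a..b})"
    by (intro measurable_restrict_space1) simp
  show ?thesis unfolding mixture_test_def[abs_def] qts prod.case by measurable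
qed

text \<open>The indices are fixed before the measure \<open>M\<close>, so the same two tests give
  the complex moment under every parameter at once.\<close>

lemma mixture_test_integrals:
  assumes "q \<in> \<rat>" "t \<in> \<rat>"
  obtains i j where "\<And>M :: (real \<times> real) measure. prob_space M \<Longrightarrow> sets M = sets (restrict_space borel {a..b} \<Otimes>\<^sub>M borel) \<Longrightarrow>
    (\<integral>z. indicator {..q} (fst z) *\<^sub>R iexp (t * snd z) \<partial>M)
      = Complex (\<integral>z. mixture_test i z \<partial>M) (\<integral>z. mixture_test j z \<partial>M)"
proof -
  obtain q' t' where q': "q = of_rat q'" and t': "t = of_rat t'"
    using assms by (auto elim!: Rats_cases)
  show ?thesis
  proof (rule that[of "to_nat (q', t', True)" "to_nat (q', t', False)"])
    fix M :: "(real \<times> real) measure" assume "prob_space M" and sets: "sets M = sets (restrict_space borel {a..b} \<Otimes>\<^sub>M borel)"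
    then interpret prob_space M by simp
    let ?f = "\<lambda>z. indicator {..q} (fst z) *\<^sub>R iexp (t * snd z)"
    have "?f \<in> borel_measurable (restrict_space borel {a..b} \<Otimes>\<^sub>M borel)"
    proof -
      have [measurable]: "(\<lambda>x. indicator {..q} x :: real) \<in> borel_measurable (restrict_space borel {a..b})"
        by (intro measurable_restrict_space1) simp
      show ?thesis by measurable
    qed
    then have "?f \<in> borel_measurable M" by (simp only: measurable_cong_sets[OF sets refl])
    then have int: "integrable M ?f"
      by (intro integrable_const_bound[of _ 1]) (auto simp: indicator_def)
    show "(\<integral>z. ?f z \<partial>M) = Complex (\<integral>z. mixture_test (to_nat (q', t', True)) z \<partial>M)
        (\<integral>z. mixture_test (to_nat (q', t', False)) z \<partial>M)"
    proof (rule complex_eqI)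
      have "Re (\<integral>z. ?f z \<partial>M) = (\<integral>z. Re (?f z) \<partial>M)" by (rule integral_Re[OF int, symmetric])
      also have "\<dots> = (\<integral>z. mixture_test (to_nat (q', t', True)) z \<partial>M)"
        by (intro Bochner_Integration.integral_cong refl) (simp add: mixture_test_def q' t' Re_exp)
      finally show "Re (\<integral>z. ?f z \<partial>M) = Re (Complex (\<integral>z. mixture_test (to_nat (q', t', True)) z \<partial>M)
        (\<integral>z. mixture_test (to_nat (q', t', False)) z \<partial>M))" by simp
      have "Im (\<integral>z. ?f z \<partial>M) = (\<integral>z. Im (?f z) \<partial>M)" by (rule integral_Im[OF int, symmetric])
      also have "\<dots> = (\<integral>z. mixture_test (to_nat (q', t', False)) z \<partial>M)"
        by (intro Bochner_Integration.integral_cong refl) (simp add: mixture_test_def q' t' Im_exp)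
      finally show "Im (\<integral>z. ?f z \<partial>M) = Im (Complex (\<integral>z. mixture_test (to_nat (q', t', True)) z \<partial>M)
        (\<integral>z. mixture_test (to_nat (q', t', False)) z \<partial>M))" by simp
    qed
  qed
qed

section \<open>From the model class to the compact class, and from a selection to estimators\<close>

lemma model_classD:
  assumes "\<theta> \<in> model_class a b K \<sigma> x0"
  shows "prob_density (lborel_on a b) (covdens \<theta>)" "has_bochner_integral lborel (\<lambda>y. y * errdens \<theta> y) 0"
    "Min (wt \<theta> ` {1..K}) > 0" "(\<Sum>k\<in>{1..K}. wt \<theta> k) = 1"
    "k \<in> {1..K} \<Longrightarrow> continuous_on {a..b} (reg \<theta> k)"
proof -
  note * = assms[unfolded model_class_def mem_Collect_eq]
  show "prob_density (lborel_on a b) (covdens \<theta>)" using * by (elim conjE)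
  show "has_bochner_integral lborel (\<lambda>y. y * errdens \<theta> y) 0" using * by (elim conjE)
  show "Min (wt \<theta> ` {1..K}) > 0" using * by (elim conjE)
  show "(\<Sum>k\<in>{1..K}. wt \<theta> k) = 1" using * by (elim conjE)
  have "\<forall>k\<in>{1..K}. continuous_on {a..b} (reg \<theta> k)" using * by (elim conjE)
  then show "k \<in> {1..K} \<Longrightarrow> continuous_on {a..b} (reg \<theta> k)" by (rule bspec)
qed

text \<open>The observed law is a sum over components and does not see their order, so its moments
  may be written with the components sorted by weight.\<close>

lemma (in joint_model) integral_joint_law_mixture_moment:
  assumes \<pi>: "\<pi> permutes {1..K}" and p: "\<And>x. x \<in> {a..b} \<Longrightarrow> covdens \<theta> x = p x"
  shows "(\<integral>z. indicator {..q} (fst z) *\<^sub>R iexp (t * snd z) \<partial>joint_law a b K \<theta>)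
    = char (density lborel (\<lambda>z. ennreal (normal_density 0 \<sigma> z))) t *
      mixture_moment a b K p G (\<lambda>k. wt \<theta> (\<pi> k)) (\<lambda>k. reg \<theta> (\<pi> k)) q t"
proof -
  have "(\<Sum>k\<in>{1..K}. wt \<theta> k * iexp (t * reg \<theta> k x)) = (\<Sum>k\<in>{1..K}. wt \<theta> (\<pi> k) * iexp (t * reg \<theta> (\<pi> k) x))" for x
    using sum.permute[OF \<pi>, of "\<lambda>k. wt \<theta> k * iexp (t * reg \<theta> k x)"] by (simp only: comp_def)
  then show ?thesis
    unfolding integral_joint_law_iexp mixture_moment_def
    by (intro arg_cong2[where f = "(*)"] refl Bochner_Integration.integral_cong)
       (simp only: p space_lborel_on)
qed

text \<open>The convex hull of the support plays the role of \<open>{\<alpha>..\<beta>}\<close>.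
  Being at most as long as the diameter, it inherits the separation, and since it contains 0 its end
  points are bounded by \<open>D\<close>. Sorting the weights turns their absolute gap into the
  signed one.\<close>

lemma (in mixture_class) model_member:
  assumes \<theta>: "\<theta> \<in> model_class a b K \<sigma> x0" and mix: "is_mixing_measure \<sigma> (errdens \<theta>) G" and \<sigma>: "\<sigma> > 0"
    and diam: "diameter (measure_support G) \<le> D"
    and diff: "\<And>k. k \<in> {1..K} \<Longrightarrow> reg \<theta> k differentiable_on {a..b}"
    and norms: "\<And>k. k \<in> {1..K} \<Longrightarrow> Linf_norm (lborel_on a b) (reg \<theta> k) \<le> ereal C"
      "\<And>k. k \<in> {1..K} \<Longrightarrow> Linf_norm (lborel_on a b) (deriv_on a b (reg \<theta> k)) \<le> ereal C"
    and B: "B = C + C * (b - a)"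
    and wts: "\<And>k. k \<in> {1..K} \<Longrightarrow> c \<le> wt \<theta> k"
      "\<And>j k. j \<in> {1..K} \<Longrightarrow> k \<in> {1..K} \<Longrightarrow> j \<noteq> k \<Longrightarrow> c \<le> \<bar>wt \<theta> j - wt \<theta> k\<bar>"
    and sep: "\<And>j k. j \<in> {1..K} \<Longrightarrow> k \<in> {1..K} \<Longrightarrow> j \<noteq> k \<Longrightarrow>
      2 * diameter (measure_support G) + c \<le> \<bar>reg \<theta> j x0 - reg \<theta> k x0\<bar>"
    and Jb: "\<And>t. J t \<le> cmod (char G t)"
    and \<pi>: "\<pi> permutes {1..K}" and mono: "strict_mono_on {1..K} (\<lambda>k. wt \<theta> (\<pi> k))"
  shows "member G (\<lambda>k. wt \<theta> (\<pi> k)) (\<lambda>k. reg \<theta> (\<pi> k))"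
proof -
  have G: "real_distribution G" and comp: "compact (measure_support G)" and f: "errdens \<theta> = gauss_conv \<sigma> G"
    using mix by (simp_all add: is_mixing_measure_def)
  have model: "has_bochner_integral lborel (\<lambda>y. y * errdens \<theta> y) 0" "(\<Sum>k\<in>{1..K}. wt \<theta> k) = 1"
    by (rule model_classD[OF \<theta>])+
  have \<pi>in: "\<pi> k \<in> {1..K}" if "k \<in> {1..K}" for k using permutes_in_image[OF \<pi>] that by simp
  have \<pi>inj: "\<pi> j \<noteq> \<pi> k" if "j \<noteq> k" for j k using permutes_inj[OF \<pi>] that by (auto dest: injD)
  obtain \<alpha> \<beta> where ab1: "AE x in G. x \<in> {\<alpha>..\<beta>}" "\<beta> - \<alpha> \<le> diameter (measure_support G)"
    using measure_support_interval[OF G comp] by blast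
  have mean: "(\<integral>x. x \<partial>G) = 0"
  proof (rule mixing_measure_mean[OF G \<sigma>])
    show "AE x in G. \<bar>x\<bar> \<le> max \<bar>\<alpha>\<bar> \<bar>\<beta>\<bar>" using ab1(1) by eventually_elim auto
    show "has_bochner_integral lborel (\<lambda>y. y * gauss_conv \<sigma> G y) 0" using model(1) by (simp only: f)
  qed
  note cen = centred_interval[OF G ab1(1) mean]
  show ?thesis
    unfolding member_def
  proof (intro conjI allI ballI impI exI)
    show "real_distribution G" "(\<integral>x. x \<partial>G) = 0" "AE x in G. x \<in> {\<alpha>..\<beta>}" by (rule G mean ab1)+
    show "\<bar>\<alpha>\<bar> \<le> D" "\<bar>\<beta>\<bar> \<le> D" using cen ab1(2) diam by linarith+
    show "2 * (\<beta> - \<alpha>) + c \<le> \<bar>reg \<theta> (\<pi> j) x0 - reg \<theta> (\<pi> k) x0\<bar>"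
      if "j \<in> {1..K}" "k \<in> {1..K}" "j \<noteq> k" for j k
      by (rule order_trans[OF add_right_mono[OF mult_left_mono[OF ab1(2)]] sep[OF \<pi>in[OF that(1)] \<pi>in[OF that(2)] \<pi>inj[OF that(3)]]]) simp
    show "J t \<le> cmod (char G t)" for t by (rule Jb)
    show "c \<le> wt \<theta> (\<pi> k)" if "k \<in> {1..K}" for k by (rule wts(1)[OF \<pi>in[OF that]])
    show "(\<Sum>k\<in>{1..K}. wt \<theta> (\<pi> k)) = 1"
      using sum.permute[OF \<pi>, of "wt \<theta>"] model(2) by (simp only: comp_def)
    show "wt \<theta> (\<pi> j) + c \<le> wt \<theta> (\<pi> k)" if "j \<in> {1..K}" "k \<in> {1..K}" "j < k" for j k
    proof -
      have "wt \<theta> (\<pi> j) < wt \<theta> (\<pi> k)" by (rule strict_mono_onD[OF mono that])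
      moreover have "\<pi> j \<noteq> \<pi> k" using \<pi>inj that(3) by simp
      then have "c \<le> \<bar>wt \<theta> (\<pi> j) - wt \<theta> (\<pi> k)\<bar>" by (rule wts(2)[OF \<pi>in[OF that(1)] \<pi>in[OF that(2)]])
      ultimately show ?thesis by linarith
    qed
    show "\<bar>reg \<theta> (\<pi> k) x\<bar> \<le> B" if "k \<in> {1..K}" "x \<in> {a..b}" for k x
      using regression_bounds(1)[OF ab diff norms, OF \<pi>in \<pi>in \<pi>in, OF that(1) that(1) that(1) that(2) that(2)] B by simp
    show "\<bar>reg \<theta> (\<pi> k) x - reg \<theta> (\<pi> k) y\<bar> \<le> B * \<bar>x - y\<bar>"
      if "k \<in> {1..K}" "x \<in> {a..b}" "y \<in> {a..b}" for k x y
    proof -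
      note rb = regression_bounds(2,3)[OF ab diff norms, OF \<pi>in \<pi>in \<pi>in, OF that(1) that(1) that(1) that(2) that(3)]
      have "C * \<bar>x - y\<bar> \<le> B * \<bar>x - y\<bar>"
        unfolding B using rb(2) ab by (intro mult_right_mono) auto
      then show ?thesis using rb(1) by linarith
    qed
  qed
qed

lemma joint_model_of_model_class:
  assumes \<theta>: "\<theta> \<in> model_class a b K \<sigma> x0" and mix: "is_mixing_measure \<sigma> (errdens \<theta>) G" and "\<sigma> > 0"
  shows "joint_model a b \<sigma> K \<theta> G"
proof (rule joint_model.intro)
  have m: "prob_density (lborel_on a b) (covdens \<theta>)" "Min (wt \<theta> ` {1..K}) > 0" "(\<Sum>k\<in>{1..K}. wt \<theta> k) = 1"
    by (rule model_classD[OF \<theta>])+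
  show "real_distribution G" "errdens \<theta> = gauss_conv \<sigma> G" using mix by (simp_all add: is_mixing_measure_def)
  show "\<sigma> > 0" "prob_density (lborel_on a b) (covdens \<theta>)" "(\<Sum>k\<in>{1..K}. wt \<theta> k) = 1" by (rule \<open>\<sigma> > 0\<close> m)+
  show "continuous_on {a..b} (reg \<theta> k)" if "k \<in> {1..K}" for k by (rule model_classD(5)[OF \<theta> that])
  show "0 \<le> wt \<theta> k" if "k \<in> {1..K}" for k
  proof -
    have "Min (wt \<theta> ` {1..K}) \<le> wt \<theta> k" using that by (intro Min_le) auto
    then show ?thesis using m(2) by linarith
  qed
qed

text \<open>The selector takes countably many values, so joint measurability reduces to
  measurability of each candidate function.\<close>

lemma function_estimator_selection:
  fixes c :: "nat \<Rightarrow> 't" and T :: "'t \<Rightarrow> real \<Rightarrow> real"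
  assumes S: "S \<in> measurable (sample_space a b n) (count_space UNIV)"
    and T: "\<And>j. T (c j) \<in> borel_measurable (restrict_space borel A)"
  shows "function_estimator a b n A (\<lambda>\<omega>. T (c (S \<omega>)))"
proof -
  have "(\<lambda>z. T (c (S (fst z))) (snd z)) \<in> borel_measurable (sample_space a b n \<Otimes>\<^sub>M restrict_space borel A)"
    by (rule measurable_compose_countable[of "\<lambda>j z. T (c j) (snd z)"])
       (use measurable_compose[OF measurable_snd T] measurable_compose[OF measurable_fst S] in auto)
  then show ?thesis unfolding function_estimator_def by (simp add: split_beta')
qed

lemma scalar_estimator_selection:
  assumes S: "S \<in> measurable (sample_space a b n) (count_space UNIV)"
  shows "scalar_estimator a b n (\<lambda>\<omega>. T (c (S \<omega>)))"
  unfolding scalar_estimator_def by (rule measurable_compose[OF S]) simp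

text \<open>All estimators are read off from one selected element of \<open>U\<close>: its error
  density, and its weights and regression functions in increasing order of the weights. The loss
  compares two parameters, so consistency of the selection is already the claim.\<close>

theorem theorem4p1:
  fixes a b \<sigma> x0 :: real and K :: nat and pX :: "real \<Rightarrow> real"
    and U :: "mixreg set" and G0 :: "mixreg \<Rightarrow> real measure"
    and J :: "real \<Rightarrow> real" and \<pi> :: "mixreg \<Rightarrow> nat \<Rightarrow> nat"
  assumes "a < b" and "K \<ge> 1" and "\<sigma> > 0" and "x0 \<in> {a..b}"
    and pX: "prob_density (lborel_on a b) pX" "(INF x\<in>{a..b}. pX x) > 0"
      "pX differentiable_on {a..b}"
      "max (Linf_norm (lborel_on a b) pX) (Linf_norm (lborel_on a b) (deriv_on a b pX)) < \<infinity>"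
    and U: "U \<subseteq> model_class a b K \<sigma> x0"
      "\<And>\<theta> x. \<theta> \<in> U \<Longrightarrow> x \<in> {a..b} \<Longrightarrow> covdens \<theta> x = pX x"
      "\<And>\<theta>. \<theta> \<in> U \<Longrightarrow> is_mixing_measure \<sigma> (errdens \<theta>) (G0 \<theta>)"
    and C1: "(SUP \<theta>\<in>U. ereal (diameter (measure_support (G0 \<theta>)))) < \<infinity>"
      "\<And>\<theta> k. \<theta> \<in> U \<Longrightarrow> k \<in> {1..K} \<Longrightarrow> reg \<theta> k differentiable_on {a..b}"
      "(SUP \<theta>\<in>U. max (Max ((\<lambda>k. Linf_norm (lborel_on a b) (reg \<theta> k)) ` {1..K}))
          (Max ((\<lambda>k. Linf_norm (lborel_on a b) (deriv_on a b (reg \<theta> k))) ` {1..K}))) < \<infinity>"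
    and C2: "(INF \<theta>\<in>U. ereal (Min (wt \<theta> ` {1..K}))) > 0"
      "(INF \<theta>\<in>U. min_sep K (wt \<theta>)) > 0"
    and C3: "(INF \<theta>\<in>U. min_sep K (\<lambda>k. reg \<theta> k x0)
          - ereal (2 * diameter (measure_support (G0 \<theta>)))) > 0"
    and C4: "\<And>t. J t > 0" "\<And>t. (INF \<theta>\<in>U. ereal (cmod (char (G0 \<theta>) t))) \<ge> ereal (J t)"
    and C5: "\<And>s :: nat \<Rightarrow> real. s \<longlonglongrightarrow> 0 \<Longrightarrow>
      (\<lambda>n. SUP \<theta>\<in>U. emeasure lborel {x\<in>{a..b}. \<exists>j\<in>{1..K}. \<exists>k\<in>{1..K}.
          j \<noteq> k \<and> \<bar>reg \<theta> j x - reg \<theta> k x\<bar> \<le> s n}) \<longlonglongrightarrow> 0"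
    and ordering: "\<And>\<theta>. \<theta> \<in> U \<Longrightarrow>
      \<pi> \<theta> permutes {1..K} \<and> strict_mono_on {1..K} (\<lambda>k. wt \<theta> (\<pi> \<theta> k))"
  shows "\<exists>(fh :: nat \<Rightarrow> (nat \<Rightarrow> real \<times> real) \<Rightarrow> real \<Rightarrow> real)
          (lh :: nat \<Rightarrow> nat \<Rightarrow> (nat \<Rightarrow> real \<times> real) \<Rightarrow> real)
          (mh :: nat \<Rightarrow> nat \<Rightarrow> (nat \<Rightarrow> real \<times> real) \<Rightarrow> real \<Rightarrow> real).
      (\<forall>n. function_estimator a b n UNIV (fh n)) \<and>
      (\<forall>n. \<forall>k\<in>{1..K}. scalar_estimator a b n (lh n k)) \<and>
      (\<forall>n. \<forall>k\<in>{1..K}. function_estimator a b n {a..b} (mh n k)) \<and>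
      (\<forall>\<epsilon>>0. (\<lambda>n. SUP \<theta>\<in>U. emeasure (sample_law a b K n \<theta>)
         {\<omega> \<in> space (sample_law a b K n \<theta>).
            max (L1_norm lborel (\<lambda>y. fh n \<omega> y - errdens \<theta> y))
              (max (Max ((\<lambda>k. ennreal \<bar>lh n k \<omega> - wt \<theta> (\<pi> \<theta> k)\<bar>) ` {1..K}))
                (Max ((\<lambda>k. L1_norm (lborel_on a b) (\<lambda>x. mh n k \<omega> x - reg \<theta> (\<pi> \<theta> k) x)) ` {1..K})))
            > ennreal \<epsilon>}) \<longlonglongrightarrow> 0)"
proof (cases "U = {}")
  case True
  \<comment> \<open>A supremum over the empty family is \<open>bot\<close>, which is 0, so constant
    estimators do. Otherwise \<open>U\<close> supplies the candidates.\<close>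
  then show ?thesis
    by (intro exI[of _ "\<lambda>_ _ _. 0"] exI[of _ "\<lambda>_ _ _. 0"] exI[of _ "\<lambda>_ _ _ _. 0"])
       (simp add: function_estimator_def scalar_estimator_def case_prod_unfold bot_ennreal)
next
  case False
  obtain D where D: "\<And>\<theta>. \<theta> \<in> U \<Longrightarrow> ereal (diameter (measure_support (G0 \<theta>))) \<le> ereal D"
    using ereal_SUP_finite_obtains[OF C1(1)] by blast
  obtain C where C: "\<And>\<theta>. \<theta> \<in> U \<Longrightarrow> max (Max ((\<lambda>k. Linf_norm (lborel_on a b) (reg \<theta> k)) ` {1..K}))
          (Max ((\<lambda>k. Linf_norm (lborel_on a b) (deriv_on a b (reg \<theta> k))) ` {1..K})) \<le> ereal C"
    using ereal_SUP_finite_obtains[OF C1(3)] by blast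
  obtain c1 where c1: "c1 > 0" "\<And>\<theta>. \<theta> \<in> U \<Longrightarrow> ereal c1 \<le> ereal (Min (wt \<theta> ` {1..K}))"
    using ereal_INF_pos_obtains[OF C2(1)] by blast
  obtain c2 where c2: "c2 > 0" "\<And>\<theta>. \<theta> \<in> U \<Longrightarrow> ereal c2 \<le> min_sep K (wt \<theta>)"
    using ereal_INF_pos_obtains[OF C2(2)] by blast
  obtain c3 where c3: "c3 > 0" "\<And>\<theta>. \<theta> \<in> U \<Longrightarrow> ereal c3 \<le> min_sep K (\<lambda>k. reg \<theta> k x0)
          - ereal (2 * diameter (measure_support (G0 \<theta>)))"
    using ereal_INF_pos_obtains[OF C3] by blast
  \<comment> \<open>One margin serves the weights, their gaps and the separation at
    \<open>x0\<close>, because each of these inequalities in \<open>member\<close> only weakens when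
    \<open>c\<close> shrinks.\<close>
  define c where "c = min c1 (min c2 c3)"
  have c: "c > 0" "c \<le> c1" "c \<le> c2" "c \<le> c3" using c1(1) c2(1) c3(1) by (auto simp: c_def)
  define B where "B = C + C * (b - a)"
  interpret MC: mixture_class a b x0 B c D K J
    by unfold_locales (rule \<open>a < b\<close> \<open>x0 \<in> {a..b}\<close> c(1) C4(1))+
  define l where "l \<theta> k = wt \<theta> (\<pi> \<theta> k)" for \<theta> k
  define m where "m \<theta> k = reg \<theta> (\<pi> \<theta> k)" for \<theta> k
  have norms: "Linf_norm (lborel_on a b) (reg \<theta> k) \<le> ereal C"
      "Linf_norm (lborel_on a b) (deriv_on a b (reg \<theta> k)) \<le> ereal C" if "\<theta> \<in> U" "k \<in> {1..K}" for \<theta> k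
  proof -
    have "Linf_norm (lborel_on a b) (reg \<theta> k) \<le> Max ((\<lambda>k. Linf_norm (lborel_on a b) (reg \<theta> k)) ` {1..K})"
      by (rule Max_ge) (use that(2) in auto)
    then show "Linf_norm (lborel_on a b) (reg \<theta> k) \<le> ereal C" using C[OF that(1)] by (meson max.boundedE order_trans)
    have "Linf_norm (lborel_on a b) (deriv_on a b (reg \<theta> k))
        \<le> Max ((\<lambda>k. Linf_norm (lborel_on a b) (deriv_on a b (reg \<theta> k))) ` {1..K})"
      by (rule Max_ge) (use that(2) in auto)
    then show "Linf_norm (lborel_on a b) (deriv_on a b (reg \<theta> k)) \<le> ereal C"
      using C[OF that(1)] by (meson max.boundedE order_trans)
  qed
  have mem: "MC.member (G0 \<theta>) (l \<theta>) (m \<theta>)" if \<theta>: "\<theta> \<in> U" for \<theta>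
    unfolding l_def m_def
  proof (rule MC.model_member[OF subsetD[OF U(1) \<theta>] U(3)[OF \<theta>] \<open>\<sigma> > 0\<close> _ C1(2)[OF \<theta>] norms[OF \<theta>] B_def])
    show "diameter (measure_support (G0 \<theta>)) \<le> D" using D[OF \<theta>] by simp
    show "c \<le> wt \<theta> k" if "k \<in> {1..K}" for k
    proof -
      have "Min (wt \<theta> ` {1..K}) \<le> wt \<theta> k" using that by (intro Min_le) auto
      moreover have "c1 \<le> Min (wt \<theta> ` {1..K})" using c1(2)[OF \<theta>] by (simp only: ereal_less_eq)
      ultimately show ?thesis using c(2) by linarith
    qed
    show "c \<le> \<bar>wt \<theta> j - wt \<theta> k\<bar>" if "j \<in> {1..K}" "k \<in> {1..K}" "j \<noteq> k" for j k
      using order_trans[OF c2(2)[OF \<theta>] min_sep_le[OF that]] c(3) by simp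
    show "2 * diameter (measure_support (G0 \<theta>)) + c \<le> \<bar>reg \<theta> j x0 - reg \<theta> k x0\<bar>"
      if "j \<in> {1..K}" "k \<in> {1..K}" "j \<noteq> k" for j k
    proof -
      have "ereal c3 \<le> ereal \<bar>reg \<theta> j x0 - reg \<theta> k x0\<bar> - ereal (2 * diameter (measure_support (G0 \<theta>)))"
        by (rule order_trans[OF c3(2)[OF \<theta>] ereal_minus_mono[OF min_sep_le[OF that, of "\<lambda>k. reg \<theta> k x0"] order_refl]])
      then have "c3 \<le> \<bar>reg \<theta> j x0 - reg \<theta> k x0\<bar> - 2 * diameter (measure_support (G0 \<theta>))" by simp
      then show ?thesis using c(4) by simp
    qed
    show "J t \<le> cmod (char (G0 \<theta>) t)" for t
    proof -
      have "ereal (J t) \<le> ereal (cmod (char (G0 \<theta>) t))"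
        by (rule order_trans[OF C4(2) INF_lower[OF \<theta>]])
      then show ?thesis by simp
    qed
    show "\<pi> \<theta> permutes {1..K}" "strict_mono_on {1..K} (\<lambda>k. wt \<theta> (\<pi> \<theta> k))"
      using ordering[OF \<theta>] by blast+
  qed
  have JM: "joint_model a b \<sigma> K \<theta> (G0 \<theta>)" if "\<theta> \<in> U" for \<theta>
    by (rule joint_model_of_model_class[OF subsetD[OF U(1) that] U(3)[OF that] \<open>\<sigma> > 0\<close>])
  have pcont: "continuous_on {a..b} pX" using pX(3) by (rule differentiable_imp_continuous_on)
  have ppos: "0 < pX x" if "x \<in> {a..b}" for x
  proof -
    \<comment> \<open>The real-valued \<open>INF\<close> is a lower bound only for an image bounded
      below, which continuity on the compact interval provides.\<close>
    have "bdd_below (pX ` {a..b})"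
      by (intro bounded_imp_bdd_below compact_imp_bounded compact_continuous_image pcont) simp
    then have "(INF x\<in>{a..b}. pX x) \<le> pX x" by (rule cINF_lower[OF _ that])
    then show ?thesis using pX(2) by linarith
  qed
  \<comment> \<open>Near-coincidence of some pair of components does not depend on how they are
    labelled, so (C5) carries over to the sorted components.\<close>
  have sep: "(\<lambda>n. SUP \<theta>\<in>U. emeasure lborel {x\<in>{a..b}. \<exists>j\<in>{1..K}. \<exists>k\<in>{1..K}.
          j \<noteq> k \<and> \<bar>m \<theta> j x - m \<theta> k x\<bar> \<le> s n}) \<longlonglongrightarrow> 0" if "s \<longlonglongrightarrow> 0" for s :: "nat \<Rightarrow> real"
  proof -
    have "{x\<in>{a..b}. \<exists>j\<in>{1..K}. \<exists>k\<in>{1..K}. j \<noteq> k \<and> \<bar>m \<theta> j x - m \<theta> k x\<bar> \<le> u}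
      = {x\<in>{a..b}. \<exists>j\<in>{1..K}. \<exists>k\<in>{1..K}. j \<noteq> k \<and> \<bar>reg \<theta> j x - reg \<theta> k x\<bar> \<le> u}" if \<theta>: "\<theta> \<in> U" for \<theta> u
    proof -
      have p: "\<pi> \<theta> permutes {1..K}" using ordering[OF \<theta>] by blast
      have "(\<exists>j\<in>{1..K}. \<exists>k\<in>{1..K}. j \<noteq> k \<and> \<bar>m \<theta> j x - m \<theta> k x\<bar> \<le> u)
        \<longleftrightarrow> (\<exists>j\<in>\<pi> \<theta> ` {1..K}. \<exists>k\<in>\<pi> \<theta> ` {1..K}. j \<noteq> k \<and> \<bar>reg \<theta> j x - reg \<theta> k x\<bar> \<le> u)" for x
        unfolding m_def Set.bex_simps(7) inj_eq[OF permutes_inj[OF p]] by (rule refl)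
      then show ?thesis by (simp only: permutes_image[OF p])
    qed
    then have "(SUP \<theta>\<in>U. emeasure lborel {x\<in>{a..b}. \<exists>j\<in>{1..K}. \<exists>k\<in>{1..K}. j \<noteq> k \<and> \<bar>m \<theta> j x - m \<theta> k x\<bar> \<le> s n})
      = (SUP \<theta>\<in>U. emeasure lborel {x\<in>{a..b}. \<exists>j\<in>{1..K}. \<exists>k\<in>{1..K}. j \<noteq> k \<and> \<bar>reg \<theta> j x - reg \<theta> k x\<bar> \<le> s n})" for n
      by (intro SUP_cong refl arg_cong[where f = "emeasure lborel"])
    then show ?thesis using C5[OF that] by (simp only:)
  qed
  let ?N = "\<lambda>t. char (density lborel (\<lambda>z. ennreal (normal_density 0 \<sigma> z))) t"
  define M where "M = restrict_space borel {a..b} \<Otimes>\<^sub>M (borel :: real measure)"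
  define T where "T i \<theta> = (\<integral>z. mixture_test i z \<partial>joint_law a b K \<theta>)" for i \<theta>
  have P: "prob_space (joint_law a b K \<theta>)" "sets (joint_law a b K \<theta>) = sets M" if "\<theta> \<in> U" for \<theta>
    using joint_model.prob_space_joint_law[OF JM[OF that]] joint_model.sets_joint_law[OF JM[OF that]]
    by (simp_all only: M_def)
  have moments: "\<exists>i j. \<forall>\<theta>\<in>U. ?N t * mixture_moment a b K pX (G0 \<theta>) (l \<theta>) (m \<theta>) q t = Complex (T i \<theta>) (T j \<theta>)"
    if qt: "q \<in> \<rat>" "t \<in> \<rat>" for q t
  proof -
    obtain i j where ij: "\<And>Q :: (real \<times> real) measure. prob_space Q \<Longrightarrow> sets Q = sets M \<Longrightarrow>
      (\<integral>z. indicator {..q} (fst z) *\<^sub>R iexp (t * snd z) \<partial>Q)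
        = Complex (\<integral>z. mixture_test i z \<partial>Q) (\<integral>z. mixture_test j z \<partial>Q)"
      using mixture_test_integrals[OF qt, of a b] unfolding M_def by blast
    have "?N t * mixture_moment a b K pX (G0 \<theta>) (l \<theta>) (m \<theta>) q t = Complex (T i \<theta>) (T j \<theta>)" if \<theta>: "\<theta> \<in> U" for \<theta>
    proof -
      have p: "\<pi> \<theta> permutes {1..K}" using ordering[OF \<theta>] by blast
      show ?thesis
        unfolding T_def ij[OF P[OF \<theta>], symmetric]
        using joint_model.integral_joint_law_mixture_moment[OF JM[OF \<theta>] p U(2)[OF \<theta>], of q t]
        by (simp only: l_def[abs_def] m_def[abs_def])
    qed
    then show ?thesis by blast
  qed
  define loss where "loss \<theta> \<theta>' = max (L1_norm lborel (\<lambda>y. errdens \<theta> y - errdens \<theta>' y))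
     (max (Max ((\<lambda>k. ennreal \<bar>l \<theta> k - l \<theta>' k\<bar>) ` {1..K}))
      (Max ((\<lambda>k. L1_norm (lborel_on a b) (\<lambda>x. m \<theta> k x - m \<theta>' k x)) ` {1..K})))" for \<theta> \<theta>'
  have f: "errdens \<theta> = gauss_conv \<sigma> (G0 \<theta>)" if "\<theta> \<in> U" for \<theta>
    using U(3)[OF that] by (simp add: is_mixing_measure_def)
  have ident: "\<exists>(N::nat) \<delta>. \<delta> > 0 \<and> (\<forall>\<theta>\<in>U. \<forall>\<theta>'\<in>U.
      (\<forall>i<N. \<bar>(\<integral>z. mixture_test i z \<partial>joint_law a b K \<theta>) - (\<integral>z. mixture_test i z \<partial>joint_law a b K \<theta>')\<bar> \<le> \<delta>)
      \<longrightarrow> loss \<theta> \<theta>' \<le> ennreal \<epsilon>)" if \<epsilon>: "\<epsilon> > 0" for \<epsilon>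
  proof -
    have "\<exists>(N::nat) \<delta>. \<delta> > 0 \<and> (\<forall>\<theta>\<in>U. \<forall>\<theta>'\<in>U. (\<forall>i<N. \<bar>T i \<theta> - T i \<theta>'\<bar> \<le> \<delta>) \<longrightarrow>
        max (L1_norm lborel (\<lambda>y. gauss_conv \<sigma> (G0 \<theta>) y - gauss_conv \<sigma> (G0 \<theta>') y))
         (max (Max ((\<lambda>k. ennreal \<bar>l \<theta> k - l \<theta>' k\<bar>) ` {1..K}))
          (Max ((\<lambda>k. L1_norm (lborel_on a b) (\<lambda>x. m \<theta> k x - m \<theta>' k x)) ` {1..K}))) \<le> ennreal \<epsilon>)"
      by (rule MC.uniform_identifiability[OF \<open>K \<ge> 1\<close> \<open>\<sigma> > 0\<close> mem sep pcont ppos char_normal_nonzero[OF \<open>\<sigma> > 0\<close>] moments \<epsilon>])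
    then obtain N :: nat and \<delta> where \<delta>: "\<delta> > 0" and N: "\<forall>\<theta>\<in>U. \<forall>\<theta>'\<in>U. (\<forall>i<N. \<bar>T i \<theta> - T i \<theta>'\<bar> \<le> \<delta>) \<longrightarrow>
        max (L1_norm lborel (\<lambda>y. gauss_conv \<sigma> (G0 \<theta>) y - gauss_conv \<sigma> (G0 \<theta>') y))
         (max (Max ((\<lambda>k. ennreal \<bar>l \<theta> k - l \<theta>' k\<bar>) ` {1..K}))
          (Max ((\<lambda>k. L1_norm (lborel_on a b) (\<lambda>x. m \<theta> k x - m \<theta>' k x)) ` {1..K}))) \<le> ennreal \<epsilon>"
      by (elim exE conjE)
    show ?thesis
    proof (intro exI[of _ N] exI[of _ \<delta>] conjI \<delta> ballI impI)
      fix \<theta> \<theta>' assume \<theta>: "\<theta> \<in> U" "\<theta>' \<in> U"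
        and "\<forall>i<N. \<bar>(\<integral>z. mixture_test i z \<partial>joint_law a b K \<theta>) - (\<integral>z. mixture_test i z \<partial>joint_law a b K \<theta>')\<bar> \<le> \<delta>"
      then have "\<forall>i<N. \<bar>T i \<theta> - T i \<theta>'\<bar> \<le> \<delta>" by (simp only: T_def)
      with bspec[OF bspec[OF N \<theta>(1)] \<theta>(2)] show "loss \<theta> \<theta>' \<le> ennreal \<epsilon>"
        unfolding loss_def f[OF \<theta>(1)] f[OF \<theta>(2)] by (rule mp)
    qed
  qed
  have test: "mixture_test i \<in> borel_measurable M" "\<bar>mixture_test i z\<bar> \<le> 1" for i z
    unfolding M_def by (rule measurable_mixture_test mixture_test_le)+
  have "\<exists>(e :: nat \<Rightarrow> mixreg) (S :: nat \<Rightarrow> (nat \<Rightarrow> real \<times> real) \<Rightarrow> nat).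
    range e \<subseteq> U \<and> (\<forall>n. S n \<in> measurable (\<Pi>\<^sub>M i\<in>{1..n}. M) (count_space UNIV)) \<and>
    (\<forall>\<epsilon>>0. (\<lambda>n. SUP \<theta>\<in>U. emeasure (\<Pi>\<^sub>M i\<in>{1..n}. joint_law a b K \<theta>)
      {\<omega> \<in> space (\<Pi>\<^sub>M i\<in>{1..n}. joint_law a b K \<theta>). loss (e (S n \<omega>)) \<theta> > ennreal \<epsilon>}) \<longlonglongrightarrow> 0)"
  proof (rule uniformly_consistent_selection[OF False P test ident])
    fix e :: "nat \<Rightarrow> mixreg" and S :: "nat \<Rightarrow> (nat \<Rightarrow> real \<times> real) \<Rightarrow> nat"
    assume "range e \<subseteq> U" "\<And>n. S n \<in> measurable (\<Pi>\<^sub>M i\<in>{1..n}. M) (count_space UNIV)"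
      "\<And>\<epsilon>. \<epsilon> > 0 \<Longrightarrow> (\<lambda>n. SUP \<theta>\<in>U. emeasure (\<Pi>\<^sub>M i\<in>{1..n}. joint_law a b K \<theta>)
      {\<omega> \<in> space (\<Pi>\<^sub>M i\<in>{1..n}. joint_law a b K \<theta>). loss (e (S n \<omega>)) \<theta> > ennreal \<epsilon>}) \<longlonglongrightarrow> 0"
    then show ?thesis by (intro exI[of _ e] exI[of _ S] conjI allI impI)
  qed assumption+
  then obtain e :: "nat \<Rightarrow> mixreg" and S :: "nat \<Rightarrow> (nat \<Rightarrow> real \<times> real) \<Rightarrow> nat"
    where e: "range e \<subseteq> U" and S: "\<forall>n. S n \<in> measurable (\<Pi>\<^sub>M i\<in>{1..n}. M) (count_space UNIV)"
    and cons: "\<forall>\<epsilon>>0. (\<lambda>n. SUP \<theta>\<in>U. emeasure (\<Pi>\<^sub>M i\<in>{1..n}. joint_law a b K \<theta>)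
      {\<omega> \<in> space (\<Pi>\<^sub>M i\<in>{1..n}. joint_law a b K \<theta>). loss (e (S n \<omega>)) \<theta> > ennreal \<epsilon>}) \<longlonglongrightarrow> 0"
    by (elim exE conjE)
  have S: "S n \<in> measurable (sample_space a b n) (count_space UNIV)" for n
    using spec[OF S, of n] by (simp only: sample_space_def M_def)
  have eU: "e j \<in> U" for j using e by blast
  show ?thesis
  proof (intro exI conjI allI ballI impI)
    show "function_estimator a b n UNIV (\<lambda>\<omega>. errdens (e (S n \<omega>)))" for n
      by (rule function_estimator_selection[OF S])
         (use joint_model.measurable_err[OF JM[OF eU]] in \<open>simp add: measurable_restrict_space1\<close>)
    show "scalar_estimator a b n (\<lambda>\<omega>. l (e (S n \<omega>)) k)" for n k
      by (rule scalar_estimator_selection[OF S])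
    show "function_estimator a b n {a..b} (\<lambda>\<omega>. m (e (S n \<omega>)) k)" if "k \<in> {1..K}" for n k
      by (rule function_estimator_selection[OF S, where T = "\<lambda>\<theta>. m \<theta> k"],
          rule borel_measurable_continuous_on_restrict, rule MC.member_continuous_on[OF mem[OF eU] that])
    show "(\<lambda>n. SUP \<theta>\<in>U. emeasure (sample_law a b K n \<theta>)
         {\<omega> \<in> space (sample_law a b K n \<theta>).
            max (L1_norm lborel (\<lambda>y. errdens (e (S n \<omega>)) y - errdens \<theta> y))
              (max (Max ((\<lambda>k. ennreal \<bar>l (e (S n \<omega>)) k - wt \<theta> (\<pi> \<theta> k)\<bar>) ` {1..K}))
                (Max ((\<lambda>k. L1_norm (lborel_on a b) (\<lambda>x. m (e (S n \<omega>)) k x - reg \<theta> (\<pi> \<theta> k) x)) ` {1..K})))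
            > ennreal \<epsilon>}) \<longlonglongrightarrow> 0" if "\<epsilon> > 0" for \<epsilon>
      using mp[OF spec[OF cons] that] unfolding loss_def sample_law_def l_def m_def .
  qed
qed

end
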